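(* Let $X$ be a compact complex manifold of dimension $d$, let $\hat\omega$ be the canonical form of $K_X$, and let $G=\mathrm{Aut}\,X$, $H=\mathbb C^\times$. Then: (1) $\hat\omega$ is invariant under $G$. (2) For $h\in H$ we have $\Gamma_h\hat\omega=\chi_1(h)\hat\omega$, where $\chi_1(h)=h$. Therefore $(\hat\omega,\chi_1)$ is a $G$-equivariant CY structure on the principal bundle $\mathbb C^\times-K_X^\times\to X$. (3) In particular, $\iota_{x_0}\hat\omega$ defines a $G$-invariant $\mathbb C^\times$-horizontal $d$-form on $K_X^\times$, where $x_0$ is the vector field generated by $-1\in\mathbb C=\mathrm{Lie}(H)$. (4) In the local coordinates $(z_w,w)$ on $K_X$ induced by local coordinates $w=(w_1,\dots,w_d)$ on $X$, $$\iota_{x_0}\hat\omega=z_w\,dw_1\wedge\cdots\wedge dw_d .$$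
   Context: Let $\pi:K_X\to X$ be the total space of the canonical bundle. A coordinate chart $w=(w_1,\dots,w_d):U\to\mathbb C^d$ on $X$ induces the chart $(z_w,w):\pi^{-1}(U)\to\mathbb C\times\mathbb C^d$, $\eta\mapsto(\eta(\tfrac{\partial}{\partial w_1},\dots,\tfrac{\partial}{\partial w_d}),w(\pi\eta))$. The canonical form $\hat\omega$ of $K_X$ is the nowhere vanishing holomorphic top form on the total space $K_X$ given on each such $\pi^{-1}(U)$ by $\hat\omega=dz_w\wedge dw_1\wedge\cdots\wedge dw_d$; it is independent of the chart, hence globally defined. $K_X^\times$ is the complement of the zero section, with $h\in H=\mathbb C^\times$ acting by $h\cdot m=mh^{-1}$ (fiberwise scaling by $h^{-1}$). $G$ acts on $K_X$ by the natural lift of its action on $X$ (transport of top forms). For $k$ in $G$ or $H$ and a form $\omega$, $\Gamma_k\omega:=(k^{-1})^*\omega$, where $k^{-1}$ denotes the inverse of the transformation by which $k$ acts. The vector field $x_0$ generated by $-1$ is $(x_0)_m=\frac{d}{dt}\big|_{t=0}\exp(-t)\cdot m=\frac{d}{dt}\big|_{t=0}e^{t}m$. A $G$-equivariant CY structure on a $G$-equivariant principal $H$-bundle $M\to X$ is a pair $(\omega,\chi)$ with $\omega$ a nowhere vanishing $G$-invariant holomorphic top form on $M$ and $\chi:H\to\mathbb C^\times$ a holomorphic homomorphism with $\Gamma_h\omega=\chi(h)\omega$ for all $h\in H$. A form is $\mathbb C^\times$-horizontal if it is annihilated by interior multiplication with the vector fields generated by the $\mathbb C^\times$-action. *)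

theory Defs
  imports "HOL-Analysis.Analysis" "HOL-Algebra.Group_Action"
begin

section \<open>Holomorphic functions of several variables\<close>

text \<open>
  The model space is \<^typ>\<open>complex ^ 'n\<close>, so complex dimensions are \<open>CARD('n)\<close>.  On open sets (the only
  sets used below) complex differentiability at every point is the usual notion of holomorphy.
\<close>

definition holo_fun_on :: "(complex ^ 'n::finite) set \<Rightarrow> (complex ^ 'n \<Rightarrow> complex) \<Rightarrow> bool" where
  "holo_fun_on S f \<longleftrightarrow>
     (\<forall>x\<in>S. \<exists>D. (f has_derivative D) (at x) \<and> (\<forall>a v. D (a *s v) = a * D v))"

definition holo_map_on ::
  "(complex ^ 'n::finite) set \<Rightarrow> (complex ^ 'n \<Rightarrow> complex ^ 'm::finite) \<Rightarrow> bool" where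
  "holo_map_on S f \<longleftrightarrow> (\<forall>i. holo_fun_on S (\<lambda>x. f x $ i))"


section \<open>Complex manifolds\<close>

text \<open>A chart is a domain together with a map; the values of the map off the domain are irrelevant.\<close>

type_synonym ('a, 'n) chart = "'a set \<times> ('a \<Rightarrow> complex ^ 'n)"

datatype ('a, 'n::finite) cmanifold =
  CManifold (mtop: "'a topology") (atlas: "('a, 'n) chart set")

abbreviation points :: "('a, 'n::finite) cmanifold \<Rightarrow> 'a set" where
  "points M \<equiv> topspace (mtop M)"

definition chart_inv :: "('a, 'n::finite) chart \<Rightarrow> complex ^ 'n \<Rightarrow> 'a" where
  "chart_inv c = inv_into (fst c) (snd c)"

definition transition :: "('a, 'n::finite) chart \<Rightarrow> ('a, 'n) chart \<Rightarrow> complex ^ 'n \<Rightarrow> complex ^ 'n" where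
  "transition c c' = snd c' \<circ> chart_inv c"

definition topological_chart :: "'a topology \<Rightarrow> ('a, 'n::finite) chart \<Rightarrow> bool" where
  "topological_chart T c \<longleftrightarrow>
     openin T (fst c) \<and> open (snd c ` fst c) \<and>
     homeomorphic_map (subtopology T (fst c)) (top_of_set (snd c ` fst c)) (snd c)"

definition compatible :: "('a, 'n::finite) chart \<Rightarrow> ('a, 'n) chart \<Rightarrow> bool" where
  "compatible c c' \<longleftrightarrow>
     holo_map_on (snd c ` (fst c \<inter> fst c')) (transition c c') \<and>
     holo_map_on (snd c' ` (fst c \<inter> fst c')) (transition c' c)"

definition complex_manifold :: "('a, 'n::finite) cmanifold \<Rightarrow> bool" where
  "complex_manifold M \<longleftrightarrow>
     Hausdorff_space (mtop M) \<and> second_countable (mtop M) \<and>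
     (\<forall>c\<in>atlas M. topological_chart (mtop M) c) \<and>
     \<Union> (fst ` atlas M) = points M \<and>
     (\<forall>c\<in>atlas M. \<forall>c'\<in>atlas M. compatible c c')"

text \<open>All coordinate charts, that is, the maximal atlas.\<close>

definition charts :: "('a, 'n::finite) cmanifold \<Rightarrow> ('a, 'n) chart set" where
  "charts M = {c. topological_chart (mtop M) c \<and> (\<forall>b\<in>atlas M. compatible b c)}"

definition charts_at :: "('a, 'n::finite) cmanifold \<Rightarrow> 'a \<Rightarrow> ('a, 'n) chart set" where
  "charts_at M p = {c \<in> charts M. p \<in> fst c}"

definition holomorphic_map ::
  "('a, 'n::finite) cmanifold \<Rightarrow> ('b, 'm::finite) cmanifold \<Rightarrow> ('a \<Rightarrow> 'b) \<Rightarrow> bool" where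
  "holomorphic_map M N f \<longleftrightarrow>
     continuous_map (mtop M) (mtop N) f \<and>
     (\<forall>b\<in>charts M. \<forall>c\<in>charts N.
        holo_map_on (snd b ` {p \<in> fst b. f p \<in> fst c}) (snd c \<circ> f \<circ> chart_inv b))"

definition biholomorphic ::
  "('a, 'n::finite) cmanifold \<Rightarrow> ('b, 'm::finite) cmanifold \<Rightarrow> ('a \<Rightarrow> 'b) \<Rightarrow> bool" where
  "biholomorphic M N f \<longleftrightarrow>
     bij_betw f (points M) (points N) \<and> holomorphic_map M N f \<and>
     holomorphic_map N M (inv_into (points M) f)"

definition open_submanifold :: "('a, 'n::finite) cmanifold \<Rightarrow> 'a set \<Rightarrow> ('a, 'n) cmanifold" where
  "open_submanifold M W =
     CManifold (subtopology (mtop M) W) ((\<lambda>(U, \<phi>). (U \<inter> W, \<phi>)) ` atlas M)"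

definition prod_manifold ::
  "('a, 'n::finite) cmanifold \<Rightarrow> ('b, 'm::finite) cmanifold \<Rightarrow> ('a \<times> 'b, 'n + 'm) cmanifold" where
  "prod_manifold M N =
     CManifold (prod_topology (mtop M) (mtop N))
       {(U \<times> V, \<lambda>(x, y). \<chi> k. case k of Inl i \<Rightarrow> \<phi> x $ i | Inr j \<Rightarrow> \<psi> y $ j) | U \<phi> V \<psi>.
          (U, \<phi>) \<in> atlas M \<and> (V, \<psi>) \<in> atlas N}"


section \<open>Tangent vectors and differentials\<close>

text \<open>
  A holomorphic tangent vector at \<open>p\<close> is the family of its component vectors in all charts around \<open>p\<close>,
  subject to the transformation law by Jacobians of transition maps; it is normalised to be \<open>0\<close>
  at charts not containing \<open>p\<close>.  Addition and scalar multiplication are pointwise.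
\<close>

type_synonym ('a, 'n) tvec = "('a, 'n) chart \<Rightarrow> complex ^ 'n"

definition tangent_space :: "('a, 'n::finite) cmanifold \<Rightarrow> 'a \<Rightarrow> ('a, 'n) tvec set" where
  "tangent_space M p =
     {v. (\<forall>c. c \<notin> charts_at M p \<longrightarrow> v c = 0) \<and>
         (\<forall>c\<in>charts_at M p. \<forall>c'\<in>charts_at M p.
            v c' = frechet_derivative (transition c c') (at (snd c p)) (v c))}"

text \<open>The coordinate vector \<open>\<partial>/\<partial>w\<^sub>i\<close> at \<open>p\<close> for the chart \<open>c = (U, w)\<close>.\<close>

definition coord_vec :: "('a, 'n::finite) cmanifold \<Rightarrow> ('a, 'n) chart \<Rightarrow> 'a \<Rightarrow> 'n \<Rightarrow> ('a, 'n) tvec" where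
  "coord_vec M c p i =
     (\<lambda>c'. if c' \<in> charts_at M p
           then frechet_derivative (transition c c') (at (snd c p)) (axis i 1) else 0)"

text \<open>The differential of \<open>f\<close> at \<open>p\<close>; it does not depend on the auxiliary chart \<open>b\<close>.\<close>

definition differential ::
  "('a, 'n::finite) cmanifold \<Rightarrow> ('b, 'm::finite) cmanifold \<Rightarrow> ('a \<Rightarrow> 'b) \<Rightarrow> 'a \<Rightarrow>
   ('a, 'n) tvec \<Rightarrow> ('b, 'm) tvec" where
  "differential M N f p v =
     (let b = (SOME b. b \<in> charts_at M p) in
      (\<lambda>c. if c \<in> charts_at N (f p)
           then frechet_derivative (snd c \<circ> f \<circ> chart_inv b) (at (snd b p)) (v b) else 0))"

definition velocity :: "('a, 'n::finite) cmanifold \<Rightarrow> (real \<Rightarrow> 'a) \<Rightarrow> ('a, 'n) tvec" where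
  "velocity M \<gamma> =
     (\<lambda>c. if c \<in> charts_at M (\<gamma> 0) then vector_derivative (\<lambda>t. snd c (\<gamma> t)) (at 0) else 0)"


section \<open>Differential forms\<close>

text \<open>
  The \<open>CARD('k)\<close>-forms (of type \<open>(CARD('k), 0)\<close>) are realised as functions of families of tangent
  vectors indexed by \<^typ>\<open>'k\<close>.  All multilinear forms are \<open>0\<close> outside the tangent space, and all
  differential forms are \<open>0\<close> outside the manifold.  When \<^typ>\<open>'k\<close> is also the index type of the model
  space, these are the top forms.
\<close>

type_synonym ('a, 'n, 'k) mform = "('k \<Rightarrow> ('a, 'n) tvec) \<Rightarrow> complex"

definition alternating_forms ::
  "('a, 'n::finite) cmanifold \<Rightarrow> 'a \<Rightarrow> ('a, 'n, 'k::finite) mform set" where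
  "alternating_forms M p =
     {\<eta>. (\<forall>v. (\<exists>i. v i \<notin> tangent_space M p) \<longrightarrow> \<eta> v = 0) \<and>
         (\<forall>v i x y a b. (\<forall>j. v j \<in> tangent_space M p) \<longrightarrow>
            x \<in> tangent_space M p \<longrightarrow> y \<in> tangent_space M p \<longrightarrow>
            \<eta> (v(i := (\<lambda>c. a *s x c + b *s y c))) = a * \<eta> (v(i := x)) + b * \<eta> (v(i := y))) \<and>
         (\<forall>v i j. (\<forall>l. v l \<in> tangent_space M p) \<longrightarrow> i \<noteq> j \<longrightarrow> v i = v j \<longrightarrow> \<eta> v = 0)}"

definition holomorphic_form ::
  "('a, 'n::finite) cmanifold \<Rightarrow> ('a \<Rightarrow> ('a, 'n, 'k::finite) mform) \<Rightarrow> bool" where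
  "holomorphic_form M \<omega> \<longleftrightarrow>
     (\<forall>p\<in>points M. \<omega> p \<in> alternating_forms M p) \<and>
     (\<forall>p. p \<notin> points M \<longrightarrow> \<omega> p = (\<lambda>v. 0)) \<and>
     (\<forall>c\<in>charts M. \<forall>I :: 'k \<Rightarrow> 'n.
        holo_fun_on (snd c ` fst c)
          (\<lambda>u. \<omega> (chart_inv c u) (\<lambda>k. coord_vec M c (chart_inv c u) (I k))))"

definition nowhere_vanishing ::
  "('a, 'n::finite) cmanifold \<Rightarrow> ('a \<Rightarrow> ('a, 'n, 'k::finite) mform) \<Rightarrow> bool" where
  "nowhere_vanishing M \<omega> \<longleftrightarrow> (\<forall>p\<in>points M. \<omega> p \<noteq> (\<lambda>v. 0))"

definition scale_form ::
  "complex \<Rightarrow> ('a \<Rightarrow> ('a, 'n, 'k) mform) \<Rightarrow> 'a \<Rightarrow> ('a, 'n, 'k) mform" where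
  "scale_form a \<omega> = (\<lambda>p v. a * \<omega> p v)"

definition pullback ::
  "('a, 'n::finite) cmanifold \<Rightarrow> ('b, 'm::finite) cmanifold \<Rightarrow> ('a \<Rightarrow> 'b) \<Rightarrow>
   ('b \<Rightarrow> ('b, 'm, 'k::finite) mform) \<Rightarrow> 'a \<Rightarrow> ('a, 'n, 'k) mform" where
  "pullback M N f \<omega> =
     (\<lambda>p v. if p \<in> points M \<and> (\<forall>k. v k \<in> tangent_space M p)
            then \<omega> (f p) (\<lambda>k. differential M N f p (v k)) else 0)"

text \<open>
  Interior multiplication inserts the vector field in the first slot, here the slot \<^const>\<open>None\<close>
  of forms whose slots are indexed by \<^typ>\<open>'k option\<close>.
\<close>

definition interior_mult ::
  "('a, 'n::finite) cmanifold \<Rightarrow> ('a \<Rightarrow> ('a, 'n) tvec) \<Rightarrow>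
   ('a \<Rightarrow> ('a, 'n, 'k::finite option) mform) \<Rightarrow> 'a \<Rightarrow> ('a, 'n, 'k) mform" where
  "interior_mult M x \<omega> =
     (\<lambda>p v. if p \<in> points M \<and> (\<forall>k. v k \<in> tangent_space M p)
            then \<omega> p (case_option (x p) v) else 0)"

text \<open>
  The wedge product over \<open>k\<close> of the coordinate differentials \<open>dw\<^bsub>I k\<^esub>\<close> of the chart \<open>c = (U, w)\<close>:
  its value on vectors \<open>v\<^sub>l\<close> is \<open>det (dw\<^bsub>I k\<^esub> (v\<^sub>l))\<close>, and \<open>dw\<^sub>i (v)\<close> is the \<open>i\<close>-th component of \<open>v\<close> in \<open>c\<close>.
  As factors and slots have the same index type, no ordering of that type has to be chosen.
\<close>

definition wedge_coords ::
  "('a, 'n::finite) cmanifold \<Rightarrow> ('a, 'n) chart \<Rightarrow> ('k::finite \<Rightarrow> 'n) \<Rightarrow> 'a \<Rightarrow> ('a, 'n, 'k) mform" where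
  "wedge_coords M c I =
     (\<lambda>p v. if p \<in> fst c \<and> (\<forall>k. v k \<in> tangent_space M p)
            then det (\<chi> k l. v l c $ I k) else 0)"


section \<open>Group actions, equivariant bundles and CY structures\<close>

text \<open>
  For a group element \<open>k\<close> acting through the transformation \<open>\<rho> k\<close>, the operator \<open>\<Gamma>\<^sub>k\<close> is the pullback
  by the inverse transformation.
\<close>

definition Gam ::
  "('a, 'n::finite) cmanifold \<Rightarrow> ('g \<Rightarrow> 'a \<Rightarrow> 'a) \<Rightarrow> 'g \<Rightarrow>
   ('a \<Rightarrow> ('a, 'n, 'k::finite) mform) \<Rightarrow> 'a \<Rightarrow> ('a, 'n, 'k) mform" where
  "Gam M \<rho> k \<omega> = pullback M M (inv_into (points M) (\<rho> k)) \<omega>"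

definition complex_lie_group :: "'h monoid \<Rightarrow> ('h, 'l::finite) cmanifold \<Rightarrow> bool" where
  "complex_lie_group H HM \<longleftrightarrow>
     group H \<and> complex_manifold HM \<and> points HM = carrier H \<and>
     holomorphic_map (prod_manifold HM HM) HM (\<lambda>(a, b). a \<otimes>\<^bsub>H\<^esub> b) \<and>
     holomorphic_map HM HM (\<lambda>a. inv\<^bsub>H\<^esub> a)"

text \<open>
  The left action \<open>\<rho>\<close> and the principal right action are related by \<open>\<rho> h m = m h\<^sup>-\<^sup>1\<close>; hence a right
  equivariant local trivialisation turns \<open>\<rho> h\<close> into right multiplication by the inverse of \<open>h\<close>.
\<close>

definition principal_bundle ::
  "'h monoid \<Rightarrow> ('h, 'l::finite) cmanifold \<Rightarrow> ('h \<Rightarrow> 'm \<Rightarrow> 'm) \<Rightarrow>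
   ('m, 'e::finite) cmanifold \<Rightarrow> ('a, 'n::finite) cmanifold \<Rightarrow> ('m \<Rightarrow> 'a) \<Rightarrow> bool" where
  "principal_bundle H HM \<rho> M X \<pi> \<longleftrightarrow>
     complex_lie_group H HM \<and> complex_manifold M \<and> complex_manifold X \<and>
     holomorphic_map M X \<pi> \<and> group_action H (points M) \<rho> \<and>
     (\<forall>h\<in>carrier H. \<forall>m\<in>points M. \<pi> (\<rho> h m) = \<pi> m) \<and>
     (\<forall>x\<in>points X. \<exists>U \<Phi>. openin (mtop X) U \<and> x \<in> U \<and>
        biholomorphic (open_submanifold M {m \<in> points M. \<pi> m \<in> U})
          (prod_manifold (open_submanifold X U) HM) \<Phi> \<and>
        (\<forall>m\<in>points M. \<pi> m \<in> U \<longrightarrow> fst (\<Phi> m) = \<pi> m) \<and>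
        (\<forall>h\<in>carrier H. \<forall>m\<in>points M. \<pi> m \<in> U \<longrightarrow>
           \<Phi> (\<rho> h m) = (\<pi> m, snd (\<Phi> m) \<otimes>\<^bsub>H\<^esub> inv\<^bsub>H\<^esub> h)))"

definition equivariant_principal_bundle ::
  "'g monoid \<Rightarrow> ('g \<Rightarrow> 'm \<Rightarrow> 'm) \<Rightarrow> ('g \<Rightarrow> 'a \<Rightarrow> 'a) \<Rightarrow>
   'h monoid \<Rightarrow> ('h, 'l::finite) cmanifold \<Rightarrow> ('h \<Rightarrow> 'm \<Rightarrow> 'm) \<Rightarrow>
   ('m, 'e::finite) cmanifold \<Rightarrow> ('a, 'n::finite) cmanifold \<Rightarrow> ('m \<Rightarrow> 'a) \<Rightarrow> bool" where
  "equivariant_principal_bundle G \<alpha>M \<alpha>X H HM \<rho> M X \<pi> \<longleftrightarrow>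
     principal_bundle H HM \<rho> M X \<pi> \<and>
     group_action G (points M) \<alpha>M \<and> group_action G (points X) \<alpha>X \<and>
     (\<forall>g\<in>carrier G. biholomorphic M M (\<alpha>M g) \<and> biholomorphic X X (\<alpha>X g) \<and>
        (\<forall>m\<in>points M. \<pi> (\<alpha>M g m) = \<alpha>X g (\<pi> m)) \<and>
        (\<forall>h\<in>carrier H. \<forall>m\<in>points M. \<alpha>M g (\<rho> h m) = \<rho> h (\<alpha>M g m)))"

definition Cstar :: "complex monoid" where
  "Cstar = \<lparr>carrier = UNIV - {0}, mult = (*), one = 1\<rparr>"

definition Cstar_manifold :: "(complex, 1) cmanifold" where
  "Cstar_manifold = CManifold (top_of_set (UNIV - {0})) {(UNIV - {0}, \<lambda>z. \<chi> i. z)}"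

definition equivariant_CY_structure ::
  "'g monoid \<Rightarrow> ('g \<Rightarrow> 'm \<Rightarrow> 'm) \<Rightarrow> ('g \<Rightarrow> 'a \<Rightarrow> 'a) \<Rightarrow>
   'h monoid \<Rightarrow> ('h, 'l::finite) cmanifold \<Rightarrow> ('h \<Rightarrow> 'm \<Rightarrow> 'm) \<Rightarrow>
   ('m, 'e::finite) cmanifold \<Rightarrow> ('a, 'n::finite) cmanifold \<Rightarrow> ('m \<Rightarrow> 'a) \<Rightarrow>
   ('m \<Rightarrow> ('m, 'e, 'e) mform) \<Rightarrow> ('h \<Rightarrow> complex) \<Rightarrow> bool" where
  "equivariant_CY_structure G \<alpha>M \<alpha>X H HM \<rho> M X \<pi> \<omega> \<chi>' \<longleftrightarrow>
     equivariant_principal_bundle G \<alpha>M \<alpha>X H HM \<rho> M X \<pi> \<and>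
     holomorphic_form M \<omega> \<and> nowhere_vanishing M \<omega> \<and>
     (\<forall>g\<in>carrier G. Gam M \<alpha>M g \<omega> = \<omega>) \<and>
     \<chi>' \<in> hom H Cstar \<and> holomorphic_map HM Cstar_manifold \<chi>' \<and>
     (\<forall>h\<in>carrier H. Gam M \<rho> h \<omega> = scale_form (\<chi>' h) \<omega>)"

text \<open>
  The vector field generated by \<open>\<xi> \<in> \<complex> = Lie(\<complex>\<^sup>\<times>)\<close>, with value \<open>d/dt exp(t \<xi>)\<cdot>m\<close> at \<open>t = 0\<close>.
\<close>

definition generated_field ::
  "('a, 'n::finite) cmanifold \<Rightarrow> (complex \<Rightarrow> 'a \<Rightarrow> 'a) \<Rightarrow> complex \<Rightarrow> 'a \<Rightarrow> ('a, 'n) tvec" where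
  "generated_field M \<rho> \<xi> = (\<lambda>m. velocity M (\<lambda>t. \<rho> (exp (of_real t * \<xi>)) m))"

text \<open>
  For an alternating form, vanishing under interior multiplication does not depend on the slot into
  which the vector field is inserted, so all slots are allowed here.
\<close>

definition Cstar_horizontal ::
  "('a, 'n::finite) cmanifold \<Rightarrow> (complex \<Rightarrow> 'a \<Rightarrow> 'a) \<Rightarrow>
   ('a \<Rightarrow> ('a, 'n, 'k::finite) mform) \<Rightarrow> bool" where
  "Cstar_horizontal M \<rho> \<theta> \<longleftrightarrow>
     (\<forall>\<xi>. \<forall>p\<in>points M. \<forall>v k. (\<forall>l. v l \<in> tangent_space M p) \<longrightarrow>
        \<theta> p (v(k := generated_field M \<rho> \<xi> p)) = 0)"


section \<open>The canonical bundle\<close>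

text \<open>
  Points of the total space of the canonical bundle are pairs \<open>(p, \<eta>)\<close> with \<open>\<eta>\<close> a top form on the
  tangent space at \<open>p\<close>; the projection is \<^const>\<open>fst\<close>.  The model space of the total space has
  index type \<^typ>\<open>'d option\<close>, the coordinate \<^const>\<open>None\<close> being the fibre coordinate \<open>z\<^sub>w\<close> and the
  coordinates \<open>Some i\<close> being \<open>w\<^sub>i\<close>.
\<close>

type_synonym ('a, 'd) kpoint = "'a \<times> ('a, 'd, 'd) mform"

definition KX_points :: "('a, 'd::finite) cmanifold \<Rightarrow> ('a, 'd) kpoint set" where
  "KX_points X = {(p, \<eta>). p \<in> points X \<and> \<eta> \<in> alternating_forms X p}"

definition fibre_coord ::
  "('a, 'd::finite) cmanifold \<Rightarrow> ('a, 'd) chart \<Rightarrow> ('a, 'd) kpoint \<Rightarrow> complex" where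
  "fibre_coord X c m = snd m (\<lambda>i. coord_vec X c (fst m) i)"

definition induced_chart ::
  "('a, 'd::finite) cmanifold \<Rightarrow> ('a, 'd) chart \<Rightarrow> (('a, 'd) kpoint, 'd option) chart" where
  "induced_chart X c =
     ({m \<in> KX_points X. fst m \<in> fst c},
      \<lambda>m. \<chi> k. case k of None \<Rightarrow> fibre_coord X c m | Some i \<Rightarrow> snd c (fst m) $ i)"

definition KX :: "('a, 'd::finite) cmanifold \<Rightarrow> (('a, 'd) kpoint, 'd option) cmanifold" where
  "KX X = CManifold
     (topology (\<lambda>S. S \<subseteq> KX_points X \<and>
        (\<forall>c\<in>charts X. open (snd (induced_chart X c) ` (S \<inter> fst (induced_chart X c))))))
     (induced_chart X ` charts X)"

definition KX_times :: "('a, 'd::finite) cmanifold \<Rightarrow> (('a, 'd) kpoint, 'd option) cmanifold" where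
  "KX_times X = open_submanifold (KX X) {m \<in> KX_points X. snd m \<noteq> (\<lambda>v. 0)}"

definition canonical_form ::
  "('a, 'd::finite) cmanifold \<Rightarrow> ('a, 'd) kpoint \<Rightarrow> (('a, 'd) kpoint, 'd option, 'd option) mform" where
  "canonical_form X =
     (THE \<omega>. holomorphic_form (KX X) \<omega> \<and>
        (\<forall>c\<in>charts X. \<forall>m\<in>fst (induced_chart X c).
           \<omega> m = wedge_coords (KX X) (induced_chart X c) (\<lambda>k. k) m))"

text \<open>Restriction of forms to \<open>K\<^sub>X\<^sup>\<times>\<close> is pullback along the inclusion.\<close>

definition restrict_to_KX_times ::
  "('a, 'd::finite) cmanifold \<Rightarrow> (('a, 'd) kpoint \<Rightarrow> (('a, 'd) kpoint, 'd option, 'k::finite) mform) \<Rightarrow>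
   ('a, 'd) kpoint \<Rightarrow> (('a, 'd) kpoint, 'd option, 'k) mform" where
  "restrict_to_KX_times X \<omega> = pullback (KX_times X) (KX X) (\<lambda>m. m) \<omega>"

text \<open>The group \<open>Aut X\<close> of biholomorphic transformations, as a subgroup of all bijections.\<close>

definition Aut :: "('a, 'd::finite) cmanifold \<Rightarrow> ('a \<Rightarrow> 'a) monoid" where
  "Aut X = BijGroup (points X) \<lparr>carrier := {f \<in> Bij (points X). biholomorphic X X f}\<rparr>"

text \<open>
  The natural lift of \<open>g\<close> transports \<open>\<eta>\<close> at \<open>p\<close> to its pullback by the inverse of \<open>g\<close> at \<open>g p\<close>.  Both
  actions below take as additional argument the manifold \<open>M\<close> (\<open>K\<^sub>X\<close> or \<open>K\<^sub>X\<^sup>\<times>\<close>) on which they are considered.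
\<close>

definition lift_action ::
  "('a, 'd::finite) cmanifold \<Rightarrow> (('a, 'd) kpoint, 'd option) cmanifold \<Rightarrow>
   ('a \<Rightarrow> 'a) \<Rightarrow> ('a, 'd) kpoint \<Rightarrow> ('a, 'd) kpoint" where
  "lift_action X M g =
     (\<lambda>m\<in>points M.
        (g (fst m),
         \<lambda>v. if \<forall>i. v i \<in> tangent_space X (g (fst m))
             then snd m (\<lambda>i. differential X X (inv_into (points X) g) (g (fst m)) (v i)) else 0))"

text \<open>The action \<open>h\<cdot>m = m h\<^sup>-\<^sup>1\<close>.\<close>

definition scaling_action ::
  "(('a, 'd::finite) kpoint, 'd option) cmanifold \<Rightarrow> complex \<Rightarrow> ('a, 'd) kpoint \<Rightarrow> ('a, 'd) kpoint" where
  "scaling_action M h = (\<lambda>m\<in>points M. (fst m, \<lambda>v. snd m v * inverse h))"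

definition x0 ::
  "(('a, 'd::finite) kpoint, 'd option) cmanifold \<Rightarrow> ('a, 'd) kpoint \<Rightarrow> (('a, 'd) kpoint, 'd option) tvec" where
  "x0 M = generated_field M (scaling_action M) (-1)"

end

theory Submission
  imports Defs "HOL-Complex_Analysis.Cauchy_Integral_Formula"
begin

text \<open>
  Near every point the canonical bundle has the coordinates \<open>(z\<^sub>w, w)\<close>, and the theorem is a statement
  about the form \<open>dz\<^sub>w \<and> dw\<^sub>1 \<and> \<dots> \<and> dw\<^sub>d\<close>.  Two observations carry the proof.

  First, passing from \<open>w\<close> to \<open>w'\<close> changes the fibre coordinate by \<open>z' = z det (\<partial>w/\<partial>w')\<close>, while \<open>w'\<close> does not
  depend on \<open>z\<close>.  The Jacobian matrix of \<open>(z, w) \<mapsto> (z', w')\<close> is therefore block triangular with diagonal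
  blocks \<open>det (\<partial>w/\<partial>w')\<close> and \<open>\<partial>w'/\<partial>w\<close>, and its determinant is \<open>1\<close> (\<open>jdet_induced\<close>).  Hence the local
  forms agree on overlaps and glue to one holomorphic form \<open>vol\<close>, which is the canonical form
  (\<open>canonical_form_eq_vol\<close>).

  Second, each map that matters has the shape \<open>(z, w) \<mapsto> (a z, w)\<close> in suitable induced charts
  (\<open>fibre_scaling\<close>), and such a map multiplies \<open>dz \<and> dw\<close> by \<open>a\<close> (\<open>pullback_vol\<close>).  For the scaling
  action this is clear, with \<open>a = h\<close> for the inverse of the action of \<open>h\<close>; for the inclusion of \<open>K\<^sub>X\<^sup>\<times>\<close>
  it holds with \<open>a = 1\<close>.  For the lift of an automorphism \<open>g\<close>, the chart \<open>w\<close> around \<open>p\<close> is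
  carried to the chart \<open>w \<circ> g\<^sup>-\<^sup>1\<close> around \<open>g p\<close>; in the two induced charts the lift is the identity, so \<open>a = 1\<close>
  (\<open>lift_point_eq\<close>).  This gives the invariance under automorphisms and the character of the scaling
  action, and also shows without further computation that lifts and scalings are holomorphic.

  The field \<open>x\<^sub>0\<close> has the components \<open>(z, 0)\<close>, so expanding the determinant along its column yields
  \<open>\<iota> vol = z dw\<^sub>1 \<and> \<dots> \<and> dw\<^sub>d\<close> (\<open>horizontal_form_eq\<close>).  Holomorphy, horizontality and invariance of the
  contracted form are read off from this expression.

  What remains is that \<open>K\<^sub>X\<close> is a complex manifold and \<open>K\<^sub>X\<^sup>\<times>\<close> a principal bundle.  The transition
  maps of \<open>K\<^sub>X\<close> contain derivatives of those of \<open>X\<close>, so it is needed that derivatives of holomorphic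
  functions of several variables are holomorphic (\<open>holo_fun_on_frechet_derivative\<close>); this follows from
  the Cauchy formula in one complex direction and differentiation under the integral sign.  That the
  induced charts are injective rests on the fact that a top form at a point is a multiple of the
  determinant (\<open>top_form_eq_det\<close>).  Finally \<open>m \<mapsto> (\<pi> m, z\<^sub>w m)\<close> trivialises \<open>K\<^sub>X\<^sup>\<times>\<close> over the domain of \<open>w\<close>.
\<close>

section \<open>Holomorphic functions of several variables\<close>

text \<open>
  Holomorphy on an open set is a pointwise condition; isolating it at one point lets changes of
  charts be checked point by point.
\<close>

definition cdiff_at :: "(complex ^ 'n::finite \<Rightarrow> complex ^ 'm::finite) \<Rightarrow> complex ^ 'n \<Rightarrow> bool" where
  "cdiff_at f x \<longleftrightarrow> (\<exists>D. (f has_derivative D) (at x) \<and> (\<forall>a v. D (a *s v) = a *s D v))"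

lemma has_derivative_vec_iff:
  fixes f :: "'a::real_normed_vector \<Rightarrow> complex ^ 'm::finite"
  shows "(f has_derivative D) F \<longleftrightarrow> (\<forall>i. ((\<lambda>x. f x $ i) has_derivative (\<lambda>x. D x $ i)) F)"
proof
  assume "(f has_derivative D) F"
  then show "\<forall>i. ((\<lambda>x. f x $ i) has_derivative (\<lambda>x. D x $ i)) F"
    using bounded_linear.has_derivative[OF bounded_linear_vec_nth] by blast
next
  assume *: "\<forall>i. ((\<lambda>x. f x $ i) has_derivative (\<lambda>x. D x $ i)) F"
  have ax: "bounded_linear (\<lambda>z::complex. axis i z)" for i :: 'm
    by (rule linear_conv_bounded_linear[THEN iffD1])
       (auto intro!: linearI simp: vec_eq_iff axis_def)
  have "((\<lambda>x. \<Sum>i\<in>UNIV. axis i (f x $ i)) has_derivative (\<lambda>x. \<Sum>i\<in>UNIV. axis i (D x $ i))) F"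
    using * by (intro has_derivative_sum bounded_linear.has_derivative[OF ax]) auto
  moreover have "(\<Sum>i\<in>UNIV. axis i (y $ i)) = y" for y :: "complex ^ 'm"
    by (simp add: vec_eq_iff axis_def if_distrib cong: if_cong)
  ultimately show "(f has_derivative D) F" by simp
qed

lemma holo_map_on_iff: "holo_map_on S f \<longleftrightarrow> (\<forall>x\<in>S. cdiff_at f x)"
proof -
  have "(\<forall>i. \<exists>D. ((\<lambda>x. f x $ i) has_derivative D) (at x) \<and> (\<forall>a v. D (a *s v) = a * D v))
      \<longleftrightarrow> cdiff_at f x" (is "?L \<longleftrightarrow> _") for x
  proof
    assume ?L
    then obtain D where D: "\<And>i. ((\<lambda>x. f x $ i) has_derivative D i) (at x)"
      "\<And>i a v. D i (a *s v) = a * D i v" by metis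
    then show "cdiff_at f x" unfolding cdiff_at_def has_derivative_vec_iff
      by (intro exI[of _ "\<lambda>v. \<chi> i. D i v"]) (auto simp: vec_eq_iff)
  next
    assume "cdiff_at f x"
    then show ?L unfolding cdiff_at_def has_derivative_vec_iff by (auto simp: vec_eq_iff)
  qed
  then show ?thesis unfolding holo_map_on_def holo_fun_on_def by blast
qed

lemma cdiff_at_frechet:
  assumes "cdiff_at f x"
  shows "(f has_derivative frechet_derivative f (at x)) (at x)"
    and "frechet_derivative f (at x) (a *s v) = a *s frechet_derivative f (at x) v"
    and "linear (frechet_derivative f (at x))"
proof -
  from assms obtain D where D: "(f has_derivative D) (at x)" "\<forall>a v. D (a *s v) = a *s D v"
    unfolding cdiff_at_def by blast
  have E: "frechet_derivative f (at x) = D" using frechet_derivative_at[OF D(1)] by simp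
  show "(f has_derivative frechet_derivative f (at x)) (at x)"
    "frechet_derivative f (at x) (a *s v) = a *s frechet_derivative f (at x) v"
    "linear (frechet_derivative f (at x))"
    unfolding E using D has_derivative_linear by auto
qed

lemma cdiff_atI:
  assumes "(f has_derivative D) (at x)" "\<And>a v. D (a *s v) = a *s D v"
  shows "cdiff_at f x"
  using assms unfolding cdiff_at_def by blast

lemma cdiff_at_compose:
  assumes "cdiff_at f x" "cdiff_at g (f x)"
  shows "cdiff_at (\<lambda>y. g (f y)) x"
    and "frechet_derivative (\<lambda>y. g (f y)) (at x) v
       = frechet_derivative g (at (f x)) (frechet_derivative f (at x) v)"
proof -
  have D: "((\<lambda>y. g (f y)) has_derivative
      (\<lambda>v. frechet_derivative g (at (f x)) (frechet_derivative f (at x) v))) (at x)"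
    using has_derivative_compose[OF cdiff_at_frechet(1)[OF assms(1)] cdiff_at_frechet(1)[OF assms(2)]] .
  then show "cdiff_at (\<lambda>y. g (f y)) x"
    by (rule cdiff_atI) (simp add: cdiff_at_frechet(2)[OF assms(1)] cdiff_at_frechet(2)[OF assms(2)])
  show "frechet_derivative (\<lambda>y. g (f y)) (at x) v
       = frechet_derivative g (at (f x)) (frechet_derivative f (at x) v)"
    using frechet_derivative_at[OF D] by metis
qed

lemma has_derivative_cong_open:
  assumes "open S" "x \<in> S" "\<And>y. y \<in> S \<Longrightarrow> f y = g y"
  shows "(f has_derivative D) (at x) \<longleftrightarrow> (g has_derivative D) (at x)"
  using has_derivative_transform_within_open[of f D x UNIV S g]
    has_derivative_transform_within_open[of g D x UNIV S f] assms by auto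

lemma cdiff_at_cong:
  assumes "open S" "x \<in> S" "\<forall>y\<in>S. f y = g y"
  shows "cdiff_at f x \<longleftrightarrow> cdiff_at g x"
    and "frechet_derivative f (at x) = frechet_derivative g (at x)"
proof -
  have E: "(f has_derivative D) (at x) \<longleftrightarrow> (g has_derivative D) (at x)" for D
    using has_derivative_cong_open[of S x f g] assms by blast
  show "cdiff_at f x \<longleftrightarrow> cdiff_at g x" unfolding cdiff_at_def E by (rule refl)
  show "frechet_derivative f (at x) = frechet_derivative g (at x)"
    unfolding frechet_derivative_def E by (rule refl)
qed

lemma holo_fun_on_cong:
  assumes "open S" "\<And>x. x \<in> S \<Longrightarrow> f x = g x"
  shows "holo_fun_on S f \<longleftrightarrow> holo_fun_on S g"
proof -
  have "(f has_derivative D) (at x) \<longleftrightarrow> (g has_derivative D) (at x)" if "x \<in> S" for x D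
    using has_derivative_cong_open[OF assms(1) that assms(2)] .
  then show ?thesis unfolding holo_fun_on_def by simp
qed

lemma holo_fun_on_const: "holo_fun_on S (\<lambda>x. c)"
  unfolding holo_fun_on_def by (auto intro!: exI[of _ "\<lambda>v. 0"])

lemma holo_fun_on_add:
  assumes "holo_fun_on S f" "holo_fun_on S g"
  shows "holo_fun_on S (\<lambda>x. f x + g x)"
  unfolding holo_fun_on_def
proof
  fix x assume "x \<in> S"
  then obtain D E where "(f has_derivative D) (at x)" "(g has_derivative E) (at x)"
    "\<forall>a v. D (a *s v) = a * D v" "\<forall>a v. E (a *s v) = a * E v"
    using assms unfolding holo_fun_on_def by blast
  then show "\<exists>D. ((\<lambda>x. f x + g x) has_derivative D) (at x) \<and> (\<forall>a v. D (a *s v) = a * D v)"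
    by (intro exI[of _ "\<lambda>v. D v + E v"]) (auto intro: has_derivative_add simp: algebra_simps)
qed

lemma holo_fun_on_mult:
  assumes "holo_fun_on S f" "holo_fun_on S g"
  shows "holo_fun_on S (\<lambda>x. f x * g x)"
  unfolding holo_fun_on_def
proof
  fix x assume "x \<in> S"
  then obtain D E where "(f has_derivative D) (at x)" "(g has_derivative E) (at x)"
    "\<forall>a v. D (a *s v) = a * D v" "\<forall>a v. E (a *s v) = a * E v"
    using assms unfolding holo_fun_on_def by blast
  then show "\<exists>D. ((\<lambda>x. f x * g x) has_derivative D) (at x) \<and> (\<forall>a v. D (a *s v) = a * D v)"
    by (intro exI[of _ "\<lambda>v. f x * E v + D v * g x"] conjI has_derivative_mult)
       (auto simp: algebra_simps)
qed

lemma holo_fun_on_sum: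
  assumes "\<And>i. i \<in> I \<Longrightarrow> holo_fun_on S (f i)"
  shows "holo_fun_on S (\<lambda>x. \<Sum>i\<in>I. f i x)"
  using assms
  by (induction I rule: infinite_finite_induct) (auto intro: holo_fun_on_const holo_fun_on_add)

lemma holo_fun_on_prod:
  assumes "\<And>i. i \<in> I \<Longrightarrow> holo_fun_on S (f i)"
  shows "holo_fun_on S (\<lambda>x. \<Prod>i\<in>I. f i x)"
  using assms
  by (induction I rule: infinite_finite_induct) (auto intro: holo_fun_on_const holo_fun_on_mult)

lemma holo_fun_on_det:
  assumes "\<And>i j. holo_fun_on S (\<lambda>x. A x $ i $ j)"
  shows "holo_fun_on S (\<lambda>x. det (A x))"
  unfolding det_def by (intro holo_fun_on_sum holo_fun_on_mult holo_fun_on_prod holo_fun_on_const assms)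

lemma holo_fun_on_nth: "holo_fun_on S (\<lambda>x. x $ i)"
  unfolding holo_fun_on_def
  by (auto intro!: exI[of _ "\<lambda>v. v $ i"] bounded_linear_imp_has_derivative bounded_linear_vec_nth)

lemma holo_fun_on_compose:
  assumes "holo_map_on S f" "holo_fun_on T g" "f ` S \<subseteq> T"
  shows "holo_fun_on S (\<lambda>x. g (f x))"
  unfolding holo_fun_on_def
proof
  fix x assume x: "x \<in> S"
  then obtain D where D: "(f has_derivative D) (at x)" "\<forall>a v. D (a *s v) = a *s D v"
    using assms(1) unfolding holo_map_on_iff cdiff_at_def by blast
  obtain E where E: "(g has_derivative E) (at (f x))" "\<forall>a v. E (a *s v) = a * E v"
    using assms(2,3) x unfolding holo_fun_on_def by blast
  show "\<exists>D. ((\<lambda>x. g (f x)) has_derivative D) (at x) \<and> (\<forall>a v. D (a *s v) = a * D v)"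
    using has_derivative_compose[OF D(1) E(1)] D(2) E(2) by (intro exI[of _ "\<lambda>v. E (D v)"]) auto
qed

lemma holo_fun_on_inverse:
  assumes "\<And>x. x \<in> S \<Longrightarrow> f x \<noteq> 0" "holo_fun_on S f"
  shows "holo_fun_on S (\<lambda>x. inverse (f x))"
  unfolding holo_fun_on_def
proof
  fix x assume x: "x \<in> S"
  then obtain D where D: "(f has_derivative D) (at x)" "\<forall>a v. D (a *s v) = a * D v"
    using assms(2) unfolding holo_fun_on_def by blast
  show "\<exists>D. ((\<lambda>x. inverse (f x)) has_derivative D) (at x) \<and> (\<forall>a v. D (a *s v) = a * D v)"
  proof (intro exI conjI allI)
    show "((\<lambda>x. inverse (f x)) has_derivative (\<lambda>h. - (inverse (f x) * D h * inverse (f x)))) (at x)"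
      using Deriv.has_derivative_inverse[OF assms(1)[OF x] D(1)] .
  qed (simp add: D(2) ac_simps)
qed

lemma holo_map_on_cong:
  assumes "open S" "\<forall>x\<in>S. f x = g x"
  shows "holo_map_on S f \<longleftrightarrow> holo_map_on S g"
  unfolding holo_map_on_iff using cdiff_at_cong(1)[OF assms(1) _ assms(2)] by (rule ball_cong[OF refl])

lemma holo_map_on_continuous: "holo_map_on S f \<Longrightarrow> continuous_on S f"
  unfolding holo_map_on_iff cdiff_at_def
  by (meson continuous_at_imp_continuous_on has_derivative_continuous)

lemma smult_norm_bound:
  fixes v :: "complex ^ 'n::finite"
  obtains K where "0 < K" "\<And>z. norm (z *s v) \<le> norm z * K"
proof -
  have "linear (\<lambda>z::complex. z *s v)"
    by (rule linearI) (auto simp: vec_eq_iff algebra_simps)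
  then have "bounded_linear (\<lambda>z::complex. z *s v)" by (simp add: linear_conv_bounded_linear)
  then show ?thesis using bounded_linear.pos_bounded that by blast
qed

lemma holo_fun_on_frechet:
  assumes "holo_fun_on S f" "x \<in> S"
  shows "(f has_derivative frechet_derivative f (at x)) (at x)"
    and "frechet_derivative f (at x) (a *s v) = a * frechet_derivative f (at x) v"
proof -
  from assms obtain D where D: "(f has_derivative D) (at x)" "\<forall>a v. D (a *s v) = a * D v"
    unfolding holo_fun_on_def by blast
  have E: "frechet_derivative f (at x) = D" using frechet_derivative_at[OF D(1)] by simp
  show "(f has_derivative frechet_derivative f (at x)) (at x)"
    "frechet_derivative f (at x) (a *s v) = a * frechet_derivative f (at x) v"
    unfolding E using D by auto
qed

lemma has_derivative_smult_line:
  "((\<lambda>z::complex. x + z *s v) has_derivative (\<lambda>h. h *s v)) (at z)"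
  unfolding has_derivative_vec_iff by (auto intro!: derivative_eq_intros)

text \<open>
  On the complex line \<open>x + z v\<close> the function is holomorphic in the single variable
  \<open>z\<close>, and its derivative at \<open>z = 0\<close> is the directional derivative.  Since
  the measure \<open>d\<zeta> / (2 \<pi> i \<zeta>\<^sup>2)\<close> on the circle becomes \<open>dt
  / \<zeta>\<close>, the Cauchy formula takes this form.
\<close>

lemma directional_derivative_Cauchy:
  fixes f :: "complex ^ 'n::finite \<Rightarrow> complex"
  assumes f: "holo_fun_on S f" and r: "0 < r" and S: "\<And>z. norm z \<le> r \<Longrightarrow> x + z *s v \<in> S"
  shows "frechet_derivative f (at x) v
       = integral {0..1} (\<lambda>t. f (x + circlepath 0 r t *s v) / circlepath 0 r t)"
proof -
  define \<phi> where "\<phi> z = f (x + z *s v)" for z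
  have d: "(\<phi> has_field_derivative frechet_derivative f (at (x + z *s v)) v) (at z)"
    if "norm z \<le> r" for z
    unfolding has_field_derivative_def \<phi>_def
  proof (rule has_derivative_eq_rhs)
    show "((\<lambda>z. f (x + z *s v)) has_derivative (\<lambda>h. frechet_derivative f (at (x + z *s v)) (h *s v))) (at z)"
      by (rule has_derivative_compose[OF has_derivative_smult_line holo_fun_on_frechet(1)[OF f S[OF that]]])
    show "(\<lambda>h. frechet_derivative f (at (x + z *s v)) (h *s v)) =
          (*) (frechet_derivative f (at (x + z *s v)) v)"
      by (rule ext) (simp add: holo_fun_on_frechet(2)[OF f S[OF that]] mult.commute)
  qed
  have hol: "\<phi> holomorphic_on cball 0 r"
    unfolding holomorphic_on_def
    using d field_differentiable_at_within field_differentiable_def mem_cball_0 by blast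
  have "contour_integral (circlepath 0 r) (\<lambda>u. \<phi> u / (u - 0)^2) = (2 * pi * \<i>) * deriv \<phi> 0"
    by (rule Cauchy_contour_integral_circlepath_2)
       (use r hol in \<open>auto intro: holomorphic_on_imp_continuous_on holomorphic_on_subset\<close>)
  moreover have "deriv \<phi> 0 = frechet_derivative f (at x) v"
    using DERIV_imp_deriv[OF d[of 0]] r by simp
  ultimately have cd: "contour_integral (circlepath 0 r) (\<lambda>u. \<phi> u / (u - 0)^2)
    = (2 * pi * \<i>) * frechet_derivative f (at x) v" by simp
  have "contour_integral (circlepath 0 r) (\<lambda>u. \<phi> u / (u - 0)^2)
    = integral {0..1} (\<lambda>t. complex_of_real (2 * pi) * \<i> * (f (x + circlepath 0 r t *s v) / circlepath 0 r t))"
    unfolding contour_integral_integral using r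
    by (intro integral_cong) (simp add: \<phi>_def vector_derivative_circlepath, simp add: circlepath power2_eq_square field_simps)
  also have "\<dots> = (2 * pi * \<i>) * integral {0..1} (\<lambda>t. f (x + circlepath 0 r t *s v) / circlepath 0 r t)"
    by (simp only: integral_mult_right of_real_mult)
  finally show ?thesis using cd by simp
qed

lemma complex_line_nbhd:
  fixes v :: "complex ^ 'n::finite"
  assumes "open S" "p0 \<in> S"
  obtains r e where "0 < r" "0 < e"
    "\<And>x z. x \<in> ball p0 e \<Longrightarrow> norm z \<le> r \<Longrightarrow> x + z *s v \<in> S"
proof -
  obtain d where d: "d > 0" "ball p0 d \<subseteq> S" using assms open_contains_ball by blast
  obtain K where K: "0 < K" "\<And>z. norm (z *s v) \<le> norm z * K" using smult_norm_bound by blast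
  show ?thesis
  proof
    show "0 < d / 2 / K" "0 < d / 2" using d K by auto
    fix x and z :: complex assume xz: "x \<in> ball p0 (d / 2)" "norm z \<le> d / 2 / K"
    have "norm (z *s v) \<le> d / 2 / K * K" using K xz mult_right_mono[of "norm z" "d/2/K" K]
      by (meson dual_order.trans less_imp_le)
    then have "norm (z *s v) \<le> d / 2" using K by simp
    moreover have "dist p0 (x + z *s v) \<le> dist p0 x + norm (z *s v)"
      using dist_triangle[of p0 "x + z *s v" x] by (simp add: dist_norm)
    ultimately show "x + z *s v \<in> S" using xz d(2) by auto
  qed
qed

lemma continuous_on_circle_shift:
  fixes f :: "complex ^ 'n::finite \<Rightarrow> complex"
  assumes "continuous_on S f" "0 < r"
    and "\<And>x z. x \<in> U \<Longrightarrow> norm z \<le> r \<Longrightarrow> x + z *s v \<in> S"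
  shows "continuous_on (U \<times> cbox 0 1) (\<lambda>(x, t). f (x + circlepath 0 r t *s v) / circlepath 0 r t)"
proof -
  have "continuous_on (U \<times> cbox 0 1) (\<lambda>p. fst p + circlepath 0 r (snd p) *s v)"
    unfolding circlepath vector_scalar_mult_def
    by (intro continuous_intros)
  moreover have "(\<lambda>p. fst p + circlepath 0 r (snd p) *s v) ` (U \<times> cbox 0 1) \<subseteq> S"
    using assms(2,3) by (auto simp: circlepath norm_mult)
  ultimately have "continuous_on (U \<times> cbox 0 1) (\<lambda>p. f (fst p + circlepath 0 r (snd p) *s v))"
    using continuous_on_compose2[OF assms(1)] by blast
  then have "continuous_on (U \<times> cbox 0 1)
      (\<lambda>p. f (fst p + circlepath 0 r (snd p) *s v) / circlepath 0 r (snd p))"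
    using assms(2) by (intro continuous_on_divide) (auto simp: circlepath intro!: continuous_intros)
  then show ?thesis by (simp add: case_prod_beta)
qed

lemma holo_fun_on_continuous: "holo_fun_on S f \<Longrightarrow> continuous_on S f"
  unfolding holo_fun_on_def
  by (meson continuous_at_imp_continuous_on has_derivative_continuous)

text \<open>
  By the Cauchy formula the derivative is an integral over a compact interval that depends
  continuously on the parameter \<open>x\<close>; continuity of \<open>f\<close> is enough for that.
\<close>

lemma continuous_on_frechet_derivative:
  fixes f :: "complex ^ 'n::finite \<Rightarrow> complex"
  assumes "open S" "holo_fun_on S f"
  shows "continuous_on S (\<lambda>x. frechet_derivative f (at x) v)"
  unfolding continuous_on_eq_continuous_at[OF assms(1)]
proof
  fix p0 assume "p0 \<in> S"
  then obtain r e where re: "0 < r" "0 < e"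
    "\<And>x z. x \<in> ball p0 e \<Longrightarrow> norm z \<le> r \<Longrightarrow> x + z *s v \<in> S"
    using complex_line_nbhd[OF assms(1)] by metis
  have "continuous_on (ball p0 e)
      (\<lambda>x. integral (cbox 0 1) (\<lambda>t. f (x + circlepath 0 r t *s v) / circlepath 0 r t))"
    by (rule integral_continuous_on_param)
       (rule continuous_on_circle_shift[OF holo_fun_on_continuous[OF assms(2)] re(1,3)])
  then have "continuous_on (ball p0 e) (\<lambda>x. frechet_derivative f (at x) v)"
    by (rule continuous_on_eq)
       (simp only: cbox_interval directional_derivative_Cauchy[OF assms(2) re(1) re(3)])
  then show "isCont (\<lambda>x. frechet_derivative f (at x) v) p0"
    using re(2) continuous_on_eq_continuous_at[OF open_ball] centre_in_ball by blast
qed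

text \<open>
  The Cauchy integral for the directional derivative can be differentiated under the integral sign,
  because the derivative of the integrand is jointly continuous by the preceding lemma; complex
  linearity passes through the integral.
\<close>

lemma holo_fun_on_frechet_derivative:
  fixes f :: "complex ^ 'n::finite \<Rightarrow> complex"
  assumes "open S" "holo_fun_on S f"
  shows "holo_fun_on S (\<lambda>x. frechet_derivative f (at x) v)"
  unfolding holo_fun_on_def
proof
  fix p0 assume "p0 \<in> S"
  then obtain r e where re: "0 < r" "0 < e"
    "\<And>x z. x \<in> ball p0 e \<Longrightarrow> norm z \<le> r \<Longrightarrow> x + z *s v \<in> S"
    using complex_line_nbhd[OF assms(1)] by metis
  define \<gamma> where "\<gamma> = circlepath 0 r"
  have \<gamma>0: "\<gamma> t \<noteq> 0" and \<gamma>r: "norm (\<gamma> t) \<le> r" for t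
    using re(1) by (auto simp: \<gamma>_def circlepath norm_mult)
  define d where "d x t h = frechet_derivative f (at (x + \<gamma> t *s v)) h / \<gamma> t" for x t h
  have dd: "((\<lambda>x. f (x + \<gamma> t *s v) / \<gamma> t) has_derivative d x t) (at x)" if "x \<in> ball p0 e" for x t
  proof -
    have "((\<lambda>x. f (x + \<gamma> t *s v)) has_derivative
        (\<lambda>h. frechet_derivative f (at (x + \<gamma> t *s v)) h)) (at x)"
      by (rule has_derivative_compose[OF _ holo_fun_on_frechet(1)[OF assms(2)]])
         (auto intro!: derivative_eq_intros re(3) that \<gamma>r)
    then show ?thesis unfolding d_def divide_inverse
      by (rule has_derivative_mult_left)
  qed
  define F where "F x t = Blinfun (d x t)" for x t
  have F: "blinfun_apply (F x t) = d x t" if "x \<in> ball p0 e" for x t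
    unfolding F_def using dd[OF that] by (intro bounded_linear_Blinfun_apply has_derivative_bounded_linear)
  have cont: "continuous_on (ball p0 e \<times> cbox 0 1) (\<lambda>(x, t). F x t)"
    unfolding case_prod_beta
  proof (rule continuous_on_blinfun_componentwise)
    fix i :: "complex ^ 'n"
    have "continuous_on (ball p0 e \<times> cbox 0 1) (\<lambda>(x, t). d x t i)"
      unfolding d_def \<gamma>_def
      by (rule continuous_on_circle_shift[OF continuous_on_frechet_derivative[OF assms] re(1,3)])
    then show "continuous_on (ball p0 e \<times> cbox 0 1) (\<lambda>p. blinfun_apply (F (fst p) (snd p)) i)"
      by (rule continuous_on_eq) (auto simp: F)
  qed
  have int: "(\<lambda>t. f (x + \<gamma> t *s v) / \<gamma> t) integrable_on cbox 0 1" if "x \<in> ball p0 e" for x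
  proof (rule integrable_continuous)
    have "continuous_on (ball p0 e \<times> cbox 0 1) (\<lambda>(x, t). f (x + \<gamma> t *s v) / \<gamma> t)"
      unfolding \<gamma>_def
      by (rule continuous_on_circle_shift[OF holo_fun_on_continuous[OF assms(2)] re(1,3)])
    then have "continuous_on ({x} \<times> cbox 0 1) (\<lambda>(x, t). f (x + \<gamma> t *s v) / \<gamma> t)"
      by (rule continuous_on_subset) (use that in auto)
    then have "continuous_on (cbox 0 1) (\<lambda>t. (\<lambda>(x, t). f (x + \<gamma> t *s v) / \<gamma> t) (x, t))"
      by (rule continuous_on_compose2) (auto intro!: continuous_intros)
    then show "continuous_on (cbox 0 1) (\<lambda>t. f (x + \<gamma> t *s v) / \<gamma> t)" by simp
  qed
  have p0: "p0 \<in> ball p0 e" using re(2) by simp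
  \<comment> \<open>The Cauchy integral is differentiated with the continuous family \<open>F\<close> of derivatives of its integrand.\<close>
  have "((\<lambda>x. integral (cbox 0 1) (\<lambda>t. f (x + \<gamma> t *s v) / \<gamma> t)) has_derivative
      integral (cbox 0 1) (F p0)) (at p0 within ball p0 e)"
    by (rule leibniz_rule[OF _ int cont p0]) (simp_all add: F has_derivative_at_withinI[OF dd] del: mem_ball)
  then have "((\<lambda>x. integral (cbox 0 1) (\<lambda>t. f (x + \<gamma> t *s v) / \<gamma> t)) has_derivative
      integral (cbox 0 1) (F p0)) (at p0)"
    using at_within_open[OF p0 open_ball] by simp
  then have "((\<lambda>x. frechet_derivative f (at x) v) has_derivative integral (cbox 0 1) (F p0)) (at p0)"
    by (rule has_derivative_transform_within_open[OF _ open_ball p0])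
       (simp add: directional_derivative_Cauchy[OF assms(2) re(1)] re(3) \<gamma>_def)
  moreover have "blinfun_apply (integral (cbox 0 1) (F p0)) (a *s h)
       = a * blinfun_apply (integral (cbox 0 1) (F p0)) h" for a h
  proof -
    have "continuous_on ({p0} \<times> cbox 0 1) (\<lambda>(x, t). F x t)"
      by (rule continuous_on_subset[OF cont]) (use p0 in auto)
    then have "continuous_on (cbox 0 1) (\<lambda>t. (\<lambda>(x, t). F x t) (p0, t))"
      by (rule continuous_on_compose2) (auto intro!: continuous_intros)
    then have i: "F p0 integrable_on cbox 0 1" by (intro integrable_continuous) simp
    have "d p0 t (a *s h) = a * d p0 t h" for t
      using holo_fun_on_frechet(2)[OF assms(2) re(3)[OF p0 \<gamma>r]] by (simp add: d_def)
    then show ?thesis unfolding blinfun_apply_integral[OF i] by (simp add: F[OF p0])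
  qed
  ultimately show "\<exists>D. ((\<lambda>x. frechet_derivative f (at x) v) has_derivative D) (at p0) \<and>
      (\<forall>a v. D (a *s v) = a * D v)" by blast
qed

lemma frechet_derivative_component:
  assumes "cdiff_at f x"
  shows "frechet_derivative f (at x) v $ k = frechet_derivative (\<lambda>y. f y $ k) (at x) v"
proof -
  have "((\<lambda>y. f y $ k) has_derivative (\<lambda>v. frechet_derivative f (at x) v $ k)) (at x)"
    using cdiff_at_frechet(1)[OF assms] unfolding has_derivative_vec_iff by blast
  from fun_cong[OF frechet_derivative_at[OF this]] show ?thesis .
qed

lemma holo_fun_on_frechet_component:
  assumes "open S" "holo_map_on S f"
  shows "holo_fun_on S (\<lambda>x. frechet_derivative f (at x) v $ k)"
proof -
  have c: "cdiff_at f x" if "x \<in> S" for x using assms(2) that unfolding holo_map_on_iff by blast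
  have "holo_fun_on S (\<lambda>x. f x $ k)" using assms(2) unfolding holo_map_on_def by blast
  from holo_fun_on_frechet_derivative[OF assms(1) this, of v]
  show ?thesis by (rule holo_fun_on_cong[OF assms(1), THEN iffD2, rotated]) (rule frechet_derivative_component[OF c])
qed

section \<open>Alternating multilinear maps and determinants\<close>

text \<open>
  Vectors are indexed by an unordered finite type, so that determinants need no ordering of the
  coordinates.
\<close>

definition alt_multilinear :: "(('k::finite \<Rightarrow> complex ^ 'n::finite) \<Rightarrow> complex) \<Rightarrow> bool" where
  "alt_multilinear F \<longleftrightarrow>
     (\<forall>v i x y a b. F (v(i := a *s x + b *s y)) = a * F (v(i := x)) + b * F (v(i := y))) \<and>
     (\<forall>v i j. i \<noteq> j \<longrightarrow> v i = v j \<longrightarrow> F v = 0)"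

lemma alt_multilinear_lin:
  "alt_multilinear F \<Longrightarrow> F (v(i := a *s x + b *s y)) = a * F (v(i := x)) + b * F (v(i := y))"
  unfolding alt_multilinear_def by blast

lemma alt_multilinear_alt: "alt_multilinear F \<Longrightarrow> i \<noteq> j \<Longrightarrow> v i = v j \<Longrightarrow> F v = 0"
  unfolding alt_multilinear_def by blast

lemma alt_multilinear_swap:
  assumes "alt_multilinear F" "i \<noteq> j"
  shows "F (v(i := x, j := y)) = - F (v(i := y, j := x))"
proof -
  have lin: "F (v(i := x + y)) = F (v(i := x)) + F (v(i := y))" for v i x y
    using alt_multilinear_lin[OF assms(1), of v i 1 x 1 y] by simp
  have alt: "F v = 0" if "v i = v j" for v
    using alt_multilinear_alt[OF assms that] .
  have tw: "v(i := a, j := b) = v(j := b, i := a)" for a b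
    by (rule fun_upd_twist[OF assms(2)])
  have "0 = F (v(i := x + y, j := x + y))" by (simp add: alt)
  also have "\<dots> = F (v(i := x + y, j := x)) + F (v(i := x + y, j := y))" by (rule lin)
  also have "F (v(i := x + y, j := x)) = F (v(i := x, j := x)) + F (v(i := y, j := x))"
    unfolding tw by (rule lin)
  also have "F (v(i := x + y, j := y)) = F (v(i := x, j := y)) + F (v(i := y, j := y))"
    unfolding tw by (rule lin)
  also have "F (v(i := x, j := x)) = 0" by (simp add: alt)
  also have "F (v(i := y, j := y)) = 0" by (simp add: alt)
  finally show ?thesis by (simp add: eq_neg_iff_add_eq_0 add.commute del: fun_upd_apply)
qed

lemma alt_multilinear_sum:
  assumes "alt_multilinear F"
  shows "F (v(i := (\<Sum>k\<in>A. c k *s w k))) = (\<Sum>k\<in>A. c k * F (v(i := w k)))"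
proof -
  have z: "F (v(i := 0)) = 0"
    using alt_multilinear_lin[OF assms, of v i 0 0 0 0] by simp
  show ?thesis
  proof (induction A rule: infinite_finite_induct)
    case (infinite A)
    then show ?case using z by (simp del: fun_upd_apply)
  next
    case empty
    then show ?case using z by (simp del: fun_upd_apply)
  next
    case (insert k A)
    then show ?case
      using alt_multilinear_lin[OF assms,
          of v i "c k" "w k" 1 "\<Sum>k\<in>A. c k *s w k"] by (simp del: fun_upd_apply)
  qed
qed

text \<open>
  Expanding the arguments one slot at a time reduces to tuples of basis vectors.  Such a tuple
  either repeats a vector or is a permutation of the standard basis, which is reached by
  transpositions.
\<close>

lemma alt_multilinear_eq_0:
  fixes F :: "('k::finite \<Rightarrow> complex ^ 'k) \<Rightarrow> complex"
  assumes "alt_multilinear F" "F (\<lambda>i. axis i 1) = 0"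
  shows "F v = 0"
proof -
  have perm: "F (\<lambda>i. axis (p i) 1) = 0" if "p permutes UNIV" for p
    using finite_class.finite_UNIV that
  proof (induction rule: permutes_rev_induct)
    case id
    then show ?case using assms(2) by simp
  next
    case (swap a b p)
    define u where "u = (\<lambda>i. axis (p i) 1 :: complex ^ 'k)"
    have "F (\<lambda>i. axis ((p \<circ> Transposition.transpose a b) i) 1) = F (u(a := u b, b := u a))"
      by (rule arg_cong[of _ _ F]) (auto simp: u_def Transposition.transpose_def fun_eq_iff)
    also have "\<dots> = - F (u(a := u a, b := u b))"
      by (rule alt_multilinear_swap) (use assms swap in auto)
    also have "u(a := u a, b := u b) = u" by simp
    finally show ?case using swap by (simp add: u_def)
  qed
  have basis: "F (\<lambda>i. axis (p i) 1) = 0" for p :: "'k \<Rightarrow> 'k"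
  proof (cases "inj p")
    case True
    then have "bij p" using finite_UNIV_inj_surj[OF finite_class.finite_UNIV] by (simp add: bij_def)
    then show ?thesis using perm permutes_bij bij_imp_permutes by (metis UNIV_I)
  next
    case False
    then obtain i j where "i \<noteq> j" "p i = p j" unfolding inj_def by blast
    then show ?thesis using alt_multilinear_alt[OF assms(1), of i j "\<lambda>i. axis (p i) 1"] by simp
  qed
  \<comment> \<open>Induction on the set \<open>B\<close> of slots that may hold an arbitrary vector.\<close>
  have "F v = 0" if "\<forall>i. i \<notin> B \<longrightarrow> (\<exists>k. v i = axis k 1)" for B v
    using finite[of B] that
  proof (induction B arbitrary: v)
    case empty
    then obtain p where "\<And>i. v i = axis (p i) 1" by (metis empty_iff)
    then have "v = (\<lambda>i. axis (p i) 1)" by auto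
    then show ?case using basis by simp
  next
    case (insert j B)
    have "F v = F (v(j := (\<Sum>k\<in>UNIV. (v j $ k) *s axis k 1)))"
      by (simp add: basis_expansion)
    also have "\<dots> = (\<Sum>k\<in>UNIV. v j $ k * F (v(j := axis k 1)))"
      by (rule alt_multilinear_sum[OF assms(1)])
    also have "\<dots> = 0"
    proof (intro sum.neutral ballI)
      fix k :: 'k
      have "F (v(j := axis k 1)) = 0" by (rule insert.IH) (use insert.prems in auto)
      then show "v j $ k * F (v(j := axis k 1)) = 0" by simp
    qed
    finally show ?case .
  qed
  from this[of UNIV v] show ?thesis by simp
qed

lemma alt_multilinear_det: "alt_multilinear (\<lambda>v :: 'k::finite \<Rightarrow> complex ^ 'k. det (\<chi> k l. v l $ k))"
proof -
  have eq: "det (\<chi> k l. v l $ k) = det (\<chi> k. v k)" for v :: "'k \<Rightarrow> complex ^ 'k"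
    using det_transpose[of "\<chi> k. v k"] by (simp add: transpose_def)
  have upd: "(\<chi> k. (v(i := x)) k) = (\<chi> k. if k = i then x else v k)" for v :: "'k \<Rightarrow> complex ^ 'k" and i x
    by (simp add: vec_eq_iff)
  show ?thesis unfolding alt_multilinear_def eq
  proof (intro conjI allI impI)
    fix v :: "'k \<Rightarrow> complex ^ 'k" and i x y a b
    show "det (\<chi> k. (v(i := a *s x + b *s y)) k)
        = a * det (\<chi> k. (v(i := x)) k) + b * det (\<chi> k. (v(i := y)) k)"
      unfolding upd det_row_add det_row_mul ..
  next
    fix v :: "'k \<Rightarrow> complex ^ 'k" and i j assume "i \<noteq> j" "v i = v j"
    then show "det (\<chi> k. v k) = 0" by (intro det_identical_rows[of i j]) (auto simp: row_def)
  qed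
qed

lemma det_axis: "det (\<chi> k l. axis l 1 $ k :: complex ^ 'k ^ 'k) = 1"
proof -
  have "(\<chi> k l. axis l 1 $ k) = (mat 1 :: complex ^ 'k ^ 'k)"
    by (simp add: mat_def axis_def vec_eq_iff)
  then show ?thesis by (simp only: det_I)
qed

text \<open>
  The difference of the two sides is alternating multilinear and vanishes on the standard basis.
\<close>

lemma alt_multilinear_eq_det:
  fixes F :: "('k::finite \<Rightarrow> complex ^ 'k) \<Rightarrow> complex"
  assumes "alt_multilinear F"
  shows "F v = det (\<chi> k l. v l $ k) * F (\<lambda>i. axis i 1)"
proof -
  let ?c = "F (\<lambda>i. axis i 1)"
  have "alt_multilinear (\<lambda>v. F v - det (\<chi> k l. v l $ k) * ?c)"
    unfolding alt_multilinear_def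
  proof (intro conjI allI impI)
    fix v :: "'k \<Rightarrow> complex ^ 'k" and i x y a b
    show "F (v(i := a *s x + b *s y)) - det (\<chi> k l. (v(i := a *s x + b *s y)) l $ k) * ?c
        = a * (F (v(i := x)) - det (\<chi> k l. (v(i := x)) l $ k) * ?c)
        + b * (F (v(i := y)) - det (\<chi> k l. (v(i := y)) l $ k) * ?c)"
      unfolding alt_multilinear_lin[OF assms, of v i a x b y]
        alt_multilinear_lin[OF alt_multilinear_det, of v i a x b y]
      by (simp only: algebra_simps)
  next
    fix v :: "'k \<Rightarrow> complex ^ 'k" and i j assume "i \<noteq> j" "v i = v j"
    then have "F v = 0" "det (\<chi> k l. v l $ k) = 0"
      using alt_multilinear_alt[OF assms] alt_multilinear_alt[OF alt_multilinear_det] by auto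
    then show "F v - det (\<chi> k l. v l $ k) * ?c = 0" by simp
  qed
  then have "F v - det (\<chi> k l. v l $ k) * ?c = 0"
    using alt_multilinear_eq_0[of "\<lambda>v. F v - det (\<chi> k l. v l $ k) * ?c" v]
    by (simp only: det_axis mult_1 diff_self)
  then show ?thesis by simp
qed

text \<open>
  The lower block \<open>B\<close> enters as an alternating multilinear function of its rows, so it
  contributes the factor \<open>det B\<close>; with \<open>B\<close> replaced by the identity, the
  first row can be expanded, and all its entries but the first give a repeated row.
\<close>

lemma det_option_block:
  fixes A :: "complex ^ 'k::finite option ^ 'k option"
  assumes "\<And>k. A $ Some k $ None = 0"
  shows "det A = A $ None $ None * det (\<chi> i j. A $ Some i $ Some j)"
proof -
  have rows: "alt_multilinear (\<lambda>v :: 'k option \<Rightarrow> complex ^ 'k option. det (\<chi> k. v k))"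
  proof -
    have "det (\<chi> k l. v l $ k) = det (\<chi> k. v k)" for v :: "'k option \<Rightarrow> complex ^ 'k option"
      using det_transpose[of "\<chi> k. v k"] by (simp add: transpose_def)
    then show ?thesis using alt_multilinear_det[where 'k="'k option"] by simp
  qed
  \<comment> \<open>The matrix with the first row of \<open>A\<close> and the rows \<open>w\<close> in the lower block.\<close>
  define u where "u w k = (case k of None \<Rightarrow> A $ None |
      Some i \<Rightarrow> (\<chi> j. case j of None \<Rightarrow> 0 | Some l \<Rightarrow> w i $ l))" for w :: "'k \<Rightarrow> complex ^ 'k" and k
  define F where "F w = det (\<chi> k. u w k)" for w
  have u_upd: "u (w(i := x)) = (u w)(Some i := (\<chi> j. case j of None \<Rightarrow> 0 | Some l \<Rightarrow> x $ l))" for w i x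
    by (auto simp: u_def fun_eq_iff split: option.split)
  have "alt_multilinear F"
    unfolding alt_multilinear_def
  proof (intro conjI allI impI)
    fix w :: "'k \<Rightarrow> complex ^ 'k" and x y :: "complex ^ 'k" and i and a b :: complex
    have "(\<chi> j. case j of None \<Rightarrow> 0 | Some l \<Rightarrow> (a *s x + b *s y) $ l)
      = a *s (\<chi> j. case j of None \<Rightarrow> 0 | Some l \<Rightarrow> x $ l) + b *s (\<chi> j. case j of None \<Rightarrow> 0 | Some l \<Rightarrow> y $ l)"
      by (auto simp: vec_eq_iff split: option.split)
    then show "F (w(i := a *s x + b *s y)) = a * F (w(i := x)) + b * F (w(i := y))"
      unfolding F_def u_upd by (simp only: alt_multilinear_lin[OF rows])
  next
    fix w :: "'k \<Rightarrow> complex ^ 'k" and i j :: 'k assume "i \<noteq> j" "w i = w j"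
    then show "F w = 0"
      using alt_multilinear_alt[OF rows, of "Some i" "Some j" "u w"]
      by (simp add: F_def u_def)
  qed
  then have "F w = det (\<chi> k l. w l $ k) * F (\<lambda>i. axis i 1)" for w
    by (rule alt_multilinear_eq_det)
  note this[of "\<lambda>i. \<chi> j. A $ Some i $ Some j"]
  moreover have "(\<chi> k. u (\<lambda>i. \<chi> j. A $ Some i $ Some j) k) = A"
    using assms by (auto simp: vec_eq_iff u_def split: option.split)
  moreover have "det (\<chi> k l. (\<chi> j. A $ Some l $ Some j) $ k) = det (\<chi> i j. A $ Some i $ Some j)"
    using det_transpose[of "\<chi> i j. A $ Some i $ Some j"] by (simp add: transpose_def)
  moreover have "F (\<lambda>i. axis i 1) = A $ None $ None"
  proof -
    define e where "e = (\<lambda>k::'k option. axis k 1 :: complex ^ 'k option)"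
    have "u (\<lambda>i. axis i 1) = e(None := (\<Sum>k\<in>UNIV. (A $ None $ k) *s e k))"
      unfolding e_def basis_expansion
      by (auto simp: u_def fun_eq_iff vec_eq_iff axis_def split: option.split)
    then have "F (\<lambda>i. axis i 1) = det (\<chi> k. (e(None := (\<Sum>k\<in>UNIV. (A $ None $ k) *s e k))) k)"
      by (simp only: F_def)
    also have "\<dots> = (\<Sum>k\<in>UNIV. A $ None $ k * det (\<chi> i. (e(None := e k)) i))"
      by (rule alt_multilinear_sum[OF rows])
    also have "\<dots> = A $ None $ None * det (\<chi> i. (e(None := e None)) i)
         + (\<Sum>k\<in>UNIV. A $ None $ Some k * det (\<chi> i. (e(None := e (Some k))) i))"
      unfolding UNIV_option_conv by (subst sum.insert) (auto simp: sum.reindex)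
    also have "(\<Sum>k\<in>UNIV. A $ None $ Some k * det (\<chi> i. (e(None := e (Some k))) i)) = 0"
    proof (intro sum.neutral ballI)
      fix k :: 'k
      show "A $ None $ Some k * det (\<chi> i. (e(None := e (Some k))) i) = 0"
        using alt_multilinear_alt[OF rows,
            of None "Some k" "e(None := e (Some k))"] by simp
    qed
    also have "det (\<chi> i. (e(None := e None)) i) = 1"
    proof -
      have "(\<chi> i. (e(None := e None)) i) = mat 1"
        by (auto simp: e_def mat_def axis_def vec_eq_iff)
      then show ?thesis by (simp only: det_I)
    qed
    finally show ?thesis by simp
  qed
  ultimately show ?thesis by (simp add: F_def)
qed

section \<open>Charts and coordinate changes\<close>

text \<open>
  The homeomorphism condition split into its open and its continuous half; this form restricts to
  open subsets and extends to products without mention of subspace topologies.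
\<close>

lemma topological_chart_iff:
  "topological_chart T c \<longleftrightarrow> openin T (fst c) \<and> inj_on (snd c) (fst c) \<and>
     (\<forall>V. openin T V \<longrightarrow> open (snd c ` (V \<inter> fst c))) \<and>
     (\<forall>W. open W \<longrightarrow> openin T {p \<in> fst c. snd c p \<in> W})"
proof (intro iffI conjI allI impI)
  assume c: "topological_chart T c"
  then have U: "openin T (fst c)" "open (snd c ` fst c)"
    and h: "homeomorphic_map (subtopology T (fst c)) (top_of_set (snd c ` fst c)) (snd c)"
    unfolding topological_chart_def by auto
  have ts: "topspace (subtopology T (fst c)) = fst c"
    using openin_subset[OF U(1)] by (rule topspace_subtopology_subset)
  show "openin T (fst c)" by (rule U)
  show "inj_on (snd c) (fst c)" using homeomorphic_imp_injective_map[OF h] unfolding ts .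
  fix V assume V: "openin T V"
  have "openin (top_of_set (snd c ` fst c)) (snd c ` (V \<inter> fst c))"
    using homeomorphic_imp_open_map[OF h] V unfolding open_map_def openin_subtopology by blast
  then show "open (snd c ` (V \<inter> fst c))" using U(2) openin_open_eq by blast
next
  assume c: "topological_chart T c"
  then have U: "openin T (fst c)"
    and h: "homeomorphic_map (subtopology T (fst c)) (top_of_set (snd c ` fst c)) (snd c)"
    unfolding topological_chart_def by auto
  have ts: "topspace (subtopology T (fst c)) = fst c"
    using openin_subset[OF U(1)] by (rule topspace_subtopology_subset)
  fix W :: "(complex ^ 'b) set" assume W: "open W"
  have "openin (top_of_set (snd c ` fst c)) (W \<inter> snd c ` fst c)"
    using openin_open_Int[OF W, of "snd c ` fst c"] by (simp only: inf_commute)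
  then have "openin (subtopology T (fst c)) {p \<in> fst c. snd c p \<in> W \<inter> snd c ` fst c}"
    using openin_continuous_map_preimage[OF homeomorphic_imp_continuous_map[OF h]] unfolding ts by blast
  also have "{p \<in> fst c. snd c p \<in> W \<inter> snd c ` fst c} = {p \<in> fst c. snd c p \<in> W}" by auto
  finally show "openin T {p \<in> fst c. snd c p \<in> W}"
    using openin_open_subtopology[OF U] by blast
next
  assume A: "openin T (fst c) \<and> inj_on (snd c) (fst c) \<and>
     (\<forall>V. openin T V \<longrightarrow> open (snd c ` (V \<inter> fst c))) \<and>
     (\<forall>W. open W \<longrightarrow> openin T {p \<in> fst c. snd c p \<in> W})"
  then have U: "openin T (fst c)" by blast
  have ts: "topspace (subtopology T (fst c)) = fst c"
    using openin_subset[OF U] by (rule topspace_subtopology_subset)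
  have o: "open (snd c ` fst c)" using A U by (metis inf.idem)
  show "topological_chart T c" unfolding topological_chart_def
  proof (intro conjI)
    show "homeomorphic_map (subtopology T (fst c)) (top_of_set (snd c ` fst c)) (snd c)"
    proof (rule bijective_open_imp_homeomorphic_map)
      show "continuous_map (subtopology T (fst c)) (top_of_set (snd c ` fst c)) (snd c)"
        unfolding continuous_map_def ts openin_open_eq[OF o] openin_open_subtopology[OF U]
        using A by auto
      show "open_map (subtopology T (fst c)) (top_of_set (snd c ` fst c)) (snd c)"
        unfolding open_map_def openin_open_eq[OF o] openin_open_subtopology[OF U]
        using A by (metis image_mono inf.absorb1)
    qed (use A ts in auto)
  qed (use U o in auto)
qed

lemma topological_chartD:
  assumes "topological_chart T c"
  shows "openin T (fst c)" "inj_on (snd c) (fst c)" "open (snd c ` fst c)"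
    and "openin T V \<Longrightarrow> open (snd c ` (V \<inter> fst c))"
    and "open W \<Longrightarrow> openin T {p \<in> fst c. snd c p \<in> W}"
proof -
  note A = assms[unfolded topological_chart_iff]
  show "openin T (fst c)" "inj_on (snd c) (fst c)" using A by auto
  show "open (snd c ` fst c)" using assms unfolding topological_chart_def by blast
  show "openin T V \<Longrightarrow> open (snd c ` (V \<inter> fst c))" using A by auto
  show "open W \<Longrightarrow> openin T {p \<in> fst c. snd c p \<in> W}" using A by auto
qed

lemma chart_inv_left: "topological_chart T c \<Longrightarrow> p \<in> fst c \<Longrightarrow> chart_inv c (snd c p) = p"
  unfolding chart_inv_def by (rule inv_into_f_f[OF topological_chartD(2)])

lemma chart_inv_right:
  assumes "u \<in> snd c ` fst c"
  shows "chart_inv c u \<in> fst c" "snd c (chart_inv c u) = u"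
  using assms unfolding chart_inv_def by (auto intro: inv_into_into f_inv_into_f)

text \<open>
  The usual way to use a chart: a coordinate expression \<open>g\<close> of \<open>F\<close>
  replaces the composition with the inverse chart.
\<close>

lemma holo_map_on_rep:
  assumes b: "topological_chart T b" and g: "holo_map_on (snd b ` fst b) g"
    and e: "\<And>q. q \<in> fst b \<Longrightarrow> F q = g (snd b q)"
  shows "holo_map_on (snd b ` fst b) (F \<circ> chart_inv b)"
proof -
  have "\<forall>u\<in>snd b ` fst b. (F \<circ> chart_inv b) u = g u"
    using e chart_inv_left[OF b] by auto
  from holo_map_on_cong[OF topological_chartD(3)[OF b] this] g show ?thesis by (rule iffD2)
qed

text \<open>
  The Jacobian of a change of coordinates, as a linear map on components of tangent vectors.
\<close>

abbreviation jac :: "('a, 'n::finite) chart \<Rightarrow> ('a, 'n) chart \<Rightarrow> 'a \<Rightarrow> complex ^ 'n \<Rightarrow> complex ^ 'n" where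
  "jac c c' p \<equiv> frechet_derivative (transition c c') (at (snd c p))"

text \<open>
  Near the point the coordinate expression in \<open>b'\<close> is the one in
  \<open>b\<close> after the transition map, so this is the chain rule.  The hypothesis on the
  transition is stated at one point only, so that it also serves to extend an atlas.
\<close>

lemma cdiff_at_change_chart:
  assumes b: "topological_chart T b" "p \<in> fst b" and b': "topological_chart T b'" "p \<in> fst b'"
    and tr: "cdiff_at (transition b' b) (snd b' p)" and F: "cdiff_at (F \<circ> chart_inv b) (snd b p)"
  shows "cdiff_at (F \<circ> chart_inv b') (snd b' p)"
    and "frechet_derivative (F \<circ> chart_inv b') (at (snd b' p)) v
       = frechet_derivative (F \<circ> chart_inv b) (at (snd b p)) (jac b' b p v)"
proof -
  let ?S = "snd b' ` (fst b \<inter> fst b')"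
  have o: "open ?S" by (rule topological_chartD(4)[OF b'(1) topological_chartD(1)[OF b(1)]])
  have i: "snd b' p \<in> ?S" using b b' by auto
  have e: "\<forall>u\<in>?S. (F \<circ> chart_inv b') u = (F \<circ> chart_inv b) (transition b' b u)"
    by (auto simp: transition_def chart_inv_left[OF b(1)] chart_inv_left[OF b'(1)])
  have t: "transition b' b (snd b' p) = snd b p"
    by (simp add: transition_def chart_inv_left[OF b'])
  show "cdiff_at (F \<circ> chart_inv b') (snd b' p)"
    unfolding cdiff_at_cong(1)[OF o i e] by (rule cdiff_at_compose(1)[OF tr]) (simp only: t F)
  show "frechet_derivative (F \<circ> chart_inv b') (at (snd b' p)) v
       = frechet_derivative (F \<circ> chart_inv b) (at (snd b p)) (jac b' b p v)"
    unfolding cdiff_at_cong(2)[OF o i e] using cdiff_at_compose(2)[OF tr, of "F \<circ> chart_inv b"]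
    by (simp only: t F)
qed

lemma compatible_iff:
  assumes "topological_chart T c" "topological_chart T c'"
  shows "compatible c c' \<longleftrightarrow> (\<forall>p\<in>fst c \<inter> fst c'.
     cdiff_at (transition c c') (snd c p) \<and> cdiff_at (transition c' c) (snd c' p))"
  unfolding compatible_def holo_map_on_iff by auto

text \<open>
  A complex manifold without the separation and countability axioms: products and open parts inherit
  this much by purely local arguments.
\<close>

definition holo_atlas :: "('a, 'n::finite) cmanifold \<Rightarrow> bool" where
  "holo_atlas M \<longleftrightarrow> (\<forall>c\<in>atlas M. topological_chart (mtop M) c) \<and>
     \<Union> (fst ` atlas M) = points M \<and> (\<forall>c\<in>atlas M. \<forall>c'\<in>atlas M. compatible c c')"

lemma complex_manifold_iff:
  "complex_manifold M \<longleftrightarrow> Hausdorff_space (mtop M) \<and> second_countable (mtop M) \<and> holo_atlas M"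
  unfolding complex_manifold_def holo_atlas_def by auto

lemma chartsD: "c \<in> charts M \<Longrightarrow> topological_chart (mtop M) c"
  unfolding charts_def by blast

lemma charts_atD:
  assumes "c \<in> charts_at M p"
  shows "topological_chart (mtop M) c" "p \<in> fst c" "c \<in> charts M" "p \<in> points M"
  using assms openin_subset[OF topological_chartD(1), of "mtop M" c]
  unfolding charts_at_def charts_def by auto

lemma charts_subset_points: "c \<in> charts M \<Longrightarrow> fst c \<subseteq> points M"
  using openin_subset[OF topological_chartD(1)[OF chartsD]] .

lemma atlas_subset_charts: "holo_atlas M \<Longrightarrow> atlas M \<subseteq> charts M"
  unfolding holo_atlas_def charts_def by blast

lemma atlas_chart_at:
  assumes "holo_atlas M" "p \<in> points M"
  obtains b where "b \<in> atlas M" "b \<in> charts_at M p"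
  using assms atlas_subset_charts[OF assms(1)] unfolding holo_atlas_def charts_at_def by blast

text \<open>
  Charts of the maximal atlas are only required to be compatible with the given atlas; a chart of
  that atlas at \<open>p\<close> mediates between two of them.
\<close>

lemma cdiff_at_transition:
  assumes M: "holo_atlas M" and c: "c \<in> charts_at M p" and c': "c' \<in> charts_at M p"
  shows "cdiff_at (transition c c') (snd c p)"
proof -
  obtain b where b: "b \<in> atlas M" "b \<in> charts_at M p"
    using atlas_chart_at[OF M charts_atD(4)[OF c]] by metis
  have "compatible b c" "compatible b c'" using b(1) c c' unfolding charts_at_def charts_def by auto
  then have *: "cdiff_at (transition c b) (snd c p)" "cdiff_at (transition b c') (snd b p)"
    using charts_atD[OF b(2)] charts_atD[OF c] charts_atD[OF c']
    by (auto simp: compatible_iff[of "mtop M"])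
  show ?thesis
    using cdiff_at_change_chart(1)[OF charts_atD(1,2)[OF b(2)] charts_atD(1,2)[OF c] *(1), of "snd c'"] *(2)
    by (simp add: transition_def)
qed

lemma jac_trans:
  assumes M: "holo_atlas M" and c: "c \<in> charts_at M p" "c' \<in> charts_at M p" "c'' \<in> charts_at M p"
  shows "jac c c'' p v = jac c' c'' p (jac c c' p v)"
  using cdiff_at_change_chart(2)[OF charts_atD(1,2)[OF c(2)] charts_atD(1,2)[OF c(1)]
      cdiff_at_transition[OF M c(1,2)], of "snd c''"] cdiff_at_transition[OF M c(2,3)]
  by (simp add: transition_def)

lemma jac_self:
  assumes c: "c \<in> charts_at M p"
  shows "jac c c p v = v"
proof -
  note t = charts_atD[OF c]
  have "jac c c p = frechet_derivative (\<lambda>u. u) (at (snd c p))"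
    by (rule cdiff_at_cong(2)[OF topological_chartD(3)[OF t(1)]])
       (use t in \<open>auto simp: transition_def chart_inv_left[OF t(1)]\<close>)
  then show ?thesis by simp
qed

text \<open>
  A chart that is compatible with one chart at a point is compatible there with all of them.
\<close>

lemma chartsI:
  assumes M: "holo_atlas M" and c: "topological_chart (mtop M) c"
    and h: "\<And>p. p \<in> fst c \<Longrightarrow> \<exists>b\<in>charts_at M p.
      cdiff_at (transition b c) (snd b p) \<and> cdiff_at (transition c b) (snd c p)"
  shows "c \<in> charts M"
  unfolding charts_def
proof (intro CollectI conjI ballI c)
  fix a assume a: "a \<in> atlas M"
  then have a': "topological_chart (mtop M) a" using M unfolding holo_atlas_def by blast
  have "cdiff_at (transition a c) (snd a p) \<and> cdiff_at (transition c a) (snd c p)"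
    if p: "p \<in> fst a \<inter> fst c" for p
  proof -
    obtain b where b: "b \<in> charts_at M p" "cdiff_at (transition b c) (snd b p)"
      "cdiff_at (transition c b) (snd c p)" using h p by blast
    have ap: "a \<in> charts_at M p" using a p atlas_subset_charts[OF M] by (auto simp: charts_at_def)
    note pa = charts_atD(1,2)[OF ap] and pb = charts_atD(1,2)[OF b(1)]
    have pc: "p \<in> fst c" using p by simp
    show ?thesis
      using cdiff_at_change_chart(1)[OF pb pa cdiff_at_transition[OF M ap b(1)], of "snd c"] b(2)
        cdiff_at_change_chart(1)[OF pb c pc b(3), of "snd a"] cdiff_at_transition[OF M b(1) ap]
      by (simp add: transition_def)
  qed
  then show "compatible a c" unfolding compatible_iff[OF a' c] by blast
qed

lemma charts_restrict:
  assumes M: "holo_atlas M" and c: "c \<in> charts M" and V: "openin (mtop M) V"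
  shows "(fst c \<inter> V, snd c) \<in> charts M"
proof (rule chartsI[OF M])
  note t = chartsD[OF c]
  show t': "topological_chart (mtop M) (fst c \<inter> V, snd c)"
    unfolding topological_chart_iff fst_conv snd_conv
  proof (intro conjI allI impI)
    show "openin (mtop M) (fst c \<inter> V)" using topological_chartD(1)[OF t] V by blast
    show "inj_on (snd c) (fst c \<inter> V)" using topological_chartD(2)[OF t] by (rule inj_on_subset) auto
    show "open (snd c ` (S \<inter> (fst c \<inter> V)))" if "openin (mtop M) S" for S
      using topological_chartD(4)[OF t, of "S \<inter> V"] that V by (simp add: openin_Int Int_ac)
    show "openin (mtop M) {p \<in> fst c \<inter> V. snd c p \<in> W}" if "open W" for W
    proof -
      have "{p \<in> fst c \<inter> V. snd c p \<in> W} = {p \<in> fst c. snd c p \<in> W} \<inter> V" by auto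
      then show ?thesis using topological_chartD(5)[OF t that] V by (simp add: openin_Int)
    qed
  qed
  fix p assume "p \<in> fst (fst c \<inter> V, snd c)"
  then have p: "p \<in> fst c" "p \<in> V" by auto
  have cp: "c \<in> charts_at M p" using c p by (simp add: charts_at_def)
  let ?S = "snd c ` (fst c \<inter> V)"
  have S: "open ?S" using topological_chartD(4)[OF t V] by (simp add: Int_ac)
  have i: "snd c p \<in> ?S" using p by auto
  have "\<forall>u\<in>?S. transition c (fst c \<inter> V, snd c) u = u"
    by (auto simp: transition_def chart_inv_left[OF t])
  moreover have "\<forall>u\<in>?S. transition (fst c \<inter> V, snd c) c u = u"
    using chart_inv_right(2)[of _ "(fst c \<inter> V, snd c)"] by (simp add: transition_def)
  moreover have "cdiff_at (\<lambda>u. u) (snd c p)" by (rule cdiff_atI[OF has_derivative_ident]) simp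
  ultimately have "cdiff_at (transition c (fst c \<inter> V, snd c)) (snd c p)"
    "cdiff_at (transition (fst c \<inter> V, snd c) c) (snd c p)"
    by (simp_all only: cdiff_at_cong(1)[where g = "\<lambda>u. u", OF S i])
  then show "\<exists>b\<in>charts_at M p. cdiff_at (transition b (fst c \<inter> V, snd c)) (snd b p) \<and>
     cdiff_at (transition (fst c \<inter> V, snd c) b) (snd (fst c \<inter> V, snd c) p)"
    using cp by (intro bexI[of _ c]) auto
qed

section \<open>Tangent vectors\<close>

text \<open>
  The tangent vector with the prescribed components \<open>u\<close> in the chart \<open>c\<close>.
\<close>

definition tvec_of :: "('a, 'n::finite) cmanifold \<Rightarrow> ('a, 'n) chart \<Rightarrow> 'a \<Rightarrow> complex ^ 'n \<Rightarrow> ('a, 'n) tvec" where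
  "tvec_of M c p u = (\<lambda>c'. if c' \<in> charts_at M p then jac c c' p u else 0)"

lemma tangent_space_jac:
  "v \<in> tangent_space M p \<Longrightarrow> c \<in> charts_at M p \<Longrightarrow> c' \<in> charts_at M p \<Longrightarrow> v c' = jac c c' p (v c)"
  unfolding tangent_space_def by blast

lemma tvec_of_tangent:
  assumes "holo_atlas M" "c \<in> charts_at M p"
  shows "tvec_of M c p u \<in> tangent_space M p"
  unfolding tangent_space_def tvec_of_def
proof (intro CollectI conjI allI impI ballI)
  fix c' c'' assume c: "c' \<in> charts_at M p" "c'' \<in> charts_at M p"
  show "(if c'' \<in> charts_at M p then jac c c'' p u else 0)
      = jac c' c'' p (if c' \<in> charts_at M p then jac c c' p u else 0)"
    using jac_trans[OF assms c] c by simp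
qed simp

lemma tvec_of_self: "c \<in> charts_at M p \<Longrightarrow> tvec_of M c p u c = u"
  by (simp add: tvec_of_def jac_self)

lemma tangent_space_eqI:
  assumes "v \<in> tangent_space M p" "w \<in> tangent_space M p" "c \<in> charts_at M p" "v c = w c"
  shows "v = w"
proof
  fix c' show "v c' = w c'"
  proof (cases "c' \<in> charts_at M p")
    case True
    then show ?thesis
      using tangent_space_jac[OF assms(1,3) True] tangent_space_jac[OF assms(2,3) True] assms(4) by simp
  next
    case False
    then have "v c' = 0" "w c' = 0" using assms(1,2) unfolding tangent_space_def by blast+
    then show ?thesis by simp
  qed
qed

lemma tvec_of_component:
  assumes "holo_atlas M" "v \<in> tangent_space M p" "c \<in> charts_at M p"
  shows "v = tvec_of M c p (v c)"
  by (rule tangent_space_eqI[OF assms(2) tvec_of_tangent[OF assms(1,3)] assms(3)])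
     (simp add: tvec_of_self[OF assms(3)])

lemma coord_vec_eq: "coord_vec M c p i = tvec_of M c p (axis i 1)"
  unfolding coord_vec_def tvec_of_def by (rule refl)

lemma linear_jac:
  assumes "holo_atlas M" "c \<in> charts_at M p" "c' \<in> charts_at M p"
  shows "jac c c' p (a *s x + b *s y) = a *s jac c c' p x + b *s jac c c' p y"
  using cdiff_at_frechet(2,3)[OF cdiff_at_transition[OF assms]] by (simp add: linear_add)

lemma tangent_space_lincomb:
  assumes "holo_atlas M" "v \<in> tangent_space M p" "w \<in> tangent_space M p"
  shows "(\<lambda>c. a *s v c + b *s w c) \<in> tangent_space M p"
proof -
  have "a *s v c' + b *s w c' = jac c c' p (a *s v c + b *s w c)"
    if "c \<in> charts_at M p" "c' \<in> charts_at M p" for c c'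
    using tangent_space_jac[OF assms(2) that] tangent_space_jac[OF assms(3) that]
    by (simp add: linear_jac[OF assms(1) that])
  moreover have "a *s v c + b *s w c = 0" if "c \<notin> charts_at M p" for c
  proof -
    have "v c = 0" "w c = 0" using assms(2,3) that unfolding tangent_space_def by blast+
    then show ?thesis by simp
  qed
  ultimately show ?thesis unfolding tangent_space_def by blast
qed

section \<open>Holomorphic maps and their differentials\<close>

abbreviation map_deriv ::
  "('a \<Rightarrow> 'b) \<Rightarrow> ('a, 'n::finite) chart \<Rightarrow> ('b, 'm::finite) chart \<Rightarrow> 'a \<Rightarrow> complex ^ 'n \<Rightarrow> complex ^ 'm" where
  "map_deriv f b c p \<equiv> frechet_derivative (snd c \<circ> f \<circ> chart_inv b) (at (snd b p))"

lemma continuous_map_open_vimage: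
  "continuous_map S T f \<Longrightarrow> openin T V \<Longrightarrow> openin S {p \<in> topspace S. f p \<in> V}"
  unfolding continuous_map_def by blast

lemma cdiff_at_map_change_charts:
  assumes M: "holo_atlas M" and N: "holo_atlas N" and f: "continuous_map (mtop M) (mtop N) f"
    and b: "b \<in> charts_at M p" "b' \<in> charts_at M p"
    and c: "c \<in> charts_at N (f p)" "c' \<in> charts_at N (f p)"
    and d: "cdiff_at (snd c \<circ> f \<circ> chart_inv b) (snd b p)"
  shows "cdiff_at (snd c' \<circ> f \<circ> chart_inv b') (snd b' p)"
    and "map_deriv f b' c' p v = jac c c' (f p) (map_deriv f b c p (jac b' b p v))"
proof -
  note tb = charts_atD[OF b(1)] and tb' = charts_atD[OF b(2)]
    and tc = charts_atD[OF c(1)] and tc' = charts_atD[OF c(2)]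
  let ?V = "{q \<in> points M. f q \<in> fst c \<inter> fst c'}"
  let ?S = "snd b ` (?V \<inter> fst b)"
  have "openin (mtop M) ?V"
    by (intro continuous_map_open_vimage[OF f] openin_Int topological_chartD(1)[OF tc(1)]
        topological_chartD(1)[OF tc'(1)])
  then have S: "open ?S" by (rule topological_chartD(4)[OF tb(1)])
  have i: "snd b p \<in> ?S" using tb tc tc' by auto
  have e: "\<forall>u\<in>?S. (snd c' \<circ> f \<circ> chart_inv b) u = transition c c' ((snd c \<circ> f \<circ> chart_inv b) u)"
    by (auto simp: transition_def chart_inv_left[OF tb(1)] chart_inv_left[OF tc(1)])
  have s: "(snd c \<circ> f \<circ> chart_inv b) (snd b p) = snd c (f p)" by (simp add: chart_inv_left[OF tb(1,2)])
  have t: "cdiff_at (transition c c') ((snd c \<circ> f \<circ> chart_inv b) (snd b p))"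
    unfolding s by (rule cdiff_at_transition[OF N c])
  have d': "cdiff_at (snd c' \<circ> f \<circ> chart_inv b) (snd b p)"
    unfolding cdiff_at_cong(1)[OF S i e] by (rule cdiff_at_compose(1)[OF d t])
  have D': "map_deriv f b c' p w = jac c c' (f p) (map_deriv f b c p w)" for w
    unfolding cdiff_at_cong(2)[OF S i e] using cdiff_at_compose(2)[OF d t, of w] unfolding s .
  show "cdiff_at (snd c' \<circ> f \<circ> chart_inv b') (snd b' p)"
    by (rule cdiff_at_change_chart(1)[OF tb(1,2) tb'(1,2) cdiff_at_transition[OF M b(2,1)] d'])
  show "map_deriv f b' c' p v = jac c c' (f p) (map_deriv f b c p (jac b' b p v))"
    unfolding cdiff_at_change_chart(2)[OF tb(1,2) tb'(1,2) cdiff_at_transition[OF M b(2,1)] d'] D' ..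
qed

lemma holomorphic_mapD:
  assumes "holomorphic_map M N f" "b \<in> charts_at M p" "c \<in> charts_at N (f p)"
  shows "cdiff_at (snd c \<circ> f \<circ> chart_inv b) (snd b p)"
  using assms unfolding holomorphic_map_def holo_map_on_iff charts_at_def by auto

lemma holomorphic_map_continuous: "holomorphic_map M N f \<Longrightarrow> continuous_map (mtop M) (mtop N) f"
  unfolding holomorphic_map_def by blast

lemma holomorphic_map_funcset: "holomorphic_map M N f \<Longrightarrow> p \<in> points M \<Longrightarrow> f p \<in> points N"
  using holomorphic_map_continuous continuous_map_funspace by blast

text \<open>
  Coordinate expressions in one pair of charts around each point suffice.  Continuity need not be
  assumed: holomorphic coordinate expressions are continuous, and \<open>f\<close> maps the one
  chart domain into the other.
\<close>

lemma holomorphic_mapI: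
  assumes M: "holo_atlas M" and N: "holo_atlas N"
    and h: "\<And>p. p \<in> points M \<Longrightarrow> \<exists>b\<in>charts_at M p. \<exists>c\<in>charts N. f ` fst b \<subseteq> fst c \<and>
      holo_map_on (snd b ` fst b) (snd c \<circ> f \<circ> chart_inv b)"
  shows "holomorphic_map M N f"
proof -
  have oV: "openin (mtop M) {p \<in> points M. f p \<in> V}" if V: "openin (mtop N) V" for V
    unfolding openin_subopen[of _ "{p \<in> points M. f p \<in> V}"]
  proof
    fix p assume "p \<in> {p \<in> points M. f p \<in> V}"
    then have p: "p \<in> points M" "f p \<in> V" by auto
    obtain b c where b: "b \<in> charts_at M p" and c: "c \<in> charts N" and fb: "f ` fst b \<subseteq> fst c"
      and hol: "holo_map_on (snd b ` fst b) (snd c \<circ> f \<circ> chart_inv b)" using h[OF p(1)] by blast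
    note tb = charts_atD[OF b] and tc = chartsD[OF c]
    \<comment> \<open>The preimage of \<open>V\<close>, seen in the coordinates of \<open>b\<close>.\<close>
    define W where "W = snd b ` fst b \<inter> (snd c \<circ> f \<circ> chart_inv b) -` (snd c ` (V \<inter> fst c))"
    have W: "open W" unfolding W_def
      by (rule continuous_open_preimage[OF holo_map_on_continuous[OF hol]
            topological_chartD(3)[OF tb(1)] topological_chartD(4)[OF tc V]])
    have mem: "q \<in> {q \<in> fst b. snd b q \<in> W} \<longleftrightarrow> q \<in> fst b \<and> f q \<in> V" for q
    proof -
      have "snd c (f q) \<in> snd c ` (V \<inter> fst c) \<longleftrightarrow> f q \<in> V" if "q \<in> fst b"
      proof -
        have "f q \<in> fst c" using fb that by auto
        then show ?thesis using topological_chartD(2)[OF tc] inj_on_image_mem_iff[of "snd c" "fst c" "f q" "V \<inter> fst c"]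
          by auto
      qed
      moreover have "snd b q \<in> W \<longleftrightarrow> snd c (f q) \<in> snd c ` (V \<inter> fst c)" if "q \<in> fst b"
        using that by (simp add: W_def chart_inv_left[OF tb(1) that])
      ultimately show ?thesis by blast
    qed
    show "\<exists>T. openin (mtop M) T \<and> p \<in> T \<and> T \<subseteq> {p \<in> points M. f p \<in> V}"
    proof (intro exI conjI)
      show "openin (mtop M) {q \<in> fst b. snd b q \<in> W}" by (rule topological_chartD(5)[OF tb(1) W])
      show "p \<in> {q \<in> fst b. snd b q \<in> W}" by (simp only: mem tb(2) p(2) simp_thms)
      show "{q \<in> fst b. snd b q \<in> W} \<subseteq> {p \<in> points M. f p \<in> V}"
        using mem openin_subset[OF topological_chartD(1)[OF tb(1)]] by blast
    qed
  qed
  have fp: "f p \<in> points N" if p: "p \<in> points M" for p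
  proof -
    obtain b c where b: "b \<in> charts_at M p" and c: "c \<in> charts N" and "f ` fst b \<subseteq> fst c"
      using h[OF p] by blast
    then have "f p \<in> fst c" using charts_atD(2)[OF b] by blast
    then show ?thesis using charts_subset_points[OF c] by blast
  qed
  have cont: "continuous_map (mtop M) (mtop N) f"
    unfolding continuous_map_def
  proof (intro conjI allI impI)
    show "f \<in> points M \<rightarrow> points N" using fp by (rule Pi_I)
  qed (rule oV)
  show ?thesis unfolding holomorphic_map_def holo_map_on_iff
  proof (intro conjI cont ballI)
    fix b' c' u assume b': "b' \<in> charts M" and c': "c' \<in> charts N"
      and u: "u \<in> snd b' ` {p \<in> fst b'. f p \<in> fst c'}"
    then obtain p where p: "p \<in> fst b'" "f p \<in> fst c'" "u = snd b' p" by auto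
    then have b'p: "b' \<in> charts_at M p" and c'p: "c' \<in> charts_at N (f p)"
      using b' c' by (auto simp: charts_at_def)
    obtain b c where b: "b \<in> charts_at M p" and c: "c \<in> charts N" and fb: "f ` fst b \<subseteq> fst c"
      and hol: "holo_map_on (snd b ` fst b) (snd c \<circ> f \<circ> chart_inv b)" using h[OF charts_atD(4)[OF b'p]] by blast
    have c: "c \<in> charts_at N (f p)" using c fb charts_atD(2)[OF b] by (auto simp: charts_at_def)
    have d: "cdiff_at (snd c \<circ> f \<circ> chart_inv b) (snd b p)"
      using hol charts_atD(2)[OF b] unfolding holo_map_on_iff by blast
    show "cdiff_at (snd c' \<circ> f \<circ> chart_inv b') u"
      unfolding p(3) by (rule cdiff_at_map_change_charts(1)[OF M N cont b b'p c c'p d])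
  qed
qed

text \<open>Independence of the chart chosen in the definition of the differential.\<close>

lemma differential_component:
  assumes M: "holo_atlas M" and N: "holo_atlas N" and f: "holomorphic_map M N f"
    and v: "v \<in> tangent_space M p" and b: "b \<in> charts_at M p" and c: "c \<in> charts_at N (f p)"
  shows "differential M N f p v c = map_deriv f b c p (v b)"
proof -
  define b0 where "b0 = (SOME b. b \<in> charts_at M p)"
  have b0: "b0 \<in> charts_at M p" unfolding b0_def using b by (rule someI)
  have "differential M N f p v c = map_deriv f b0 c p (v b0)"
    unfolding differential_def Let_def b0_def[symmetric] using c by simp
  also have "\<dots> = jac c c (f p) (map_deriv f b c p (jac b0 b p (v b0)))"
    by (rule cdiff_at_map_change_charts(2)[OF M N holomorphic_map_continuous[OF f] b b0 c c
          holomorphic_mapD[OF f b c]])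
  also have "\<dots> = map_deriv f b c p (v b)"
    unfolding jac_self[OF c] tangent_space_jac[OF v b0 b, symmetric] ..
  finally show ?thesis .
qed

lemma differential_tangent:
  assumes M: "holo_atlas M" and N: "holo_atlas N" and f: "holomorphic_map M N f"
    and v: "v \<in> tangent_space M p" and p: "p \<in> points M"
  shows "differential M N f p v \<in> tangent_space N (f p)"
proof -
  obtain b where b: "b \<in> charts_at M p" using atlas_chart_at[OF M p] by blast
  have "differential M N f p v c' = jac c c' (f p) (differential M N f p v c)"
    if c: "c \<in> charts_at N (f p)" "c' \<in> charts_at N (f p)" for c c'
    using cdiff_at_map_change_charts(2)[OF M N holomorphic_map_continuous[OF f] b b c
        holomorphic_mapD[OF f b c(1)], of "v b"] jac_self[OF b]
    by (simp add: differential_component[OF M N f v b] c)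
  moreover have "differential M N f p v c = 0" if "c \<notin> charts_at N (f p)" for c
    using that unfolding differential_def Let_def by simp
  ultimately show ?thesis unfolding tangent_space_def by blast
qed

text \<open>Computing a differential from any coordinate expression valid near the point.\<close>

lemma differential_local_rep:
  assumes M: "holo_atlas M" and N: "holo_atlas N" and f: "holomorphic_map M N f"
    and v: "v \<in> tangent_space M p" and b: "b \<in> charts_at M p" and c: "c \<in> charts_at N (f p)"
    and V: "openin (mtop M) V" "p \<in> V" and g: "\<And>q. q \<in> V \<Longrightarrow> q \<in> fst b \<Longrightarrow> snd c (f q) = g (snd b q)"
    and D: "(g has_derivative D) (at (snd b p))"
  shows "differential M N f p v c = D (v b)"
proof -
  note t = charts_atD[OF b]
  let ?S = "snd b ` (V \<inter> fst b)"
  have S: "open ?S" by (rule topological_chartD(4)[OF t(1) V(1)])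
  have e: "(snd c \<circ> f \<circ> chart_inv b) u = g u" if "u \<in> ?S" for u
    using that g by (auto simp: chart_inv_left[OF t(1)])
  have i: "snd b p \<in> ?S" using V(2) t(2) by blast
  have "((snd c \<circ> f \<circ> chart_inv b) has_derivative D) (at (snd b p))"
    using has_derivative_cong_open[of ?S "snd b p" "snd c \<circ> f \<circ> chart_inv b" g D, OF S i e] D by simp
  then have "map_deriv f b c p = D" by (rule frechet_derivative_at[symmetric])
  then show ?thesis unfolding differential_component[OF M N f v b c] by simp
qed

lemma holomorphic_map_compose:
  assumes M: "holo_atlas M" and N: "holo_atlas N" and P: "holo_atlas P"
    and f: "holomorphic_map M N f" and g: "holomorphic_map N P g"
  shows "holomorphic_map M P (g \<circ> f)"
  unfolding holomorphic_map_def holo_map_on_iff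
proof (intro conjI ballI)
  show "continuous_map (mtop M) (mtop P) (g \<circ> f)"
    by (rule continuous_map_compose[OF holomorphic_map_continuous[OF f] holomorphic_map_continuous[OF g]])
  fix b d u assume b: "b \<in> charts M" and d: "d \<in> charts P" and "u \<in> snd b ` {p \<in> fst b. (g \<circ> f) p \<in> fst d}"
  then obtain p where p: "p \<in> fst b" "g (f p) \<in> fst d" "u = snd b p" by auto
  have b: "b \<in> charts_at M p" and d: "d \<in> charts_at P (g (f p))" using b d p by (auto simp: charts_at_def)
  obtain c where c: "c \<in> charts_at N (f p)"
    by (rule atlas_chart_at[OF N holomorphic_map_funcset[OF f charts_atD(4)[OF b]]])
  note tb = charts_atD[OF b] and tc = charts_atD[OF c]
  let ?S = "snd b ` ({q \<in> points M. f q \<in> fst c} \<inter> fst b)"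
  have S: "open ?S"
    by (intro topological_chartD(4)[OF tb(1)] continuous_map_open_vimage[OF holomorphic_map_continuous[OF f]]
        topological_chartD(1)[OF tc(1)])
  have i: "snd b p \<in> ?S" using tb tc by auto
  have e: "\<forall>u\<in>?S. (snd d \<circ> (g \<circ> f) \<circ> chart_inv b) u
      = (snd d \<circ> g \<circ> chart_inv c) ((snd c \<circ> f \<circ> chart_inv b) u)"
    by (auto simp: chart_inv_left[OF tb(1)] chart_inv_left[OF tc(1)])
  have s: "(snd c \<circ> f \<circ> chart_inv b) (snd b p) = snd c (f p)" by (simp add: chart_inv_left[OF tb(1,2)])
  show "cdiff_at (snd d \<circ> (g \<circ> f) \<circ> chart_inv b) u"
    unfolding p(3) cdiff_at_cong(1)[OF S i e]
    by (rule cdiff_at_compose(1)[OF holomorphic_mapD[OF f b c]]) (unfold s, rule holomorphic_mapD[OF g c d])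
qed

lemma holomorphic_map_cong:
  assumes f: "holomorphic_map M N f" and e: "\<And>p. p \<in> points M \<Longrightarrow> f p = g p"
  shows "holomorphic_map M N g"
  unfolding holomorphic_map_def holo_map_on_iff
proof (intro conjI ballI)
  show g: "continuous_map (mtop M) (mtop N) g"
    by (rule continuous_map_eq[OF holomorphic_map_continuous[OF f] e])
  fix b c u assume b: "b \<in> charts M" and c: "c \<in> charts N" and "u \<in> snd b ` {p \<in> fst b. g p \<in> fst c}"
  then obtain p where p: "p \<in> fst b" "g p \<in> fst c" "u = snd b p" by auto
  have bp: "b \<in> charts_at M p" using b p by (simp add: charts_at_def)
  have cp: "c \<in> charts_at N (f p)" using c p(2) unfolding charts_at_def e[OF charts_atD(4)[OF bp]] by blast
  note t = charts_atD[OF bp]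
  have "\<forall>x\<in>snd b ` fst b. (snd c \<circ> f \<circ> chart_inv b) x = (snd c \<circ> g \<circ> chart_inv b) x"
  proof
    fix x assume "x \<in> snd b ` fst b"
    from chart_inv_right(1)[OF this] have "chart_inv b x \<in> points M" using charts_subset_points[OF b] by blast
    from e[OF this] show "(snd c \<circ> f \<circ> chart_inv b) x = (snd c \<circ> g \<circ> chart_inv b) x"
      by (simp only: o_apply)
  qed
  from cdiff_at_cong(1)[OF topological_chartD(3)[OF t(1)] imageI[OF t(2)] this] holomorphic_mapD[OF f bp cp]
  show "cdiff_at (snd c \<circ> g \<circ> chart_inv b) u" unfolding p(3) by (rule iffD1)
qed

lemma holomorphic_map_id:
  assumes "holo_atlas M"
  shows "holomorphic_map M M (\<lambda>p. p)"
proof (rule holomorphic_mapI[OF assms assms])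
  fix p assume "p \<in> points M"
  then obtain b where b: "b \<in> charts_at M p" using atlas_chart_at[OF assms] by blast
  have "holo_map_on (snd b ` fst b) (snd b \<circ> (\<lambda>p. p) \<circ> chart_inv b)"
    unfolding holo_map_on_iff
  proof
    fix u assume u: "u \<in> snd b ` fst b"
    have e: "\<forall>u\<in>snd b ` fst b. (snd b \<circ> (\<lambda>p. p) \<circ> chart_inv b) u = u"
      by (simp add: chart_inv_right(2))
    have "cdiff_at (\<lambda>u. u) u" by (rule cdiff_atI[OF has_derivative_ident]) simp
    with cdiff_at_cong(1)[OF topological_chartD(3)[OF charts_atD(1)[OF b]] u e]
    show "cdiff_at (snd b \<circ> (\<lambda>p. p) \<circ> chart_inv b) u" by (rule iffD2)
  qed
  then show "\<exists>b\<in>charts_at M p. \<exists>c\<in>charts M. (\<lambda>p. p) ` fst b \<subseteq> fst c \<and>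
      holo_map_on (snd b ` fst b) (snd c \<circ> (\<lambda>p. p) \<circ> chart_inv b)"
    using b charts_atD(3)[OF b] by (intro bexI[of _ b]) auto
qed

section \<open>Velocities\<close>

text \<open>
  One coordinate expression of the curve determines the components of its velocity in all charts by
  the chain rule, so the velocity satisfies the transformation law of a tangent vector.
\<close>

lemma velocity_component:
  assumes M: "holo_atlas M" and c: "c \<in> charts_at M (\<gamma> 0)"
    and e: "eventually (\<lambda>t. \<gamma> t \<in> fst c) (at 0)"
    and d: "((\<lambda>t. snd c (\<gamma> t)) has_vector_derivative w) (at 0)"
  shows "velocity M \<gamma> \<in> tangent_space M (\<gamma> 0)" "velocity M \<gamma> c = w"
proof -
  have *: "velocity M \<gamma> c' = jac c c' (\<gamma> 0) w" if c': "c' \<in> charts_at M (\<gamma> 0)" for c'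
  proof -
    note t = charts_atD[OF c]
    have "((\<lambda>t. transition c c' (snd c (\<gamma> t))) has_vector_derivative jac c c' (\<gamma> 0) w) (at 0)"
    proof -
      have "((\<lambda>t. transition c c' (snd c (\<gamma> t))) has_derivative (\<lambda>s. jac c c' (\<gamma> 0) (s *\<^sub>R w))) (at 0)"
        by (rule has_derivative_compose[OF d[unfolded has_vector_derivative_def]
              cdiff_at_frechet(1)[OF cdiff_at_transition[OF M c c']]])
      then show ?thesis unfolding has_vector_derivative_def
        by (rule has_derivative_eq_rhs)
           (simp add: fun_eq_iff linear_scale[OF cdiff_at_frechet(3)[OF cdiff_at_transition[OF M c c']]])
    qed
    moreover have "eventually (\<lambda>t. transition c c' (snd c (\<gamma> t)) = snd c' (\<gamma> t)) (at 0)"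
      using e by eventually_elim (simp add: transition_def chart_inv_left[OF t(1)])
    ultimately have "((\<lambda>t. snd c' (\<gamma> t)) has_vector_derivative jac c c' (\<gamma> 0) w) (at 0)"
      unfolding has_vector_derivative_def using t(2)
      by (elim has_derivative_transform_eventually) (simp_all add: transition_def chart_inv_left[OF t(1)])
    then show ?thesis unfolding velocity_def using c' by (simp add: vector_derivative_at)
  qed
  have "velocity M \<gamma> = tvec_of M c (\<gamma> 0) w"
    unfolding tvec_of_def using * by (auto simp: velocity_def)
  then show "velocity M \<gamma> \<in> tangent_space M (\<gamma> 0)" "velocity M \<gamma> c = w"
    using tvec_of_tangent[OF M c] tvec_of_self[OF c] by auto
qed

section \<open>Open submanifolds and products\<close>

lemma mtop_open_submanifold [simp]: "mtop (open_submanifold M W) = subtopology (mtop M) W"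
  by (simp add: open_submanifold_def)

lemma points_open_submanifold:
  "openin (mtop M) W \<Longrightarrow> points (open_submanifold M W) = W"
  unfolding mtop_open_submanifold by (rule topspace_subtopology_subset[OF openin_subset])

lemma atlas_open_submanifold: "atlas (open_submanifold M W) = (\<lambda>c. (fst c \<inter> W, snd c)) ` atlas M"
  by (simp add: open_submanifold_def case_prod_beta)

lemma topological_chart_subtopology:
  assumes W: "openin T W"
  shows "topological_chart (subtopology T W) c \<longleftrightarrow> topological_chart T c \<and> fst c \<subseteq> W"
proof
  assume c: "topological_chart (subtopology T W) c"
  note D = topological_chartD[OF c]
  have "openin T (fst c)" and cW: "fst c \<subseteq> W" using D(1) openin_open_subtopology[OF W] by auto
  moreover have "open (snd c ` (V \<inter> fst c))" if "openin T V" for V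
  proof -
    have "openin (subtopology T W) (V \<inter> W)" using that openin_subtopology by blast
    from D(4)[OF this] show ?thesis using cW by (simp add: Int_assoc Int_absorb1)
  qed
  moreover have "openin T {p \<in> fst c. snd c p \<in> V}" if "open V" for V
    using D(5)[OF that] openin_open_subtopology[OF W] by blast
  ultimately show "topological_chart T c \<and> fst c \<subseteq> W"
    unfolding topological_chart_iff using D(2) by blast
next
  assume c: "topological_chart T c \<and> fst c \<subseteq> W"
  note D = topological_chartD[OF conjunct1[OF c]]
  have "openin (subtopology T W) (fst c)" using c D(1) openin_open_subtopology[OF W] by blast
  moreover have "open (snd c ` (V \<inter> fst c))" if "openin (subtopology T W) V" for V
    using D(4) that openin_open_subtopology[OF W] by blast
  moreover have "openin (subtopology T W) {p \<in> fst c. snd c p \<in> V}" if "open V" for V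
    using D(5)[OF that] c openin_open_subtopology[OF W] by blast
  ultimately show "topological_chart (subtopology T W) c"
    unfolding topological_chart_iff using D(2) by blast
qed

lemma compatible_charts:
  assumes M: "holo_atlas M" and c: "c \<in> charts M" "c' \<in> charts M"
  shows "compatible c c'"
  unfolding compatible_iff[OF chartsD[OF c(1)] chartsD[OF c(2)]]
proof
  fix p assume "p \<in> fst c \<inter> fst c'"
  then have "c \<in> charts_at M p" "c' \<in> charts_at M p" using c by (auto simp: charts_at_def)
  then show "cdiff_at (transition c c') (snd c p) \<and> cdiff_at (transition c' c) (snd c' p)"
    using cdiff_at_transition[OF M] by blast
qed

lemma atlas_open_submanifold_subset:
  assumes M: "holo_atlas M" and W: "openin (mtop M) W"
  shows "atlas (open_submanifold M W) \<subseteq> {c \<in> charts M. fst c \<subseteq> W}"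
  using charts_restrict[OF M _ W] atlas_subset_charts[OF M]
  unfolding atlas_open_submanifold by auto

lemma holo_atlas_open_submanifold:
  assumes M: "holo_atlas M" and W: "openin (mtop M) W"
  shows "holo_atlas (open_submanifold M W)"
proof -
  note s = atlas_open_submanifold_subset[OF M W]
  have "topological_chart (mtop (open_submanifold M W)) c" if "c \<in> atlas (open_submanifold M W)" for c
    using that s chartsD[of c M] by (auto simp: topological_chart_subtopology[OF W])
  moreover have "\<Union> (fst ` atlas (open_submanifold M W)) = points (open_submanifold M W)"
  proof -
    have "\<Union> (fst ` atlas (open_submanifold M W)) = \<Union> (fst ` atlas M) \<inter> W"
      unfolding atlas_open_submanifold by auto
    also have "\<dots> = W" using M openin_subset[OF W] unfolding holo_atlas_def by blast
    finally show ?thesis unfolding points_open_submanifold[OF W] .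
  qed
  moreover have "compatible c c'"
    if "c \<in> atlas (open_submanifold M W)" "c' \<in> atlas (open_submanifold M W)" for c c'
    using compatible_charts[OF M] that s by blast
  ultimately show ?thesis unfolding holo_atlas_def by blast
qed

text \<open>
  The charts of an open part are exactly the charts of the manifold with domain inside it; hence
  tangent vectors on both are related by restriction to a smaller family of charts.
\<close>

lemma charts_open_submanifold:
  assumes M: "holo_atlas M" and W: "openin (mtop M) W"
  shows "charts (open_submanifold M W) = {c \<in> charts M. fst c \<subseteq> W}"
proof (intro equalityI subsetI)
  fix c assume c: "c \<in> charts (open_submanifold M W)"
  then have t: "topological_chart (mtop M) c" and cW: "fst c \<subseteq> W"
    using chartsD[OF c] by (auto simp: topological_chart_subtopology[OF W])
  have "c \<in> charts M"
  proof (rule chartsI[OF M t])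
    fix p assume p: "p \<in> fst c"
    have "p \<in> points (open_submanifold M W)" using p cW points_open_submanifold[OF W] by blast
    then obtain b where b: "b \<in> atlas (open_submanifold M W)" "b \<in> charts_at (open_submanifold M W) p"
      using atlas_chart_at[OF holo_atlas_open_submanifold[OF M W]] by metis
    have bM: "b \<in> charts M" using b(1) atlas_open_submanifold_subset[OF M W] by blast
    have pb: "p \<in> fst b" using charts_atD(2)[OF b(2)] .
    have "compatible b c" using b(1) c unfolding charts_def by blast
    then have "cdiff_at (transition b c) (snd b p) \<and> cdiff_at (transition c b) (snd c p)"
      using compatible_iff[OF chartsD[OF bM] t] p pb by blast
    then show "\<exists>b\<in>charts_at M p. cdiff_at (transition b c) (snd b p) \<and> cdiff_at (transition c b) (snd c p)"
      using bM pb unfolding charts_at_def by blast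
  qed
  then show "c \<in> {c \<in> charts M. fst c \<subseteq> W}" using cW by blast
next
  fix c assume c: "c \<in> {c \<in> charts M. fst c \<subseteq> W}"
  then have "topological_chart (mtop (open_submanifold M W)) c"
    using chartsD[of c M] by (simp add: topological_chart_subtopology[OF W])
  moreover have "compatible b c" if "b \<in> atlas (open_submanifold M W)" for b
    using that c atlas_open_submanifold_subset[OF M W] compatible_charts[OF M] by blast
  ultimately show "c \<in> charts (open_submanifold M W)" unfolding charts_def by blast
qed

lemma charts_at_open_submanifold:
  assumes M: "holo_atlas M" and W: "openin (mtop M) W"
  shows "charts_at (open_submanifold M W) p = {c \<in> charts_at M p. fst c \<subseteq> W}"
  unfolding charts_at_def charts_open_submanifold[OF assms] by blast

lemma complex_manifold_open_submanifold:
  assumes "complex_manifold M" "openin (mtop M) W"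
  shows "complex_manifold (open_submanifold M W)"
  using assms(1) holo_atlas_open_submanifold[OF _ assms(2)]
  unfolding complex_manifold_iff
  by (simp add: Hausdorff_space_subtopology second_countable_subtopology)

lemma open_submanifold_points:
  assumes M: "holo_atlas M"
  shows "open_submanifold M (points M) = M"
proof -
  have "(\<lambda>c. (fst c \<inter> points M, snd c)) ` atlas M = (\<lambda>c. c) ` atlas M"
  proof (rule image_cong[OF refl])
    fix c assume "c \<in> atlas M"
    then have "fst c \<subseteq> points M" using charts_subset_points atlas_subset_charts[OF M] by blast
    then show "(fst c \<inter> points M, snd c) = c" by (simp add: Int_absorb2)
  qed
  then have "atlas (open_submanifold M (points M)) = atlas M"
    unfolding atlas_open_submanifold by simp
  moreover have "mtop (open_submanifold M (points M)) = mtop M" by simp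
  ultimately show ?thesis by (metis cmanifold.expand)
qed

lemma cdiff_at_componentwise: "cdiff_at f x \<longleftrightarrow> (\<forall>i. holo_fun_on {x} (\<lambda>y. f y $ i))"
  using holo_map_on_iff[of "{x}" f] unfolding holo_map_on_def by simp

text \<open>
  The coordinates of a product manifold are indexed by a sum type; this is the isomorphism of the
  model spaces with its two projections.
\<close>

definition vjoin :: "complex ^ 'n::finite \<Rightarrow> complex ^ 'm::finite \<Rightarrow> complex ^ ('n + 'm)" where
  "vjoin u v = (\<chi> k. case k of Inl i \<Rightarrow> u $ i | Inr j \<Rightarrow> v $ j)"

definition vleft :: "complex ^ ('n::finite + 'm::finite) \<Rightarrow> complex ^ 'n" where
  "vleft u = (\<chi> i. u $ Inl i)"

definition vright :: "complex ^ ('n::finite + 'm::finite) \<Rightarrow> complex ^ 'm" where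
  "vright u = (\<chi> i. u $ Inr i)"

lemma vjoin_simps [simp]:
  "vleft (vjoin u v) = u" "vright (vjoin u v) = v" "vjoin (vleft w) (vright w) = w"
  "vjoin u v $ Inl i = u $ i" "vjoin u v $ Inr j = v $ j" "vleft w $ i = w $ Inl i" "vright w $ j = w $ Inr j"
  by (auto simp: vjoin_def vleft_def vright_def vec_eq_iff split: sum.split)

lemma cdiff_at_vleft: "cdiff_at vleft x" and cdiff_at_vright: "cdiff_at vright x"
  unfolding cdiff_at_componentwise by (simp_all add: holo_fun_on_nth)

lemma cdiff_at_vjoin:
  assumes "cdiff_at f x" "cdiff_at g x"
  shows "cdiff_at (\<lambda>y. vjoin (f y) (g y)) x"
  unfolding cdiff_at_componentwise
proof
  fix k show "holo_fun_on {x} (\<lambda>y. vjoin (f y) (g y) $ k)"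
    using assms unfolding cdiff_at_componentwise by (cases k) simp_all
qed

definition prod_chart ::
  "('a, 'n::finite) chart \<Rightarrow> ('b, 'm::finite) chart \<Rightarrow> ('a \<times> 'b, 'n + 'm) chart" where
  "prod_chart c d = (fst c \<times> fst d, \<lambda>(x, y). vjoin (snd c x) (snd d y))"

lemma fst_prod_chart [simp]: "fst (prod_chart c d) = fst c \<times> fst d"
  and snd_prod_chart [simp]: "snd (prod_chart c d) (x, y) = vjoin (snd c x) (snd d y)"
  by (simp_all add: prod_chart_def)

lemma mtop_prod_manifold [simp]: "mtop (prod_manifold M N) = prod_topology (mtop M) (mtop N)"
  by (simp add: prod_manifold_def)

lemma atlas_prod_manifold:
  "atlas (prod_manifold M N) = {prod_chart c d | c d. c \<in> atlas M \<and> d \<in> atlas N}"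
  unfolding prod_manifold_def cmanifold.sel prod_chart_def vjoin_def by (auto 4 4)

lemma continuous_on_vjoin: "continuous_on UNIV (\<lambda>p. vjoin (fst p) (snd p))"
proof -
  have "continuous_on UNIV (\<lambda>p. case k of Inl i \<Rightarrow> fst p $ i | Inr j \<Rightarrow> snd p $ j)"
    for k :: "'n::finite + 'm::finite"
    by (cases k) (auto intro!: continuous_intros)
  then show ?thesis unfolding vjoin_def by (intro continuous_on_vec_lambda)
qed

lemma topological_chart_prod:
  assumes c: "topological_chart T c" and d: "topological_chart S d"
  shows "topological_chart (prod_topology T S) (prod_chart c d)"
  unfolding topological_chart_iff
proof (intro conjI allI impI)
  note C = topological_chartD[OF c] and D = topological_chartD[OF d]
  show "openin (prod_topology T S) (fst (prod_chart c d))"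
    using C(1) D(1) by (simp add: openin_prod_Times_iff)
  have inj: "vjoin u v = vjoin u' v' \<longleftrightarrow> u = u' \<and> v = v'"
    for u u' :: "complex ^ 'b" and v v' :: "complex ^ 'd"
    by (metis vjoin_simps(1,2))
  show "inj_on (snd (prod_chart c d)) (fst (prod_chart c d))"
    using C(2) D(2) by (auto simp: inj_on_def inj)
  show "open (snd (prod_chart c d) ` (V \<inter> fst (prod_chart c d)))" if V: "openin (prod_topology T S) V" for V
    unfolding open_subopen[of "snd (prod_chart c d) ` (V \<inter> fst (prod_chart c d))"]
  proof
    fix u assume "u \<in> snd (prod_chart c d) ` (V \<inter> fst (prod_chart c d))"
    then obtain x y where xy: "(x, y) \<in> V" "x \<in> fst c" "y \<in> fst d" "u = vjoin (snd c x) (snd d y)" by auto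
    obtain A B where AB: "openin T A" "openin S B" "x \<in> A" "y \<in> B" "A \<times> B \<subseteq> V"
      using V[unfolded openin_prod_topology_alt, rule_format, OF xy(1)] by (elim exE conjE)
    let ?O = "vleft -` (snd c ` (A \<inter> fst c)) \<inter> vright -` (snd d ` (B \<inter> fst d))"
    have cont: "continuous_on UNIV (vleft :: complex ^ ('b + 'd) \<Rightarrow> _)"
      "continuous_on UNIV (vright :: complex ^ ('b + 'd) \<Rightarrow> _)"
      unfolding vleft_def vright_def by (intro continuous_on_vec_lambda continuous_intros)+
    have "open ?O"
      by (intro open_Int open_vimage C(4) D(4) AB cont)
    moreover have "u \<in> ?O" using xy AB by auto
    moreover have "?O \<subseteq> snd (prod_chart c d) ` (V \<inter> fst (prod_chart c d))"
    proof
      fix w assume "w \<in> ?O"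
      then obtain a b where ab: "a \<in> A \<inter> fst c" "vleft w = snd c a" "b \<in> B \<inter> fst d" "vright w = snd d b"
        by auto
      have "w = snd (prod_chart c d) (a, b)"
        using vjoin_simps(3)[of w] ab by simp
      moreover have "(a, b) \<in> V \<inter> fst (prod_chart c d)" using ab AB(5) by auto
      ultimately show "w \<in> snd (prod_chart c d) ` (V \<inter> fst (prod_chart c d))" by (rule image_eqI)
    qed
    ultimately show "\<exists>Q. open Q \<and> u \<in> Q \<and> Q \<subseteq> snd (prod_chart c d) ` (V \<inter> fst (prod_chart c d))"
      by blast
  qed
  show "openin (prod_topology T S) {p \<in> fst (prod_chart c d). snd (prod_chart c d) p \<in> W}" if W: "open W" for W
    unfolding openin_prod_topology_alt
  proof (intro allI impI)
    fix x y assume "(x, y) \<in> {p \<in> fst (prod_chart c d). snd (prod_chart c d) p \<in> W}"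
    then have xy: "x \<in> fst c" "y \<in> fst d" "vjoin (snd c x) (snd d y) \<in> W" by auto
    have "open ((\<lambda>p. vjoin (fst p) (snd p)) -` W)" by (rule open_vimage[OF W continuous_on_vjoin])
    moreover have "(snd c x, snd d y) \<in> (\<lambda>p. vjoin (fst p) (snd p)) -` W" using xy by simp
    ultimately obtain A B where AB: "open A" "open B" "snd c x \<in> A" "snd d y \<in> B"
      "A \<times> B \<subseteq> (\<lambda>p. vjoin (fst p) (snd p)) -` W"
      by (rule open_prod_elim) blast
    show "\<exists>U V. openin T U \<and> openin S V \<and> x \<in> U \<and> y \<in> V \<and>
        U \<times> V \<subseteq> {p \<in> fst (prod_chart c d). snd (prod_chart c d) p \<in> W}"
      by (rule exI[of _ "{x \<in> fst c. snd c x \<in> A}"], rule exI[of _ "{y \<in> fst d. snd d y \<in> B}"])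
         (use C(5)[OF AB(1)] D(5)[OF AB(2)] AB xy in auto)
  qed
qed

lemma holo_atlas_prod_manifold:
  assumes M: "holo_atlas M" and N: "holo_atlas N"
  shows "holo_atlas (prod_manifold M N)"
  unfolding holo_atlas_def
proof (intro conjI ballI)
  have t: "topological_chart (mtop M) c" if "c \<in> atlas M" for c using that M unfolding holo_atlas_def by blast
  have t': "topological_chart (mtop N) c" if "c \<in> atlas N" for c using that N unfolding holo_atlas_def by blast
  show T: "topological_chart (mtop (prod_manifold M N)) e" if e: "e \<in> atlas (prod_manifold M N)" for e
  proof -
    obtain c d where "c \<in> atlas M" "d \<in> atlas N" "e = prod_chart c d"
      using e unfolding atlas_prod_manifold by blast
    then show ?thesis using topological_chart_prod[OF t t'] by simp
  qed
  have "\<Union> (fst ` atlas (prod_manifold M N)) = \<Union> (fst ` atlas M) \<times> \<Union> (fst ` atlas N)"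
    unfolding atlas_prod_manifold by (auto simp: prod_chart_def) blast
  then show "\<Union> (fst ` atlas (prod_manifold M N)) = points (prod_manifold M N)"
    using M N unfolding holo_atlas_def by simp
  \<comment> \<open>One half of compatibility; the other half is the same with the charts exchanged.\<close>
  have half: "cdiff_at (transition (prod_chart c d) (prod_chart c' d')) (snd (prod_chart c d) p)"
    if cd: "c \<in> atlas M" "d \<in> atlas N" "c' \<in> atlas M" "d' \<in> atlas N"
      and p: "p \<in> fst (prod_chart c d) \<inter> fst (prod_chart c' d')" for c d c' d' p
  proof -
    obtain x y where xy: "p = (x, y)" "x \<in> fst c" "y \<in> fst d" "x \<in> fst c'" "y \<in> fst d'" using p by auto
    note P = topological_chart_prod[OF t[OF cd(1)] t'[OF cd(2)]]
    have e: "\<forall>u\<in>snd (prod_chart c d) ` fst (prod_chart c d). transition (prod_chart c d) (prod_chart c' d') u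
        = vjoin (transition c c' (vleft u)) (transition d d' (vright u))"
    proof
      fix u assume "u \<in> snd (prod_chart c d) ` fst (prod_chart c d)"
      then obtain a b where ab: "a \<in> fst c" "b \<in> fst d" "u = snd (prod_chart c d) (a, b)" by auto
      then have "chart_inv (prod_chart c d) u = (a, b)" by (simp only: chart_inv_left[OF P] fst_prod_chart SigmaI)
      then show "transition (prod_chart c d) (prod_chart c' d') u
          = vjoin (transition c c' (vleft u)) (transition d d' (vright u))"
        using ab by (simp add: transition_def chart_inv_left[OF t[OF cd(1)]] chart_inv_left[OF t'[OF cd(2)]])
    qed
    have C: "cdiff_at (transition c c') (snd c x)"
      by (rule cdiff_at_transition[OF M]) (use cd xy atlas_subset_charts[OF M] in \<open>auto simp: charts_at_def\<close>)
    have D: "cdiff_at (transition d d') (snd d y)"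
      by (rule cdiff_at_transition[OF N]) (use cd xy atlas_subset_charts[OF N] in \<open>auto simp: charts_at_def\<close>)
    have i: "snd (prod_chart c d) p \<in> snd (prod_chart c d) ` fst (prod_chart c d)" using p by blast
    have "cdiff_at (\<lambda>u. vjoin (transition c c' (vleft u)) (transition d d' (vright u))) (snd (prod_chart c d) p)"
      by (intro cdiff_at_vjoin cdiff_at_compose(1)[OF cdiff_at_vleft] cdiff_at_compose(1)[OF cdiff_at_vright])
         (simp_all add: xy(1) C D)
    then show ?thesis by (rule cdiff_at_cong(1)[OF topological_chartD(3)[OF P] i e, THEN iffD2])
  qed
  fix e e' assume e: "e \<in> atlas (prod_manifold M N)" "e' \<in> atlas (prod_manifold M N)"
  then obtain c d c' d' where *: "c \<in> atlas M" "d \<in> atlas N" "c' \<in> atlas M" "d' \<in> atlas N"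
    "e = prod_chart c d" "e' = prod_chart c' d'" unfolding atlas_prod_manifold by blast
  show "compatible e e'" unfolding compatible_iff[OF T[OF e(1)] T[OF e(2)]]
  proof
    fix p assume "p \<in> fst e \<inter> fst e'"
    then show "cdiff_at (transition e e') (snd e p) \<and> cdiff_at (transition e' e) (snd e' p)"
      using half[OF *(1-4), of p] half[OF *(3,4,1,2), of p] by (simp only: *(5,6) Int_commute simp_thms)
  qed
qed

section \<open>The multiplicative group\<close>

lemma Cstar_simps [simp]: "carrier Cstar = UNIV - {0}" "a \<otimes>\<^bsub>Cstar\<^esub> b = a * b" "\<one>\<^bsub>Cstar\<^esub> = 1"
  by (simp_all add: Cstar_def)

lemma group_Cstar: "group Cstar"
proof (rule groupI)
  fix x assume "x \<in> carrier Cstar"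
  then show "\<exists>y\<in>carrier Cstar. y \<otimes>\<^bsub>Cstar\<^esub> x = \<one>\<^bsub>Cstar\<^esub>"
    by (intro bexI[of _ "inverse x"]) auto
qed auto

lemma inv_Cstar: "a \<in> carrier Cstar \<Longrightarrow> inv\<^bsub>Cstar\<^esub> a = inverse a"
  by (rule group.inv_equality[OF group_Cstar]) auto

definition Cchart :: "(complex, 1) chart" where
  "Cchart = (UNIV - {0}, \<lambda>z. \<chi> i. z)"

lemma Cchart_simps [simp]: "fst Cchart = UNIV - {0}" "snd Cchart z $ i = z"
  by (simp_all add: Cchart_def)

lemma Cstar_manifold_simps [simp]:
  "mtop Cstar_manifold = top_of_set (UNIV - {0})" "atlas Cstar_manifold = {Cchart}"
  by (simp_all add: Cstar_manifold_def Cchart_def)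

lemma snd_Cchart: "snd Cchart = vec" by (simp add: Cchart_def vec_def fun_eq_iff)

lemma topological_chart_Cchart: "topological_chart (top_of_set (UNIV - {0})) Cchart"
  unfolding topological_chart_iff
proof (intro conjI allI impI)
  have o: "open (UNIV - {0::complex})" by auto
  show "openin (top_of_set (UNIV - {0})) (fst Cchart)" by simp
  show "inj_on (snd Cchart) (fst Cchart)" by (auto simp: inj_on_def vec_eq_iff)
  show "open (snd Cchart ` (V \<inter> fst Cchart))" if "openin (top_of_set (UNIV - {0})) V" for V
  proof -
    have "open V" "V \<subseteq> UNIV - {0}" using that openin_open_eq[OF o] by auto
    moreover have "snd Cchart ` V = (\<lambda>u :: complex ^ 1. u $ 1) -` V"
    proof (intro equalityI subsetI)
      fix u :: "complex ^ 1" assume "u \<in> (\<lambda>u. u $ 1) -` V"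
      moreover have "u = snd Cchart (u $ 1)" by (simp add: vec_eq_iff)
      ultimately show "u \<in> snd Cchart ` V" by blast
    qed auto
    ultimately show ?thesis
      by (simp add: Int_absorb2) (intro open_vimage continuous_intros)
  qed
  show "openin (top_of_set (UNIV - {0})) {p \<in> fst Cchart. snd Cchart p \<in> W}" if "open W" for W
  proof -
    have "open (snd Cchart -` W)" unfolding snd_Cchart vec_def
      by (intro open_vimage[OF that] continuous_on_vec_lambda continuous_intros)
    then have "openin (top_of_set (UNIV - {0})) ((UNIV - {0}) \<inter> snd Cchart -` W)" by (rule openin_open_Int)
    also have "(UNIV - {0}) \<inter> snd Cchart -` W = {p \<in> fst Cchart. snd Cchart p \<in> W}" by auto
    finally show ?thesis .
  qed
qed

lemma chart_inv_Cchart: "u \<in> snd Cchart ` fst Cchart \<Longrightarrow> chart_inv Cchart u = u $ 1"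
  using chart_inv_right(2)[of u Cchart] Cchart_simps(2) by metis

lemma holo_atlas_Cstar: "holo_atlas Cstar_manifold"
proof -
  have "cdiff_at (transition Cchart Cchart) (snd Cchart p)" if "p \<in> fst Cchart" for p
  proof -
    have e: "\<forall>u\<in>snd Cchart ` fst Cchart. transition Cchart Cchart u = u"
      unfolding transition_def using chart_inv_right(2)[of _ Cchart] by simp
    have "cdiff_at (\<lambda>u. u) (snd Cchart p)" by (rule cdiff_atI[OF has_derivative_ident]) simp
    then show ?thesis
      by (rule cdiff_at_cong(1)[OF topological_chartD(3)[OF topological_chart_Cchart] imageI[OF that] e, THEN iffD2])
  qed
  then have "compatible Cchart Cchart"
    unfolding compatible_iff[OF topological_chart_Cchart topological_chart_Cchart] by blast
  then show ?thesis unfolding holo_atlas_def using topological_chart_Cchart by simp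
qed

lemma complex_manifold_Cstar: "complex_manifold Cstar_manifold"
proof -
  have "Hausdorff_space (top_of_set (UNIV - {0::complex}))"
    by (simp add: Hausdorff_space_subtopology)
  moreover have "second_countable (euclidean :: complex topology)"
    unfolding second_countable_def
  proof -
    obtain B :: "complex set set" where B: "countable B" "topological_basis B" using ex_countable_basis by blast
    have "\<exists>V\<in>B. x \<in> V \<and> V \<subseteq> U" if "open U" "x \<in> U" for U x
      using topological_basisE[OF B(2) that] by metis
    then show "\<exists>B::complex set set. countable B \<and> (\<forall>V\<in>B. openin euclidean V) \<and>
        (\<forall>U x. openin euclidean U \<and> x \<in> U \<longrightarrow> (\<exists>V\<in>B. x \<in> V \<and> V \<subseteq> U))"
      using B(1) topological_basis_open[OF B(2)] by (intro exI[of _ B]) simp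
  qed
  ultimately show ?thesis unfolding complex_manifold_iff
    using holo_atlas_Cstar by (simp add: second_countable_subtopology)
qed

lemma Cchart_at: "a \<noteq> 0 \<Longrightarrow> Cchart \<in> charts_at Cstar_manifold a"
  using atlas_subset_charts[OF holo_atlas_Cstar] by (simp add: charts_at_def)

lemma complex_lie_group_Cstar: "complex_lie_group Cstar Cstar_manifold"
  unfolding complex_lie_group_def
proof (intro conjI group_Cstar complex_manifold_Cstar)
  show "points Cstar_manifold = carrier Cstar" by simp
  let ?P = "prod_manifold Cstar_manifold Cstar_manifold"
  have P: "holo_atlas ?P" by (rule holo_atlas_prod_manifold[OF holo_atlas_Cstar holo_atlas_Cstar])
  have tP: "topological_chart (prod_topology (top_of_set (UNIV - {0})) (top_of_set (UNIV - {0}))) (prod_chart Cchart Cchart)"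
    by (rule topological_chart_prod[OF topological_chart_Cchart topological_chart_Cchart])
  have aP: "prod_chart Cchart Cchart \<in> charts ?P"
    using atlas_subset_charts[OF P] unfolding atlas_prod_manifold Cstar_manifold_simps by blast
  show "holomorphic_map ?P Cstar_manifold (\<lambda>(a, b). a \<otimes>\<^bsub>Cstar\<^esub> b)"
  proof (rule holomorphic_mapI[OF P holo_atlas_Cstar])
    fix p assume "p \<in> points ?P"
    then have p: "p \<in> fst (prod_chart Cchart Cchart)" by auto
    have "holo_map_on (snd (prod_chart Cchart Cchart) ` fst (prod_chart Cchart Cchart))
        (snd Cchart \<circ> (\<lambda>(a, b). a \<otimes>\<^bsub>Cstar\<^esub> b) \<circ> chart_inv (prod_chart Cchart Cchart))"
      unfolding holo_map_on_iff
    proof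
      fix u assume u: "u \<in> snd (prod_chart Cchart Cchart) ` fst (prod_chart Cchart Cchart)"
      have e: "\<forall>u\<in>snd (prod_chart Cchart Cchart) ` fst (prod_chart Cchart Cchart).
          (snd Cchart \<circ> (\<lambda>(a, b). a \<otimes>\<^bsub>Cstar\<^esub> b) \<circ> chart_inv (prod_chart Cchart Cchart)) u
          = (\<chi> i. u $ Inl 1 * u $ Inr 1)"
        using chart_inv_left[OF tP] by (auto simp: vec_eq_iff)
      have "cdiff_at (\<lambda>u. \<chi> i. u $ Inl 1 * u $ Inr 1) u"
        unfolding cdiff_at_componentwise by (auto intro!: holo_fun_on_mult holo_fun_on_nth)
      then show "cdiff_at (snd Cchart \<circ> (\<lambda>(a, b). a \<otimes>\<^bsub>Cstar\<^esub> b) \<circ> chart_inv (prod_chart Cchart Cchart)) u"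
        by (rule cdiff_at_cong(1)[OF topological_chartD(3)[OF tP] u e, THEN iffD2])
    qed
    then show "\<exists>b\<in>charts_at ?P p. \<exists>c\<in>charts Cstar_manifold. (\<lambda>(a, b). a \<otimes>\<^bsub>Cstar\<^esub> b) ` fst b \<subseteq> fst c \<and>
        holo_map_on (snd b ` fst b) (snd c \<circ> (\<lambda>(a, b). a \<otimes>\<^bsub>Cstar\<^esub> b) \<circ> chart_inv b)"
      using p aP atlas_subset_charts[OF holo_atlas_Cstar]
      by (intro bexI[of _ "prod_chart Cchart Cchart"] bexI[of _ Cchart]) (auto simp: charts_at_def)
  qed
  show "holomorphic_map Cstar_manifold Cstar_manifold (\<lambda>a. inv\<^bsub>Cstar\<^esub> a)"
  proof (rule holomorphic_mapI[OF holo_atlas_Cstar holo_atlas_Cstar])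
    fix p assume "p \<in> points Cstar_manifold"
    then have p: "p \<noteq> 0" by simp
    have "holo_map_on (snd Cchart ` fst Cchart) (snd Cchart \<circ> (\<lambda>a. inv\<^bsub>Cstar\<^esub> a) \<circ> chart_inv Cchart)"
      unfolding holo_map_on_iff
    proof
      fix u assume u: "u \<in> snd Cchart ` fst Cchart"
      have e: "\<forall>u\<in>snd Cchart ` fst Cchart.
          (snd Cchart \<circ> (\<lambda>a. inv\<^bsub>Cstar\<^esub> a) \<circ> chart_inv Cchart) u = (\<chi> i. inverse (u $ 1))"
        by (auto simp: vec_eq_iff chart_inv_Cchart inv_Cstar)
      have "cdiff_at (\<lambda>u. \<chi> i. inverse (u $ 1)) u"
        unfolding cdiff_at_componentwise using u by (auto intro!: holo_fun_on_inverse holo_fun_on_nth)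
      then show "cdiff_at (snd Cchart \<circ> (\<lambda>a. inv\<^bsub>Cstar\<^esub> a) \<circ> chart_inv Cchart) u"
        by (rule cdiff_at_cong(1)[OF topological_chartD(3)[OF topological_chart_Cchart] u e, THEN iffD2])
    qed
    moreover have "(\<lambda>a. inv\<^bsub>Cstar\<^esub> a) ` fst Cchart \<subseteq> fst Cchart" by (auto simp: inv_Cstar)
    ultimately show "\<exists>b\<in>charts_at Cstar_manifold p. \<exists>c\<in>charts Cstar_manifold. (\<lambda>a. inv\<^bsub>Cstar\<^esub> a) ` fst b \<subseteq> fst c \<and>
        holo_map_on (snd b ` fst b) (snd c \<circ> (\<lambda>a. inv\<^bsub>Cstar\<^esub> a) \<circ> chart_inv b)"
      using Cchart_at[OF p] charts_atD(3)[OF Cchart_at[OF p]] by blast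
  qed
qed

section \<open>Top forms at a point\<close>

text \<open>
  The top form \<open>z dw\<^sub>1 \<and> \<dots> \<and> dw\<^sub>d\<close> at \<open>p\<close>.
\<close>

definition form_of ::
  "('a, 'd::finite) cmanifold \<Rightarrow> ('a, 'd) chart \<Rightarrow> 'a \<Rightarrow> complex \<Rightarrow> ('a, 'd, 'd) mform" where
  "form_of X c p z = (\<lambda>v. if \<forall>k. v k \<in> tangent_space X p then z * det (\<chi> k l. v l c $ k) else 0)"

lemma tvec_of_lincomb:
  assumes "holo_atlas X" "c \<in> charts_at X p"
  shows "tvec_of X c p (a *s x + b *s y) = (\<lambda>c'. a *s tvec_of X c p x c' + b *s tvec_of X c p y c')"
  using linear_jac[OF assms] by (auto simp: tvec_of_def fun_eq_iff)

lemma alternating_formsD: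
  assumes "\<eta> \<in> alternating_forms M p"
  shows "\<not> (\<forall>i. v i \<in> tangent_space M p) \<Longrightarrow> \<eta> v = 0"
    and "\<forall>j. v j \<in> tangent_space M p \<Longrightarrow> x \<in> tangent_space M p \<Longrightarrow> y \<in> tangent_space M p \<Longrightarrow>
      \<eta> (v(i := (\<lambda>c. a *s x c + b *s y c))) = a * \<eta> (v(i := x)) + b * \<eta> (v(i := y))"
    and "\<forall>l. v l \<in> tangent_space M p \<Longrightarrow> i \<noteq> j \<Longrightarrow> v i = v j \<Longrightarrow> \<eta> v = 0"
proof -
  note D = assms[unfolded alternating_forms_def mem_Collect_eq]
  show "\<not> (\<forall>i. v i \<in> tangent_space M p) \<Longrightarrow> \<eta> v = 0"
    using D[THEN conjunct1, THEN spec, of v] by simp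
  show "\<forall>j. v j \<in> tangent_space M p \<Longrightarrow> x \<in> tangent_space M p \<Longrightarrow> y \<in> tangent_space M p \<Longrightarrow>
      \<eta> (v(i := (\<lambda>c. a *s x c + b *s y c))) = a * \<eta> (v(i := x)) + b * \<eta> (v(i := y))"
    by (rule D[THEN conjunct2, THEN conjunct1, rule_format]) auto
  show "\<forall>l. v l \<in> tangent_space M p \<Longrightarrow> i \<noteq> j \<Longrightarrow> v i = v j \<Longrightarrow> \<eta> v = 0"
    using D[THEN conjunct2, THEN conjunct2, THEN spec, THEN spec, THEN spec, of v i j] by simp
qed

text \<open>
  In components with respect to \<open>c\<close>, a top form is an alternating multilinear function
  of as many vectors as there are coordinates.
\<close>

lemma top_form_eq_det:
  fixes \<eta> :: "('a, 'd::finite, 'd) mform"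
  assumes X: "holo_atlas X" and \<eta>: "\<eta> \<in> alternating_forms X p" and c: "c \<in> charts_at X p"
    and v: "\<forall>k. v k \<in> tangent_space X p"
  shows "\<eta> v = det (\<chi> k l. v l c $ k) * \<eta> (\<lambda>i. coord_vec X c p i)"
proof -
  define F where "F u = \<eta> (\<lambda>l. tvec_of X c p (u l))" for u
  note t = tvec_of_tangent[OF X c]
  have upd: "(\<lambda>l. tvec_of X c p ((u(i := x)) l)) = (\<lambda>l. tvec_of X c p (u l))(i := tvec_of X c p x)"
    for u :: "'d \<Rightarrow> complex ^ 'd" and i x by auto
  have lin: "\<eta> (v(i := (\<lambda>c. a *s x c + b *s y c))) = a * \<eta> (v(i := x)) + b * \<eta> (v(i := y))"
    if "\<forall>j. v j \<in> tangent_space X p" "x \<in> tangent_space X p" "y \<in> tangent_space X p" for v i x y a b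
    using that by (rule alternating_formsD(2)[OF \<eta>])
  have alt: "\<eta> v = 0" if "\<forall>j. v j \<in> tangent_space X p" "i \<noteq> j" "v i = v j" for v i j
    using that by (rule alternating_formsD(3)[OF \<eta>])
  have "alt_multilinear F"
    unfolding alt_multilinear_def
  proof (intro conjI allI impI)
    fix u :: "'d \<Rightarrow> complex ^ 'd" and i x y a b
    show "F (u(i := a *s x + b *s y)) = a * F (u(i := x)) + b * F (u(i := y))"
      unfolding F_def upd tvec_of_lincomb[OF X c] by (rule lin) (auto intro: t)
  next
    fix u :: "'d \<Rightarrow> complex ^ 'd" and i j assume "i \<noteq> j" "u i = u j"
    then show "F u = 0" unfolding F_def by (intro alt[of _ i j]) (auto intro: t)
  qed
  then have "F (\<lambda>l. v l c) = det (\<chi> k l. v l c $ k) * F (\<lambda>i. axis i 1)"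
    by (rule alt_multilinear_eq_det)
  moreover have "(\<lambda>l. tvec_of X c p (v l c)) = v"
    using tvec_of_component[OF X v[rule_format] c] by (intro ext) (simp only: )
  ultimately show ?thesis unfolding F_def coord_vec_eq by simp
qed

lemma form_of_alternating:
  assumes X: "holo_atlas X" and c: "c \<in> charts_at X p"
  shows "form_of X c p z \<in> alternating_forms X p"
  unfolding alternating_forms_def
proof (intro CollectI conjI allI impI)
  fix v :: "'b \<Rightarrow> ('a, 'b) tvec" and i x y a b
  assume v: "\<forall>j. v j \<in> tangent_space X p" and xy: "x \<in> tangent_space X p" "y \<in> tangent_space X p"
  have upd: "(\<chi> k l. (v(i := w)) l c $ k) = (\<chi> k l. ((\<lambda>l. v l c)(i := w c)) l $ k)" for w
    by (simp add: vec_eq_iff)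
  have "\<forall>k. (v(i := w)) k \<in> tangent_space X p" if "w \<in> tangent_space X p" for w
    using v that by simp
  then show "form_of X c p z (v(i := (\<lambda>c. a *s x c + b *s y c)))
      = a * form_of X c p z (v(i := x)) + b * form_of X c p z (v(i := y))"
    using xy tangent_space_lincomb[OF X xy] unfolding form_of_def upd
    by (simp only: if_True alt_multilinear_lin[OF alt_multilinear_det] simp_thms) (simp only: algebra_simps)
next
  fix v :: "'b \<Rightarrow> ('a, 'b) tvec" and i j
  assume "\<forall>l. v l \<in> tangent_space X p" "i \<noteq> j" "v i = v j"
  then show "form_of X c p z v = 0"
    using alt_multilinear_alt[OF alt_multilinear_det, of i j "\<lambda>l. v l c"] by (simp add: form_of_def)
next
  fix v :: "'b \<Rightarrow> ('a, 'b) tvec"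
  assume "\<exists>i. v i \<notin> tangent_space X p"
  then show "form_of X c p z v = 0" by (auto simp: form_of_def)
qed

lemma coord_vec_tangent:
  "holo_atlas X \<Longrightarrow> c \<in> charts_at X p \<Longrightarrow> coord_vec X c p i \<in> tangent_space X p"
  unfolding coord_vec_eq by (rule tvec_of_tangent)

lemma coord_vec_self: "c \<in> charts_at X p \<Longrightarrow> coord_vec X c p i c = axis i 1"
  unfolding coord_vec_eq by (rule tvec_of_self)

lemma form_of_coord_vec:
  assumes X: "holo_atlas X" and c: "c \<in> charts_at X p"
  shows "form_of X c p z (\<lambda>i. coord_vec X c p i) = z"
  using coord_vec_tangent[OF assms] by (simp add: form_of_def coord_vec_self[OF c] det_axis)

lemma form_of_eq:
  fixes \<eta> :: "('a, 'd::finite, 'd) mform"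
  assumes X: "holo_atlas X" and \<eta>: "\<eta> \<in> alternating_forms X p" and c: "c \<in> charts_at X p"
  shows "\<eta> = form_of X c p (\<eta> (\<lambda>i. coord_vec X c p i))"
proof
  fix v show "\<eta> v = form_of X c p (\<eta> (\<lambda>i. coord_vec X c p i)) v"
  proof (cases "\<forall>k. v k \<in> tangent_space X p")
    case True
    then have "form_of X c p (\<eta> (\<lambda>i. coord_vec X c p i)) v
        = det (\<chi> k l. v l c $ k) * \<eta> (\<lambda>i. coord_vec X c p i)"
      by (simp add: form_of_def mult.commute)
    then show ?thesis by (simp only: top_form_eq_det[OF assms True, symmetric])
  next
    case False
    then have "\<eta> v = 0" by (rule alternating_formsD(1)[OF \<eta>])
    then show ?thesis using False by (simp only: form_of_def if_False)
  qed
qed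

section \<open>Induced charts of the canonical bundle\<close>

text \<open>
  The coordinates \<open>(z, w)\<close> of the bundle as one vector, and the projection to
  \<open>w\<close>.
\<close>

definition kjoin :: "complex \<Rightarrow> complex ^ 'd::finite \<Rightarrow> complex ^ 'd option" where
  "kjoin z w = (\<chi> k. case k of None \<Rightarrow> z | Some i \<Rightarrow> w $ i)"

definition kbase :: "complex ^ 'd::finite option \<Rightarrow> complex ^ 'd" where
  "kbase u = (\<chi> i. u $ Some i)"

lemma kjoin_simps [simp]:
  "kjoin z w $ None = z" "kjoin z w $ Some i = w $ i" "kbase u $ i = u $ Some i"
  "kbase (kjoin z w) = w" "kjoin (u $ None) (kbase u) = u"
  by (auto simp: kjoin_def kbase_def vec_eq_iff split: option.split)

lemma kjoin_eq_iff: "kjoin z w = kjoin z' w' \<longleftrightarrow> z = z' \<and> w = w'"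
  by (metis kjoin_simps(1,4))

lemma cdiff_at_kbase: "cdiff_at kbase u"
  unfolding cdiff_at_componentwise by (simp add: holo_fun_on_nth)

lemma holo_map_on_kbase: "holo_map_on S kbase"
  unfolding holo_map_on_iff by (simp add: cdiff_at_kbase)

lemma continuous_on_kbase: "continuous_on S kbase"
  by (rule holo_map_on_continuous[OF holo_map_on_kbase])

lemma open_kbase: "open A \<Longrightarrow> open {u. kbase u \<in> A}"
  using open_vimage[OF _ continuous_on_kbase, of A] by (simp add: vimage_def)

lemma fst_induced_chart: "fst (induced_chart X c) = {m \<in> KX_points X. fst m \<in> fst c}"
  by (simp add: induced_chart_def)

lemma snd_induced_chart: "snd (induced_chart X c) m = kjoin (fibre_coord X c m) (snd c (fst m))"
  by (simp add: induced_chart_def kjoin_def)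

lemma KX_pointsD:
  "m \<in> KX_points X \<Longrightarrow> fst m \<in> points X" "m \<in> KX_points X \<Longrightarrow> snd m \<in> alternating_forms X (fst m)"
  unfolding KX_points_def by auto

text \<open>
  The point of the bundle with given induced coordinates, that is, the inverse of the induced chart.
\<close>

definition kpoint_of :: "('a, 'd::finite) cmanifold \<Rightarrow> ('a, 'd) chart \<Rightarrow> complex ^ 'd option \<Rightarrow> ('a, 'd) kpoint" where
  "kpoint_of X c u = (chart_inv c (kbase u), form_of X c (chart_inv c (kbase u)) (u $ None))"

lemma kpoint_of:
  assumes X: "holo_atlas X" and c: "c \<in> charts X" and u: "kbase u \<in> snd c ` fst c"
  shows "kpoint_of X c u \<in> fst (induced_chart X c)" "snd (induced_chart X c) (kpoint_of X c u) = u"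
proof -
  let ?p = "chart_inv c (kbase u)"
  have p: "?p \<in> fst c" "snd c ?p = kbase u" using chart_inv_right[OF u] by auto
  have cp: "c \<in> charts_at X ?p" using c p by (simp add: charts_at_def)
  show "kpoint_of X c u \<in> fst (induced_chart X c)"
    using p charts_atD(4)[OF cp] form_of_alternating[OF X cp]
    by (simp add: fst_induced_chart kpoint_of_def KX_points_def)
  show "snd (induced_chart X c) (kpoint_of X c u) = u"
    using p form_of_coord_vec[OF X cp] by (simp add: snd_induced_chart kpoint_of_def fibre_coord_def)
qed

lemma kpoint_of_left:
  assumes X: "holo_atlas X" and c: "c \<in> charts X" and m: "m \<in> fst (induced_chart X c)"
  shows "kpoint_of X c (snd (induced_chart X c) m) = m"
proof -
  have m': "m \<in> KX_points X" "fst m \<in> fst c" using m by (auto simp: fst_induced_chart)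
  have cp: "c \<in> charts_at X (fst m)" using c m' by (simp add: charts_at_def)
  have i: "chart_inv c (snd c (fst m)) = fst m" by (rule chart_inv_left[OF chartsD[OF c] m'(2)])
  show ?thesis
    unfolding kpoint_of_def snd_induced_chart kjoin_simps i fibre_coord_def
      form_of_eq[OF X KX_pointsD(2)[OF m'(1)] cp, symmetric] by simp
qed

lemma inj_on_induced_chart:
  assumes X: "holo_atlas X" and c: "c \<in> charts X"
  shows "inj_on (snd (induced_chart X c)) (fst (induced_chart X c))"
  by (rule inj_on_inverseI[of _ "kpoint_of X c"]) (rule kpoint_of_left[OF X c])

lemma chart_inv_induced:
  assumes X: "holo_atlas X" and c: "c \<in> charts X" and u: "kbase u \<in> snd c ` fst c"
  shows "chart_inv (induced_chart X c) u = kpoint_of X c u"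
  using inv_into_f_f[OF inj_on_induced_chart[OF X c] kpoint_of(1)[OF assms]]
  unfolding chart_inv_def kpoint_of(2)[OF assms] .

lemma image_induced_chart_overlap:
  assumes X: "holo_atlas X" and c: "c \<in> charts X"
  shows "snd (induced_chart X c) ` (fst (induced_chart X c) \<inter> fst (induced_chart X c'))
       = {u. kbase u \<in> snd c ` (fst c \<inter> fst c')}"
proof (intro equalityI subsetI)
  fix u assume "u \<in> snd (induced_chart X c) ` (fst (induced_chart X c) \<inter> fst (induced_chart X c'))"
  then show "u \<in> {u. kbase u \<in> snd c ` (fst c \<inter> fst c')}"
    by (auto simp: fst_induced_chart snd_induced_chart)
next
  fix u assume "u \<in> {u. kbase u \<in> snd c ` (fst c \<inter> fst c')}"
  then obtain p where p: "p \<in> fst c" "p \<in> fst c'" "kbase u = snd c p" by auto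
  then have u: "kbase u \<in> snd c ` fst c" by simp
  have "fst (kpoint_of X c u) = p"
    using chart_inv_left[OF chartsD[OF c] p(1)] by (simp add: kpoint_of_def p(3))
  then have "kpoint_of X c u \<in> fst (induced_chart X c) \<inter> fst (induced_chart X c')"
    using kpoint_of(1)[OF X c u] p by (auto simp: fst_induced_chart)
  then show "u \<in> snd (induced_chart X c) ` (fst (induced_chart X c) \<inter> fst (induced_chart X c'))"
    using kpoint_of(2)[OF X c u] by (metis image_eqI)
qed

definition jdet :: "('a, 'd::finite) chart \<Rightarrow> ('a, 'd) chart \<Rightarrow> 'a \<Rightarrow> complex" where
  "jdet c c' p = det (\<chi> k l. jac c c' p (axis l 1) $ k)"

text \<open>
  The frame \<open>\<partial>/\<partial>w'\<close> has the Jacobian matrix of the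
  change from \<open>w'\<close> to \<open>w\<close> as components in \<open>w\<close>,
  and a top form evaluates on it with the determinant of that matrix.
\<close>

lemma fibre_coord_change:
  assumes X: "holo_atlas X" and m: "m \<in> KX_points X"
    and c: "c \<in> charts_at X (fst m)" "c' \<in> charts_at X (fst m)"
  shows "fibre_coord X c' m = jdet c' c (fst m) * fibre_coord X c m"
proof -
  have "snd m (\<lambda>i. coord_vec X c' (fst m) i)
      = det (\<chi> k l. coord_vec X c' (fst m) l c $ k) * snd m (\<lambda>i. coord_vec X c (fst m) i)"
    by (rule top_form_eq_det[OF X KX_pointsD(2)[OF m] c(1)]) (simp add: coord_vec_tangent[OF X c(2)])
  moreover have "coord_vec X c' (fst m) l c = jac c' c (fst m) (axis l 1)" for l
    using c by (simp add: coord_vec_def)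
  ultimately show ?thesis by (simp add: fibre_coord_def jdet_def)
qed

lemma transition_induced:
  assumes X: "holo_atlas X" and c: "c \<in> charts X" "c' \<in> charts X"
    and u: "kbase u \<in> snd c ` (fst c \<inter> fst c')"
  shows "transition (induced_chart X c) (induced_chart X c') u
    = kjoin (jdet c' c (chart_inv c (kbase u)) * u $ None) (transition c c' (kbase u))"
proof -
  have u': "kbase u \<in> snd c ` fst c" using u by blast
  let ?m = "kpoint_of X c u"
  have m: "?m \<in> KX_points X" using kpoint_of(1)[OF X c(1) u'] by (simp add: fst_induced_chart)
  obtain p where p: "p \<in> fst c" "p \<in> fst c'" "kbase u = snd c p" using u by auto
  have fp: "chart_inv c (kbase u) = p" using chart_inv_left[OF chartsD[OF c(1)] p(1)] p(3) by simp
  then have fm: "fst ?m = p" by (simp add: kpoint_of_def)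
  have cp: "c \<in> charts_at X (fst ?m)" "c' \<in> charts_at X (fst ?m)" using c p by (auto simp: charts_at_def fm)
  have "fibre_coord X c ?m = u $ None"
    using kpoint_of(2)[OF X c(1) u'] unfolding snd_induced_chart by (metis kjoin_simps(1))
  then show ?thesis
    using fibre_coord_change[OF X m cp]
    by (simp add: transition_def chart_inv_induced[OF X c(1) u'] snd_induced_chart fm fp)
qed

text \<open>
  The determinant is polynomial in the first derivatives of a transition map, and these are
  holomorphic.
\<close>

lemma holo_fun_on_jdet:
  assumes X: "holo_atlas X" and c: "c \<in> charts X" "c' \<in> charts X"
  shows "holo_fun_on (snd c ` (fst c \<inter> fst c')) (\<lambda>w. jdet c' c (chart_inv c w))"
proof -
  let ?S = "snd c ` (fst c \<inter> fst c')" and ?S' = "snd c' ` (fst c' \<inter> fst c)"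
  have S': "open ?S'" by (metis Int_commute topological_chartD(1,4) chartsD c)
  have hS': "holo_map_on ?S' (transition c' c)"
    using compatible_charts[OF X c(2,1)] unfolding compatible_def by blast
  have hS: "holo_map_on ?S (transition c c')"
    using compatible_charts[OF X c] unfolding compatible_def by blast
  have im: "transition c c' ` ?S \<subseteq> ?S'"
    using chart_inv_left[OF chartsD[OF c(1)]] by (auto simp: transition_def)
  have "holo_fun_on ?S (\<lambda>w. frechet_derivative (transition c' c) (at (transition c c' w)) (axis l 1) $ k)" for l k
    by (rule holo_fun_on_compose[OF hS holo_fun_on_frechet_component[OF S' hS'] im])
  then have "holo_fun_on ?S (\<lambda>w. det (\<chi> k l. frechet_derivative (transition c' c) (at (transition c c' w)) (axis l 1) $ k))"
    by (intro holo_fun_on_det) simp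
  then show ?thesis by (simp add: jdet_def transition_def)
qed

lemma open_chart_overlap:
  assumes "c \<in> charts X" "c' \<in> charts X"
  shows "open (snd c ` (fst c \<inter> fst c'))"
  using topological_chartD(4)[OF chartsD[OF assms(1)] topological_chartD(1)[OF chartsD[OF assms(2)]]]
  by (simp only: Int_commute)

lemma holo_map_on_transition_induced:
  assumes X: "holo_atlas X" and c: "c \<in> charts X" "c' \<in> charts X"
  shows "holo_map_on {u. kbase u \<in> snd c ` (fst c \<inter> fst c')} (transition (induced_chart X c) (induced_chart X c'))"
    (is "holo_map_on ?S _")
proof -
  have S: "open ?S" by (rule open_kbase[OF open_chart_overlap[OF c]])
  have t: "holo_map_on (snd c ` (fst c \<inter> fst c')) (transition c c')"
    using compatible_charts[OF X c] unfolding compatible_def by blast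
  have im: "kbase ` ?S \<subseteq> snd c ` (fst c \<inter> fst c')" by auto
  have "holo_fun_on ?S (\<lambda>u. kjoin (jdet c' c (chart_inv c (kbase u)) * u $ None) (transition c c' (kbase u)) $ k)" for k
  proof (cases k)
    case None
    then show ?thesis
      using holo_fun_on_mult[OF holo_fun_on_compose[OF holo_map_on_kbase holo_fun_on_jdet[OF X c] im] holo_fun_on_nth]
      by simp
  next
    case (Some i)
    have "holo_fun_on (snd c ` (fst c \<inter> fst c')) (\<lambda>w. transition c c' w $ i)"
      using t unfolding holo_map_on_def by blast
    from holo_fun_on_compose[OF holo_map_on_kbase this im] show ?thesis using Some by simp
  qed
  then have "holo_map_on ?S (\<lambda>u. kjoin (jdet c' c (chart_inv c (kbase u)) * u $ None) (transition c c' (kbase u)))"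
    unfolding holo_map_on_def by blast
  then show ?thesis by (rule holo_map_on_cong[OF S, THEN iffD2, rotated]) (simp add: transition_induced[OF X c])
qed

text \<open>
  Blocks of the Jacobian matrix of \<open>(z, w) \<mapsto> (\<delta>(w) z, \<tau>(w))\<close>.
  Since \<open>\<tau>\<close> is independent of \<open>z\<close>, its rows vanish in the column of
  \<open>z\<close>, and the remaining entry of that column is \<open>\<delta>(w)\<close>.
\<close>

lemma jac_induced:
  assumes X: "holo_atlas X" and m: "m \<in> KX_points X"
    and c: "c \<in> charts_at X (fst m)" "c' \<in> charts_at X (fst m)"
  shows "jac (induced_chart X c) (induced_chart X c') m h $ Some i = jac c c' (fst m) (kbase h) $ i"
    and "jac (induced_chart X c) (induced_chart X c') m (axis None 1) $ None = jdet c' c (fst m)"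
proof -
  note tc = charts_atD[OF c(1)] and tc' = charts_atD[OF c(2)]
  let ?S = "{u. kbase u \<in> snd c ` (fst c \<inter> fst c')}" and ?u = "snd (induced_chart X c) m"
    and ?T = "transition (induced_chart X c) (induced_chart X c')"
  have S: "open ?S" by (rule open_kbase[OF open_chart_overlap[OF tc(3) tc'(3)]])
  have u: "?u \<in> ?S" using tc(2) tc'(2) by (simp add: snd_induced_chart)
  have ku: "kbase ?u = snd c (fst m)" by (simp add: snd_induced_chart)
  have T: "cdiff_at ?T ?u"
    using holo_map_on_transition_induced[OF X tc(3) tc'(3)] u unfolding holo_map_on_iff by blast
  have kd: "(kbase has_derivative kbase) (at ?u)"
    unfolding has_derivative_vec_iff
    by (auto intro!: bounded_linear_imp_has_derivative bounded_linear_vec_nth)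
  have tr: "(transition c c' has_derivative jac c c' (fst m)) (at (kbase ?u))"
    unfolding ku by (rule cdiff_at_frechet(1)[OF cdiff_at_transition[OF X c]])
  have "((\<lambda>u. transition c c' (kbase u)) has_derivative (\<lambda>h. jac c c' (fst m) (kbase h))) (at ?u)"
    by (rule has_derivative_compose[OF kd tr])
  then have "((\<lambda>u. transition c c' (kbase u) $ i) has_derivative (\<lambda>h. jac c c' (fst m) (kbase h) $ i)) (at ?u)"
    unfolding has_derivative_vec_iff by blast
  then have "((\<lambda>u. ?T u $ Some i) has_derivative (\<lambda>h. jac c c' (fst m) (kbase h) $ i)) (at ?u)"
    by (rule has_derivative_transform_within_open[OF _ S u]) (simp add: transition_induced[OF X tc(3) tc'(3)])
  from fun_cong[OF frechet_derivative_at[OF this], of h]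
  show "jac (induced_chart X c) (induced_chart X c') m h $ Some i = jac c c' (fst m) (kbase h) $ i"
    using frechet_derivative_component[OF T, of h "Some i"] by simp
  \<comment> \<open>The factor by which the fibre coordinate changes, as a function of the base coordinates.\<close>
  define \<delta> where "\<delta> w = jdet c' c (chart_inv c w)" for w
  obtain D where D: "(\<delta> has_derivative D) (at (kbase ?u))"
    using holo_fun_on_jdet[OF X tc(3) tc'(3)] u unfolding holo_fun_on_def \<delta>_def by blast
  have "((\<lambda>u. \<delta> (kbase u) * u $ None) has_derivative (\<lambda>h. \<delta> (kbase ?u) * h $ None + D (kbase h) * ?u $ None)) (at ?u)"
    by (rule has_derivative_mult[OF has_derivative_compose[OF kd D]
          bounded_linear_imp_has_derivative[OF bounded_linear_vec_nth]])
  then have "((\<lambda>u. ?T u $ None) has_derivative (\<lambda>h. \<delta> (kbase ?u) * h $ None + D (kbase h) * ?u $ None)) (at ?u)"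
    by (rule has_derivative_transform_within_open[OF _ S u])
       (simp add: transition_induced[OF X tc(3) tc'(3)] \<delta>_def)
  note fun_cong[OF frechet_derivative_at[OF this], of "axis None 1", symmetric]
  moreover have "kbase (axis None 1) = (0 :: complex ^ 'b)" by (simp add: vec_eq_iff axis_def)
  moreover have "D 0 = 0" using linear_0[OF has_derivative_linear[OF D]] .
  moreover have "\<delta> (kbase ?u) = jdet c' c (fst m)"
    using chart_inv_left[OF tc(1,2)] by (simp add: \<delta>_def ku)
  ultimately show "jac (induced_chart X c) (induced_chart X c') m (axis None 1) $ None = jdet c' c (fst m)"
    using frechet_derivative_component[OF T, of "axis None 1" None] by (simp add: axis_def)
qed

text \<open>
  Applying the Jacobian to all vectors first is again alternating multilinear, so this is the
  multiplicativity of the determinant.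
\<close>

lemma det_components_change:
  fixes v :: "'n::finite \<Rightarrow> ('a, 'n) tvec"
  assumes M: "holo_atlas M" and c: "c \<in> charts_at M p" "c' \<in> charts_at M p"
    and v: "\<And>l. v l \<in> tangent_space M p"
  shows "det (\<chi> k l. v l c' $ k) = jdet c c' p * det (\<chi> k l. v l c $ k)"
proof -
  define F where "F u = det (\<chi> k l. jac c c' p (u l) $ k)" for u :: "'n \<Rightarrow> complex ^ 'n"
  have upd: "(\<lambda>l. jac c c' p ((u(i := x)) l)) = (\<lambda>l. jac c c' p (u l))(i := jac c c' p x)"
    for u :: "'n \<Rightarrow> complex ^ 'n" and i x by auto
  have e: "F (u(i := x)) = det (\<chi> k l. ((\<lambda>l. jac c c' p (u l))(i := jac c c' p x)) l $ k)"
    for u :: "'n \<Rightarrow> complex ^ 'n" and i x unfolding F_def upd[symmetric] ..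
  have F: "F u = (\<lambda>w. det (\<chi> k l. w l $ k)) (\<lambda>l. jac c c' p (u l))" for u unfolding F_def ..
  have "alt_multilinear F"
    unfolding alt_multilinear_def
  proof (intro conjI allI impI)
    fix u :: "'n \<Rightarrow> complex ^ 'n" and i x y a b
    show "F (u(i := a *s x + b *s y)) = a * F (u(i := x)) + b * F (u(i := y))"
      unfolding e linear_jac[OF M c] by (rule alt_multilinear_lin[OF alt_multilinear_det])
  next
    fix u :: "'n \<Rightarrow> complex ^ 'n" and i j assume "i \<noteq> j" "u i = u j"
    then show "F u = 0" unfolding F by (intro alt_multilinear_alt[OF alt_multilinear_det, of i j]) auto
  qed
  then have "F (\<lambda>l. v l c) = det (\<chi> k l. v l c $ k) * F (\<lambda>i. axis i 1)"
    by (rule alt_multilinear_eq_det)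
  moreover have "F (\<lambda>l. v l c) = det (\<chi> k l. v l c' $ k)"
    unfolding F_def tangent_space_jac[OF v c, symmetric] ..
  ultimately show ?thesis by (simp add: F_def jdet_def mult.commute)
qed

lemma jdet_inverse:
  assumes M: "holo_atlas M" and c: "c \<in> charts_at M p" "c' \<in> charts_at M p"
  shows "jdet c' c p * jdet c c' p = 1"
proof -
  have "det (\<chi> k l. coord_vec M c p l c $ k) = jdet c' c p * det (\<chi> k l. coord_vec M c p l c' $ k)"
    by (rule det_components_change[OF M c(2,1) coord_vec_tangent[OF M c(1)]])
  moreover have "det (\<chi> k l. coord_vec M c p l c' $ k) = jdet c c' p"
    using c(2) by (simp add: coord_vec_def jdet_def)
  ultimately show ?thesis by (simp add: coord_vec_self[OF c(1)] det_axis)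
qed

text \<open>
  The reason why the canonical form is well defined: the fibre coordinate changes by the inverse of
  the Jacobian determinant of the base.
\<close>

lemma jdet_induced:
  assumes X: "holo_atlas X" and m: "m \<in> KX_points X"
    and c: "c \<in> charts_at X (fst m)" "c' \<in> charts_at X (fst m)"
  shows "jdet (induced_chart X c) (induced_chart X c') m = 1"
proof -
  define A where "A = (\<chi> k l. jac (induced_chart X c) (induced_chart X c') m (axis l 1) $ k)"
  have "jac c c' (fst m) (kbase (axis None 1)) = 0"
  proof -
    have "kbase (axis None 1) = (0 :: complex ^ 'b)" by (simp add: vec_eq_iff axis_def)
    then show ?thesis using linear_0[OF cdiff_at_frechet(3)[OF cdiff_at_transition[OF X c]]] by simp
  qed
  then have z: "A $ Some k $ None = 0" for k
    by (simp add: A_def jac_induced(1)[OF X m c])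
  have n: "A $ None $ None = jdet c' c (fst m)"
    by (simp add: A_def jac_induced(2)[OF X m c])
  have "kbase (axis (Some j) 1) = axis j (1 :: complex)" for j :: 'b
    by (simp add: vec_eq_iff axis_def)
  then have "A $ Some i $ Some j = jac c c' (fst m) (axis j 1) $ i" for i j
    by (simp add: A_def jac_induced(1)[OF X m c])
  then have "det (\<chi> i j. A $ Some i $ Some j) = jdet c c' (fst m)"
    by (simp add: jdet_def)
  then have "det A = 1" unfolding det_option_block[OF z] n using jdet_inverse[OF X c] by simp
  then show ?thesis by (simp add: jdet_def A_def)
qed

section \<open>The total space of the canonical bundle as a complex manifold\<close>

text \<open>Intersections of open sets are open because the induced charts are injective.\<close>

lemma openin_KX:
  assumes X: "holo_atlas X"
  shows "openin (mtop (KX X)) S \<longleftrightarrow> S \<subseteq> KX_points X \<and>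
    (\<forall>c\<in>charts X. open (snd (induced_chart X c) ` (S \<inter> fst (induced_chart X c))))"
proof -
  let ?P = "\<lambda>S. S \<subseteq> KX_points X \<and>
    (\<forall>c\<in>charts X. open (snd (induced_chart X c) ` (S \<inter> fst (induced_chart X c))))"
  have "istopology ?P"
    unfolding istopology_def
  proof (intro conjI allI impI ballI)
    fix S T assume S: "?P S" and T: "?P T"
    show "S \<inter> T \<subseteq> KX_points X" using S by blast
    fix c assume c: "c \<in> charts X"
    have "snd (induced_chart X c) ` (S \<inter> T \<inter> fst (induced_chart X c))
      = snd (induced_chart X c) ` ((S \<inter> fst (induced_chart X c)) \<inter> (T \<inter> fst (induced_chart X c)))"
      by (rule arg_cong[of _ _ "image _"]) blast
    also have "\<dots> = snd (induced_chart X c) ` (S \<inter> fst (induced_chart X c)) \<inter>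
        snd (induced_chart X c) ` (T \<inter> fst (induced_chart X c))"
      by (rule inj_on_image_Int[OF inj_on_induced_chart[OF X c]]) auto
    finally show "open (snd (induced_chart X c) ` (S \<inter> T \<inter> fst (induced_chart X c)))"
      using S T c by (simp add: open_Int)
  next
    fix K assume K: "\<forall>S\<in>K. ?P S"
    then show "\<Union> K \<subseteq> KX_points X" by blast
    fix c assume c: "c \<in> charts X"
    have "snd (induced_chart X c) ` (\<Union> K \<inter> fst (induced_chart X c))
      = (\<Union>S\<in>K. snd (induced_chart X c) ` (S \<inter> fst (induced_chart X c)))" by blast
    then show "open (snd (induced_chart X c) ` (\<Union> K \<inter> fst (induced_chart X c)))"
      using K c by (simp add: open_UN)
  qed
  then show ?thesis by (simp add: KX_def)
qed

text \<open>
  Overlaps of induced charts are cylinders over overlaps of charts of the base, hence open, and the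
  transition maps between them are continuous.
\<close>

lemma topological_chart_induced:
  assumes X: "holo_atlas X" and c: "c \<in> charts X"
  shows "topological_chart (mtop (KX X)) (induced_chart X c)"
  unfolding topological_chart_iff
proof (intro conjI allI impI)
  show "inj_on (snd (induced_chart X c)) (fst (induced_chart X c))" by (rule inj_on_induced_chart[OF X c])
  show "openin (mtop (KX X)) (fst (induced_chart X c))"
    unfolding openin_KX[OF X]
  proof (intro conjI ballI)
    show "fst (induced_chart X c) \<subseteq> KX_points X" by (auto simp: fst_induced_chart)
    fix c' assume c': "c' \<in> charts X"
    show "open (snd (induced_chart X c') ` (fst (induced_chart X c) \<inter> fst (induced_chart X c')))"
      using image_induced_chart_overlap[OF X c', of c] open_kbase[OF open_chart_overlap[OF c' c]]
      by (simp only: Int_commute)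
  qed
  show "open (snd (induced_chart X c) ` (V \<inter> fst (induced_chart X c)))" if "openin (mtop (KX X)) V" for V
    using that c unfolding openin_KX[OF X] by blast
  show "openin (mtop (KX X)) {m \<in> fst (induced_chart X c). snd (induced_chart X c) m \<in> W}" if W: "open W" for W
    unfolding openin_KX[OF X]
  proof (intro conjI ballI)
    show "{m \<in> fst (induced_chart X c). snd (induced_chart X c) m \<in> W} \<subseteq> KX_points X"
      by (auto simp: fst_induced_chart)
    fix c' assume c': "c' \<in> charts X"
    let ?O = "{u. kbase u \<in> snd c' ` (fst c' \<inter> fst c)}"
    let ?S = "{m \<in> fst (induced_chart X c). snd (induced_chart X c) m \<in> W}"
    have inv: "chart_inv (induced_chart X c') (snd (induced_chart X c') m) = m"
      if "m \<in> fst (induced_chart X c')" for m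
      using inv_into_f_f[OF inj_on_induced_chart[OF X c'] that] by (simp add: chart_inv_def)
    have "snd (induced_chart X c') ` (?S \<inter> fst (induced_chart X c'))
        = ?O \<inter> transition (induced_chart X c') (induced_chart X c) -` W"
      unfolding image_induced_chart_overlap[OF X c', of c, symmetric]
      by (auto simp: transition_def inv)
    also have "open \<dots>"
      by (rule continuous_open_preimage[OF holo_map_on_continuous[OF holo_map_on_transition_induced[OF X c' c]]
            open_kbase[OF open_chart_overlap[OF c' c]] W])
    finally show "open (snd (induced_chart X c') ` (?S \<inter> fst (induced_chart X c')))" .
  qed
qed

lemma points_KX:
  assumes X: "holo_atlas X"
  shows "points (KX X) = KX_points X"
proof
  show "points (KX X) \<subseteq> KX_points X"
    using openin_topspace[of "mtop (KX X)"] unfolding openin_KX[OF X] by blast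
  show "KX_points X \<subseteq> points (KX X)"
  proof
    fix m assume m: "m \<in> KX_points X"
    obtain c where c: "c \<in> charts_at X (fst m)" by (rule atlas_chart_at[OF X KX_pointsD(1)[OF m]])
    have "m \<in> fst (induced_chart X c)" using m charts_atD(2)[OF c] by (simp add: fst_induced_chart)
    then show "m \<in> points (KX X)"
      using openin_subset[OF topological_chartD(1)[OF topological_chart_induced[OF X charts_atD(3)[OF c]]]] by blast
  qed
qed

lemma atlas_KX: "atlas (KX X) = induced_chart X ` charts X"
  by (simp add: KX_def)

lemma holo_atlas_KX:
  assumes X: "holo_atlas X"
  shows "holo_atlas (KX X)"
  unfolding holo_atlas_def atlas_KX
proof (intro conjI ballI)
  show "topological_chart (mtop (KX X)) e" if "e \<in> induced_chart X ` charts X" for e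
    using that topological_chart_induced[OF X] by blast
  show "\<Union> (fst ` induced_chart X ` charts X) = points (KX X)"
    unfolding points_KX[OF X]
  proof (intro equalityI subsetI)
    fix m assume m: "m \<in> KX_points X"
    obtain c where c: "c \<in> charts_at X (fst m)" by (rule atlas_chart_at[OF X KX_pointsD(1)[OF m]])
    have "m \<in> fst (induced_chart X c)" using m charts_atD(2)[OF c] by (simp add: fst_induced_chart)
    then show "m \<in> \<Union> (fst ` induced_chart X ` charts X)" using charts_atD(3)[OF c] by blast
  qed (auto simp: fst_induced_chart)
  fix e e' assume "e \<in> induced_chart X ` charts X" "e' \<in> induced_chart X ` charts X"
  then obtain c c' where c: "c \<in> charts X" "c' \<in> charts X" "e = induced_chart X c" "e' = induced_chart X c'"
    by blast
  show "compatible e e'"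
    unfolding compatible_def c(3,4)
  proof
    show "holo_map_on (snd (induced_chart X c) ` (fst (induced_chart X c) \<inter> fst (induced_chart X c')))
        (transition (induced_chart X c) (induced_chart X c'))"
      unfolding image_induced_chart_overlap[OF X c(1)] by (rule holo_map_on_transition_induced[OF X c(1,2)])
    show "holo_map_on (snd (induced_chart X c') ` (fst (induced_chart X c) \<inter> fst (induced_chart X c')))
        (transition (induced_chart X c') (induced_chart X c))"
      unfolding image_induced_chart_overlap[OF X c(2), of c, unfolded Int_commute[of "fst (induced_chart X c')"]]
      by (rule holo_map_on_transition_induced[OF X c(2,1)])
  qed
qed

lemma induced_chart_at:
  assumes X: "holo_atlas X" and m: "m \<in> KX_points X" and c: "c \<in> charts_at X (fst m)"
  shows "induced_chart X c \<in> charts_at (KX X) m"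
  using atlas_subset_charts[OF holo_atlas_KX[OF X]] charts_atD(2,3)[OF c] m
  unfolding atlas_KX charts_at_def by (auto simp: fst_induced_chart)

lemma holomorphic_map_fst_KX:
  assumes X: "holo_atlas X"
  shows "holomorphic_map (KX X) X fst"
proof (rule holomorphic_mapI[OF holo_atlas_KX[OF X] X])
  fix m assume "m \<in> points (KX X)"
  then have m: "m \<in> KX_points X" by (simp add: points_KX[OF X])
  obtain c where c: "c \<in> charts_at X (fst m)" by (rule atlas_chart_at[OF X KX_pointsD(1)[OF m]])
  note tc = charts_atD[OF c] and i = induced_chart_at[OF X m c]
  have "holo_map_on (snd (induced_chart X c) ` fst (induced_chart X c)) ((\<lambda>m. snd c (fst m)) \<circ> chart_inv (induced_chart X c))"
    by (rule holo_map_on_rep[OF charts_atD(1)[OF i] holo_map_on_kbase]) (simp add: snd_induced_chart)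
  then have "holo_map_on (snd (induced_chart X c) ` fst (induced_chart X c)) (snd c \<circ> fst \<circ> chart_inv (induced_chart X c))"
    by (simp add: comp_def)
  moreover have "fst ` fst (induced_chart X c) \<subseteq> fst c" by (auto simp: fst_induced_chart)
  ultimately show "\<exists>b\<in>charts_at (KX X) m. \<exists>c\<in>charts X. fst ` fst b \<subseteq> fst c \<and>
      holo_map_on (snd b ` fst b) (snd c \<circ> fst \<circ> chart_inv b)"
    using i tc(3) by blast
qed

text \<open>
  Points over different base points are separated by preimages under the projection; points of one
  fibre lie in a common induced chart.
\<close>

lemma Hausdorff_KX:
  assumes X: "holo_atlas X" and H: "Hausdorff_space (mtop X)"
  shows "Hausdorff_space (mtop (KX X))"
  unfolding Hausdorff_space_def
proof (intro allI impI)
  fix m m' assume "m \<in> points (KX X) \<and> m' \<in> points (KX X) \<and> m \<noteq> m'"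
  then have m: "m \<in> KX_points X" "m' \<in> KX_points X" "m \<noteq> m'" by (auto simp: points_KX[OF X])
  show "\<exists>U V. openin (mtop (KX X)) U \<and> openin (mtop (KX X)) V \<and> m \<in> U \<and> m' \<in> V \<and> disjnt U V"
  proof (cases "fst m = fst m'")
    case False
    then obtain U V where UV: "openin (mtop X) U" "openin (mtop X) V" "fst m \<in> U" "fst m' \<in> V" "disjnt U V"
      using H KX_pointsD(1)[OF m(1)] KX_pointsD(1)[OF m(2)] unfolding Hausdorff_space_def by metis
    note o = continuous_map_open_vimage[OF holomorphic_map_continuous[OF holomorphic_map_fst_KX[OF X]]]
    show ?thesis
      by (rule exI[of _ "{q \<in> points (KX X). fst q \<in> U}"], rule exI[of _ "{q \<in> points (KX X). fst q \<in> V}"])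
         (use o[OF UV(1)] o[OF UV(2)] UV(3-5) m in \<open>auto simp: points_KX[OF X] disjnt_iff\<close>)
  next
    case True
    obtain c where c: "c \<in> charts_at X (fst m)" by (rule atlas_chart_at[OF X KX_pointsD(1)[OF m(1)]])
    let ?b = "induced_chart X c"
    have mb: "m \<in> fst ?b" "m' \<in> fst ?b" using m charts_atD(2)[OF c] True by (auto simp: fst_induced_chart)
    have "snd ?b m \<noteq> snd ?b m'"
      using inj_onD[OF inj_on_induced_chart[OF X charts_atD(3)[OF c]] _ mb] m(3) by blast
    then obtain A B where AB: "open A" "open B" "snd ?b m \<in> A" "snd ?b m' \<in> B" "A \<inter> B = {}"
      by (rule hausdorff[THEN exE]) blast
    note o = topological_chartD(5)[OF topological_chart_induced[OF X charts_atD(3)[OF c]]]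
    show ?thesis
      by (rule exI[of _ "{q \<in> fst ?b. snd ?b q \<in> A}"], rule exI[of _ "{q \<in> fst ?b. snd ?b q \<in> B}"])
         (use o[OF AB(1)] o[OF AB(2)] AB(3-5) mb in \<open>auto simp: disjnt_iff\<close>)
  qed
qed

text \<open>
  By compactness finitely many charts of the base suffice; the preimages of a countable basis of the
  model space under the finitely many induced charts form a basis.
\<close>

lemma second_countable_KX:
  assumes X: "holo_atlas X" and cpt: "compact_space (mtop X)"
  shows "second_countable (mtop (KX X))"
proof -
  have "\<And>U. U \<in> fst ` atlas X \<Longrightarrow> openin (mtop X) U"
    using X topological_chartD(1) unfolding holo_atlas_def by blast
  moreover have "\<Union> (fst ` atlas X) = points X" using X unfolding holo_atlas_def by blast
  ultimately obtain \<F> where F: "finite \<F>" "\<F> \<subseteq> fst ` atlas X" "\<Union> \<F> = points X"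
    using cpt unfolding compact_space by metis
  obtain C where C: "finite C" "C \<subseteq> atlas X" "\<F> = fst ` C"
    using finite_subset_image[OF F(1,2)] by blast
  obtain B :: "(complex ^ 'b option) set set" where B: "countable B" "topological_basis B"
    using ex_countable_basis by blast
  let ?v = "\<lambda>c W. {m \<in> fst (induced_chart X c). snd (induced_chart X c) m \<in> W}"
  show ?thesis unfolding second_countable_def
  proof (intro exI conjI ballI allI impI)
    show "countable (\<Union>c\<in>C. ?v c ` B)"
      using countable_finite[OF C(1)] B(1) by (intro countable_UN countable_image)
    show "openin (mtop (KX X)) V" if V: "V \<in> (\<Union>c\<in>C. ?v c ` B)" for V
    proof -
      obtain c W where cW: "c \<in> C" "W \<in> B" "V = ?v c W" using V by blast
      have "c \<in> charts X" using cW(1) C(2) atlas_subset_charts[OF X] by blast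
      from topological_chartD(5)[OF topological_chart_induced[OF X this] topological_basis_open[OF B(2) cW(2)]]
      show ?thesis unfolding cW(3) .
    qed
    fix U m assume Um: "openin (mtop (KX X)) U \<and> m \<in> U"
    then have m: "m \<in> KX_points X" unfolding openin_KX[OF X] by blast
    then obtain c where c: "c \<in> C" "fst m \<in> fst c" using KX_pointsD(1)[OF m] F(3) C(3) by blast
    have cX: "c \<in> charts X" using c(1) C(2) atlas_subset_charts[OF X] by blast
    let ?b = "induced_chart X c"
    have mb: "m \<in> fst ?b" using m c by (simp add: fst_induced_chart)
    have o: "open (snd ?b ` (U \<inter> fst ?b))"
      using topological_chartD(4)[OF topological_chart_induced[OF X cX]] Um by blast
    have "snd ?b m \<in> snd ?b ` (U \<inter> fst ?b)" using Um mb by blast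
    from topological_basisE[OF B(2) o this]
    obtain W where W: "W \<in> B" "snd ?b m \<in> W" "W \<subseteq> snd ?b ` (U \<inter> fst ?b)" .
    have "?v c W \<subseteq> U"
    proof
      fix q assume "q \<in> ?v c W"
      then obtain q' where "q \<in> fst ?b" "q' \<in> U \<inter> fst ?b" "snd ?b q = snd ?b q'" using W(3) by blast
      then show "q \<in> U" using inj_onD[OF inj_on_induced_chart[OF X cX], of q q'] by blast
    qed
    then show "\<exists>V\<in>\<Union>c\<in>C. ?v c ` B. m \<in> V \<and> V \<subseteq> U"
      using c(1) W(1,2) mb by (intro bexI[of _ "?v c W"]) auto
  qed
qed

lemma complex_manifold_KX:
  assumes X: "complex_manifold X" and cpt: "compact_space (mtop X)"
  shows "complex_manifold (KX X)"
proof -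
  have "holo_atlas X" "Hausdorff_space (mtop X)" using X unfolding complex_manifold_iff by auto
  then show ?thesis
    unfolding complex_manifold_iff using Hausdorff_KX second_countable_KX[OF _ cpt] holo_atlas_KX by blast
qed

section \<open>Holomorphic forms from local expressions\<close>

lemma holo_fun_on_local:
  assumes "\<And>x. x \<in> S \<Longrightarrow> \<exists>T. x \<in> T \<and> holo_fun_on T f"
  shows "holo_fun_on S f"
  using assms unfolding holo_fun_on_def by blast

text \<open>
  A local expression \<open>F dw\<^bsub>I\<^esub>\<close> makes the form alternating, and its
  coefficients in any other chart are \<open>F\<close> times determinants of derivatives of a
  transition map.
\<close>

lemma holomorphic_formI:
  fixes \<omega> :: "'a \<Rightarrow> ('a, 'n::finite, 'k::finite) mform"
  assumes M: "holo_atlas M"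
    and z: "\<And>p v. \<not> (p \<in> points M \<and> (\<forall>k. v k \<in> tangent_space M p)) \<Longrightarrow> \<omega> p v = 0"
    and h: "\<And>p. p \<in> points M \<Longrightarrow> \<exists>b\<in>charts_at M p. \<exists>F. holo_fun_on (snd b ` fst b) F \<and>
      (\<forall>q\<in>fst b. \<forall>v. (\<forall>k. v k \<in> tangent_space M q) \<longrightarrow> \<omega> q v = F (snd b q) * det (\<chi> k l. v l b $ I k))"
  shows "holomorphic_form M \<omega>"
  unfolding holomorphic_form_def
proof (intro conjI ballI allI impI)
  fix p assume p: "p \<in> points M"
  obtain b F where b: "b \<in> charts_at M p"
    and e: "\<And>v. \<forall>k. v k \<in> tangent_space M p \<Longrightarrow> \<omega> p v = F (snd b p) * det (\<chi> k l. v l b $ I k)"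
    using h[OF p] charts_atD(2) by metis
  define P where "P u = (\<chi> k. u $ I k)" for u :: "complex ^ 'n"
  have P: "(\<chi> k l. v l b $ I k) = (\<chi> k l. (\<lambda>l. P (v l b)) l $ k)" for v :: "'k \<Rightarrow> ('a, 'n) tvec"
    by (simp add: P_def)
  have Plin: "P (a *s x + b *s y) = a *s P x + b *s P y" for a b x y
    by (simp add: P_def vec_eq_iff)
  show "\<omega> p \<in> alternating_forms M p"
    unfolding alternating_forms_def
  proof (intro CollectI conjI allI impI)
    fix v :: "'k \<Rightarrow> ('a, 'n) tvec" and i x y a c
    assume v: "\<forall>j. v j \<in> tangent_space M p" and xy: "x \<in> tangent_space M p" "y \<in> tangent_space M p"
    have upd: "(\<chi> k l. (v(i := w)) l b $ I k) = (\<chi> k l. ((\<lambda>l. P (v l b))(i := P (w b))) l $ k)" for w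
      by (simp add: vec_eq_iff P_def)
    have t: "\<forall>k. (v(i := w)) k \<in> tangent_space M p" if "w \<in> tangent_space M p" for w
      using v that by simp
    have e': "\<omega> p (v(i := w)) = F (snd b p) * det (\<chi> k l. ((\<lambda>l. P (v l b))(i := P (w b))) l $ k)"
      if "w \<in> tangent_space M p" for w
      using e[OF t[OF that]] unfolding upd .
    show "\<omega> p (v(i := (\<lambda>d. a *s x d + c *s y d))) = a * \<omega> p (v(i := x)) + c * \<omega> p (v(i := y))"
      unfolding e'[OF xy(1)] e'[OF xy(2)] e'[OF tangent_space_lincomb[OF M xy]] Plin
        alt_multilinear_lin[OF alt_multilinear_det]
      by (simp only: algebra_simps)
  next
    fix v :: "'k \<Rightarrow> ('a, 'n) tvec" and i j
    assume v: "\<forall>l. v l \<in> tangent_space M p" and ij: "i \<noteq> j" "v i = v j"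
    have "det (\<chi> k l. (\<lambda>l. P (v l b)) l $ k) = 0"
      by (rule alt_multilinear_alt[OF alt_multilinear_det ij(1)]) (simp add: ij(2))
    then show "\<omega> p v = 0" unfolding e[OF v] P by simp
  next
    fix v :: "'k \<Rightarrow> ('a, 'n) tvec"
    assume "\<exists>i. v i \<notin> tangent_space M p"
    then show "\<omega> p v = 0" by (intro z) blast
  qed
next
  fix p assume "p \<notin> points M"
  then show "\<omega> p = (\<lambda>v. 0)" by (intro ext z) blast
next
  fix c and J :: "'k \<Rightarrow> 'n" assume c: "c \<in> charts M"
  show "holo_fun_on (snd c ` fst c) (\<lambda>u. \<omega> (chart_inv c u) (\<lambda>k. coord_vec M c (chart_inv c u) (J k)))"
  proof (rule holo_fun_on_local)
    fix u assume "u \<in> snd c ` fst c"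
    then obtain p where p: "p \<in> fst c" "u = snd c p" by blast
    have cp: "c \<in> charts_at M p" using c p by (simp add: charts_at_def)
    obtain b F where b: "b \<in> charts_at M p" and F: "holo_fun_on (snd b ` fst b) F"
      and e: "\<forall>q\<in>fst b. \<forall>v. (\<forall>k. v k \<in> tangent_space M q) \<longrightarrow> \<omega> q v = F (snd b q) * det (\<chi> k l. v l b $ I k)"
      using h[OF charts_atD(4)[OF cp]] by (elim bexE exE conjE)
    note tb = charts_atD[OF b]
    let ?S = "snd c ` (fst c \<inter> fst b)"
    have S: "open ?S" by (rule open_chart_overlap[OF c tb(3)])
    have T: "holo_map_on ?S (transition c b)"
      using compatible_charts[OF M c tb(3)] unfolding compatible_def by blast
    have im: "transition c b ` ?S \<subseteq> snd b ` fst b"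
      using chart_inv_left[OF chartsD[OF c]] by (auto simp: transition_def)
    have "holo_fun_on ?S (\<lambda>u. F (transition c b u) *
        det (\<chi> k l. frechet_derivative (transition c b) (at u) (axis (J l) 1) $ I k))"
      by (intro holo_fun_on_mult holo_fun_on_compose[OF T F im] holo_fun_on_det)
         (simp add: holo_fun_on_frechet_component[OF S T])
    then have "holo_fun_on ?S (\<lambda>u. \<omega> (chart_inv c u) (\<lambda>k. coord_vec M c (chart_inv c u) (J k)))"
    proof (rule holo_fun_on_cong[OF S, THEN iffD2, rotated])
      fix u assume "u \<in> ?S"
      then obtain q where q: "q \<in> fst c" "q \<in> fst b" "u = snd c q" by blast
      have i: "chart_inv c u = q" unfolding q(3) by (rule chart_inv_left[OF chartsD[OF c] q(1)])
      have cq: "c \<in> charts_at M q" and bq: "b \<in> charts_at M q"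
        using c q tb(3) by (auto simp: charts_at_def)
      have "coord_vec M c q (J l) b = frechet_derivative (transition c b) (at u) (axis (J l) 1)" for l
        using bq by (simp add: coord_vec_def q(3))
      moreover have "\<omega> q (\<lambda>k. coord_vec M c q (J k)) = F (snd b q) * det (\<chi> k l. coord_vec M c q (J l) b $ I k)"
        by (rule e[rule_format, OF q(2)]) (rule coord_vec_tangent[OF M cq])
      moreover have "transition c b u = snd b q" by (simp add: transition_def i)
      ultimately show "\<omega> (chart_inv c u) (\<lambda>k. coord_vec M c (chart_inv c u) (J k))
          = F (transition c b u) * det (\<chi> k l. frechet_derivative (transition c b) (at u) (axis (J l) 1) $ I k)"
        by (simp add: i)
    qed
    moreover have "u \<in> ?S" using p tb(2) by blast
    ultimately show "\<exists>T. u \<in> T \<and> holo_fun_on T (\<lambda>u. \<omega> (chart_inv c u) (\<lambda>k. coord_vec M c (chart_inv c u) (J k)))"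
      by (intro exI[of _ ?S] conjI)
  qed
qed

section \<open>Open parts of the canonical bundle\<close>

text \<open>
  The bundle itself and the complement of its zero section are treated together, as open parts of
  the bundle.
\<close>

definition bundle_part :: "('a, 'd::finite) cmanifold \<Rightarrow> ('a, 'd) kpoint set \<Rightarrow> bool" where
  "bundle_part X W \<longleftrightarrow> holo_atlas X \<and> openin (mtop (KX X)) W"

definition part_chart ::
  "('a, 'd::finite) cmanifold \<Rightarrow> ('a, 'd) kpoint set \<Rightarrow> ('a, 'd) chart \<Rightarrow> (('a, 'd) kpoint, 'd option) chart" where
  "part_chart X W c = (fst (induced_chart X c) \<inter> W, snd (induced_chart X c))"

abbreviation KW :: "('a, 'd::finite) cmanifold \<Rightarrow> ('a, 'd) kpoint set \<Rightarrow> (('a, 'd) kpoint, 'd option) cmanifold" where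
  "KW X W \<equiv> open_submanifold (KX X) W"

lemma bundle_partD:
  assumes "bundle_part X W"
  shows "holo_atlas X" "openin (mtop (KX X)) W" "holo_atlas (KW X W)" "points (KW X W) = W" "W \<subseteq> KX_points X"
proof -
  show X: "holo_atlas X" and W: "openin (mtop (KX X)) W" using assms unfolding bundle_part_def by auto
  show "holo_atlas (KW X W)" by (rule holo_atlas_open_submanifold[OF holo_atlas_KX[OF X] W])
  show "points (KW X W) = W" by (rule points_open_submanifold[OF W])
  show "W \<subseteq> KX_points X" using W unfolding openin_KX[OF X] by blast
qed

lemma snd_part_chart: "snd (part_chart X W c) m = kjoin (fibre_coord X c m) (snd c (fst m))"
  by (simp add: part_chart_def snd_induced_chart)

lemma snd_part_chart': "snd (part_chart X W c) = snd (induced_chart X c)"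
  by (simp add: part_chart_def)

lemma fst_part_chart: "bundle_part X W \<Longrightarrow> fst (part_chart X W c) = {m \<in> W. fst m \<in> fst c}"
  using bundle_partD(5) by (auto simp: part_chart_def fst_induced_chart)

lemma part_chart_at:
  assumes P: "bundle_part X W" and m: "m \<in> W" and c: "c \<in> charts_at X (fst m)"
  shows "part_chart X W c \<in> charts_at (KW X W) m" "part_chart X W c \<in> charts_at (KX X) m"
proof -
  note D = bundle_partD[OF P]
  have mK: "m \<in> KX_points X" using m D(5) by blast
  have i: "induced_chart X c \<in> charts_at (KX X) m" by (rule induced_chart_at[OF D(1) mK c])
  then have ch: "part_chart X W c \<in> charts (KX X)"
    unfolding part_chart_def by (intro charts_restrict[OF holo_atlas_KX[OF D(1)] _ D(2)] charts_atD(3))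
  moreover have mem: "m \<in> fst (part_chart X W c)"
    using m charts_atD(2)[OF i] by (simp add: part_chart_def)
  ultimately show k: "part_chart X W c \<in> charts_at (KX X) m" by (simp add: charts_at_def)
  have "fst (part_chart X W c) \<subseteq> W" by (auto simp: part_chart_def)
  then show "part_chart X W c \<in> charts_at (KW X W) m"
    using k unfolding charts_at_open_submanifold[OF holo_atlas_KX[OF D(1)] D(2)] by blast
qed

lemma jac_same_map:
  assumes c: "c \<in> charts_at M p" "c' \<in> charts_at M p" and s: "snd c' = snd c"
  shows "jac c c' p v = v"
proof -
  note t = charts_atD[OF c(1)]
  have "\<forall>u\<in>snd c ` fst c. transition c c' u = u"
    using chart_inv_right(2)[of _ c] by (simp add: transition_def s)
  from cdiff_at_cong(2)[OF topological_chartD(3)[OF t(1)] imageI[OF t(2)] this]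
  have "jac c c' p = frechet_derivative (\<lambda>u. u) (at (snd c p))" .
  then show ?thesis by simp
qed

text \<open>Restricting charts to smaller domains does not change their Jacobians.\<close>

lemma jdet_part_chart:
  assumes P: "bundle_part X W" and m: "m \<in> W" and c: "c \<in> charts_at X (fst m)" "c' \<in> charts_at X (fst m)"
  shows "jdet (part_chart X W c) (part_chart X W c') m = 1"
proof -
  note D = bundle_partD[OF P] and K = holo_atlas_KX[OF bundle_partD(1)[OF P]]
  have mK: "m \<in> KX_points X" using m D(5) by blast
  note i = induced_chart_at[OF D(1) mK c(1)] and i' = induced_chart_at[OF D(1) mK c(2)]
  note p = part_chart_at(2)[OF P m c(1)] and p' = part_chart_at(2)[OF P m c(2)]
  have "jac (part_chart X W c) (part_chart X W c') m v = jac (induced_chart X c) (induced_chart X c') m v" for v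
  proof -
    have "jac (part_chart X W c) (part_chart X W c') m v
      = jac (induced_chart X c) (part_chart X W c') m (jac (part_chart X W c) (induced_chart X c) m v)"
      by (rule jac_trans[OF K p i p'])
    also have "jac (part_chart X W c) (induced_chart X c) m v = v"
      by (rule jac_same_map[OF p i]) (simp add: snd_part_chart')
    also have "jac (induced_chart X c) (part_chart X W c') m v
      = jac (induced_chart X c') (part_chart X W c') m (jac (induced_chart X c) (induced_chart X c') m v)"
      by (rule jac_trans[OF K i i' p'])
    also have "\<dots> = jac (induced_chart X c) (induced_chart X c') m v"
      by (rule jac_same_map[OF i' p']) (simp add: snd_part_chart')
    finally show ?thesis .
  qed
  then show ?thesis using jdet_induced[OF D(1) mK c] by (simp add: jdet_def)
qed

text \<open>
  The form \<open>dz \<and> dw\<^sub>1 \<and> \<dots> \<and> dw\<^sub>d\<close> on an open part of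
  the bundle, written in an arbitrarily chosen chart.
\<close>

definition vol ::
  "('a, 'd::finite) cmanifold \<Rightarrow> ('a, 'd) kpoint set \<Rightarrow> ('a, 'd) kpoint \<Rightarrow>
   (('a, 'd) kpoint, 'd option, 'd option) mform" where
  "vol X W = (\<lambda>m v. if m \<in> W \<and> (\<forall>k. v k \<in> tangent_space (KW X W) m)
     then det (\<chi> k l. v l (part_chart X W (SOME c. c \<in> charts_at X (fst m))) $ k) else 0)"

text \<open>
  The choice of the chart is immaterial because the transition maps have Jacobian determinant
  \<open>1\<close>.
\<close>

lemma vol_eq:
  assumes P: "bundle_part X W" and m: "m \<in> W" and c: "c \<in> charts_at X (fst m)"
    and v: "\<forall>k. v k \<in> tangent_space (KW X W) m"
  shows "vol X W m v = det (\<chi> k l. v l (part_chart X W c) $ k)"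
proof -
  define d where "d = (SOME c. c \<in> charts_at X (fst m))"
  have d: "d \<in> charts_at X (fst m)" unfolding d_def using c by (rule someI)
  have "vol X W m v = det (\<chi> k l. v l (part_chart X W d) $ k)"
    using m v by (simp add: vol_def d_def)
  also have "\<dots> = jdet (part_chart X W c) (part_chart X W d) m * det (\<chi> k l. v l (part_chart X W c) $ k)"
    by (rule det_components_change[OF bundle_partD(3)[OF P] part_chart_at(1)[OF P m c] part_chart_at(1)[OF P m d] v[rule_format]])
  finally show ?thesis by (simp add: jdet_part_chart[OF P m c d])
qed

lemma vol_0: "\<not> (m \<in> W \<and> (\<forall>k. v k \<in> tangent_space (KW X W) m)) \<Longrightarrow> vol X W m v = 0"
  unfolding vol_def by (rule if_not_P)

lemma bundle_part_chart_obtain: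
  assumes P: "bundle_part X W" and m: "m \<in> W"
  obtains c where "c \<in> atlas X" "c \<in> charts_at X (fst m)"
proof -
  have "fst m \<in> points X" using KX_pointsD(1) bundle_partD(5)[OF P] m by blast
  then show ?thesis using atlas_chart_at[OF bundle_partD(1)[OF P]] that by metis
qed

lemma part_chart_memberD: "bundle_part X W \<Longrightarrow> c \<in> charts X \<Longrightarrow> q \<in> fst (part_chart X W c) \<Longrightarrow>
    q \<in> W \<and> c \<in> charts_at X (fst q)"
  by (simp add: fst_part_chart charts_at_def)

lemma holomorphic_form_vol:
  fixes X :: "('a, 'd::finite) cmanifold"
  assumes P: "bundle_part X W"
  shows "holomorphic_form (KW X W) (vol X W)"
proof (rule holomorphic_formI[OF bundle_partD(3)[OF P], where I = "\<lambda>k. k"])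
  fix m and v :: "'d option \<Rightarrow> (('a, 'd) kpoint, 'd option) tvec"
  assume "\<not> (m \<in> points (KW X W) \<and> (\<forall>k. v k \<in> tangent_space (KW X W) m))"
  then show "vol X W m v = 0" unfolding bundle_partD(4)[OF P] by (rule vol_0)
next
  fix m assume "m \<in> points (KW X W)"
  then have m: "m \<in> W" unfolding bundle_partD(4)[OF P] .
  obtain c where c: "c \<in> charts_at X (fst m)" by (rule bundle_part_chart_obtain[OF P m])
  have "vol X W q v = 1 * det (\<chi> k l. v l (part_chart X W c) $ k)"
    if "q \<in> fst (part_chart X W c)" "\<forall>k. v k \<in> tangent_space (KW X W) q" for q v
  proof -
    have q: "q \<in> W" "c \<in> charts_at X (fst q)" using part_chart_memberD[OF P charts_atD(3)[OF c] that(1)] by auto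
    show ?thesis unfolding mult_1 by (rule vol_eq[OF P q that(2)])
  qed
  then show "\<exists>b\<in>charts_at (KW X W) m. \<exists>F. holo_fun_on (snd b ` fst b) F \<and>
      (\<forall>q\<in>fst b. \<forall>v. (\<forall>k. v k \<in> tangent_space (KW X W) q) \<longrightarrow> vol X W q v = F (snd b q) * det (\<chi> k l. v l b $ k))"
    using holo_fun_on_const[of "snd (part_chart X W c) ` fst (part_chart X W c)" 1]
    by (intro bexI[OF _ part_chart_at(1)[OF P m c]] exI[of _ "\<lambda>u. 1"]) blast
qed

lemma vol_wedge:
  assumes P: "bundle_part X W" and c: "c \<in> charts X" and m: "m \<in> fst (part_chart X W c)"
  shows "vol X W m = wedge_coords (KW X W) (part_chart X W c) (\<lambda>k. k) m"
proof
  fix v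
  have mW: "m \<in> W" and cm: "c \<in> charts_at X (fst m)" using part_chart_memberD[OF P c m] by auto
  show "vol X W m v = wedge_coords (KW X W) (part_chart X W c) (\<lambda>k. k) m v"
  proof (cases "\<forall>k. v k \<in> tangent_space (KW X W) m")
    case True
    then show ?thesis using vol_eq[OF P mW cm True] m by (simp add: wedge_coords_def)
  next
    case False
    then have "wedge_coords (KW X W) (part_chart X W c) (\<lambda>k. k) m v = 0"
      unfolding wedge_coords_def by (intro if_not_P) blast
    moreover have "vol X W m v = 0" by (rule vol_0) (use False in blast)
    ultimately show ?thesis by simp
  qed
qed

lemma nowhere_vanishing_vol:
  assumes P: "bundle_part X W"
  shows "nowhere_vanishing (KW X W) (vol X W)"
  unfolding nowhere_vanishing_def bundle_partD(4)[OF P]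
proof (intro ballI notI)
  fix m assume m: "m \<in> W" and z: "vol X W m = (\<lambda>v. 0)"
  obtain c where c: "c \<in> charts_at X (fst m)" by (rule bundle_part_chart_obtain[OF P m])
  note p = part_chart_at(1)[OF P m c]
  have "vol X W m (\<lambda>i. coord_vec (KW X W) (part_chart X W c) m i) = 1"
    using vol_eq[OF P m c, of "\<lambda>i. coord_vec (KW X W) (part_chart X W c) m i"]
    by (simp add: coord_vec_tangent[OF bundle_partD(3)[OF P] p] coord_vec_self[OF p] det_axis)
  then show False using z by simp
qed

lemma bundle_part_KX: "holo_atlas X \<Longrightarrow> bundle_part X (KX_points X)"
  using openin_topspace[of "mtop (KX X)"] points_KX[of X] by (simp add: bundle_part_def)

lemma KW_KX: "holo_atlas X \<Longrightarrow> KW X (KX_points X) = KX X"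
  using open_submanifold_points[OF holo_atlas_KX] points_KX by metis

lemma part_chart_KX: "part_chart X (KX_points X) c = induced_chart X c"
  by (simp add: part_chart_def fst_induced_chart prod_eq_iff) blast

text \<open>
  The local expressions determine the form at every point of the bundle, and forms vanish elsewhere
  by convention.
\<close>

lemma canonical_form_eq_vol:
  assumes X: "holo_atlas X"
  shows "canonical_form X = vol X (KX_points X)"
  unfolding canonical_form_def
proof (rule the_equality)
  note P = bundle_part_KX[OF X]
  have w: "\<forall>c\<in>charts X. \<forall>m\<in>fst (induced_chart X c).
      vol X (KX_points X) m = wedge_coords (KX X) (induced_chart X c) (\<lambda>k. k) m"
    using vol_wedge[OF P] unfolding KW_KX[OF X] part_chart_KX by blast
  show "holomorphic_form (KX X) (vol X (KX_points X)) \<and> (\<forall>c\<in>charts X. \<forall>m\<in>fst (induced_chart X c).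
      vol X (KX_points X) m = wedge_coords (KX X) (induced_chart X c) (\<lambda>k. k) m)"
    using holomorphic_form_vol[OF P] w unfolding KW_KX[OF X] by blast
  fix \<omega> assume \<omega>: "holomorphic_form (KX X) \<omega> \<and> (\<forall>c\<in>charts X. \<forall>m\<in>fst (induced_chart X c).
      \<omega> m = wedge_coords (KX X) (induced_chart X c) (\<lambda>k. k) m)"
  show "\<omega> = vol X (KX_points X)"
  proof
    fix m show "\<omega> m = vol X (KX_points X) m"
    proof (cases "m \<in> KX_points X")
      case True
      obtain c where c: "c \<in> charts_at X (fst m)" by (rule bundle_part_chart_obtain[OF P True])
      have "m \<in> fst (induced_chart X c)" using True charts_atD(2)[OF c] by (simp add: fst_induced_chart)
      then show ?thesis using \<omega> w charts_atD(3)[OF c] by simp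
    next
      case False
      then have "\<omega> m = (\<lambda>v. 0)" using \<omega> unfolding holomorphic_form_def points_KX[OF X] by blast
      moreover have "vol X (KX_points X) m = (\<lambda>v. 0)" using False by (intro ext vol_0) blast
      ultimately show ?thesis by simp
    qed
  qed
qed

section \<open>Maps that scale the fibre coordinate\<close>

text \<open>The map \<open>(z, w) \<mapsto> (a z, w)\<close>.\<close>

definition kscale :: "complex \<Rightarrow> complex ^ 'd::finite option \<Rightarrow> complex ^ 'd option" where
  "kscale a u = kjoin (a * u $ None) (kbase u)"

lemma kscale_simps [simp]: "kscale a u $ None = a * u $ None" "kscale a u $ Some i = u $ Some i"
  by (simp_all add: kscale_def)

lemma kscale_1: "kscale 1 u = u"
  by (simp add: kscale_def)

lemma kscale_kjoin: "kscale a (kjoin z w) = kjoin (a * z) w"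
  by (simp add: kscale_def)

lemma has_derivative_kscale: "(kscale a has_derivative kscale a) (at u)"
  unfolding has_derivative_vec_iff
proof
  fix k show "((\<lambda>u. kscale a u $ k) has_derivative (\<lambda>u. kscale a u $ k)) (at u)"
    by (cases k) (auto intro!: bounded_linear_imp_has_derivative bounded_linear_vec_nth
        bounded_linear_const_mult)
qed

lemma holo_map_on_kscale: "holo_map_on S (kscale a)"
  unfolding holo_map_on_iff
proof
  fix u :: "complex ^ 'a option"
  have "kscale a (b *s v) = b *s kscale a v" for b and v :: "complex ^ 'a option"
  proof -
    have "kscale a (b *s v) $ k = (b *s kscale a v) $ k" for k by (cases k) simp_all
    then show ?thesis by (simp add: vec_eq_iff)
  qed
  then show "cdiff_at (kscale a) u" by (rule cdiff_atI[OF has_derivative_kscale])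
qed

lemma det_kscale:
  "det (\<chi> k l. kscale a (v l) $ k) = a * det (\<chi> k l. v l $ k :: complex ^ 'd::finite option ^ 'd option)"
proof -
  have "(\<chi> k l. kscale a (v l) $ k) = (\<chi> k. if k = None then a *s (\<chi> l. v l $ k) else (\<chi> l. v l $ k))"
  proof -
    have "(\<chi> k l. kscale a (v l) $ k) $ k = (\<chi> k. if k = None then a *s (\<chi> l. v l $ k) else (\<chi> l. v l $ k)) $ k" for k
      by (cases k) (simp_all add: vec_eq_iff)
    then show ?thesis by (simp add: vec_eq_iff)
  qed
  moreover have "(\<chi> k l. v l $ k) = (\<chi> k. if k = None then (\<chi> l. v l $ k) else (\<chi> l. v l $ k))"
    by simp
  ultimately show ?thesis using det_row_mul[of None a "\<lambda>k. \<chi> l. v l $ k" "\<lambda>k. \<chi> l. v l $ k"] by simp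
qed

text \<open>
  In suitable induced charts around each point and its image, \<open>f\<close> is \<open>(z, w)
  \<mapsto> (a z, w)\<close>.  Inclusions, scalings and lifts of automorphisms are all of this kind.
\<close>

definition fibre_scaling ::
  "('a, 'd::finite) cmanifold \<Rightarrow> ('a, 'd) kpoint set \<Rightarrow> ('a, 'd) kpoint set \<Rightarrow>
   (('a, 'd) kpoint \<Rightarrow> ('a, 'd) kpoint) \<Rightarrow> complex \<Rightarrow> bool" where
  "fibre_scaling X W W' f a \<longleftrightarrow> (\<forall>m\<in>W. \<exists>c\<in>charts_at X (fst m). \<exists>c'\<in>charts X.
     \<forall>q\<in>W. fst q \<in> fst c \<longrightarrow> f q \<in> W' \<and> fst (f q) \<in> fst c' \<and>
       snd (induced_chart X c') (f q) = kscale a (snd (induced_chart X c) q))"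

lemma fibre_scalingE:
  assumes "fibre_scaling X W W' f a" "m \<in> W"
  obtains c c' where "c \<in> charts_at X (fst m)" "c' \<in> charts X" "c' \<in> charts_at X (fst (f m))" "f m \<in> W'"
    "\<And>q. q \<in> W \<Longrightarrow> fst q \<in> fst c \<Longrightarrow> f q \<in> W' \<and> fst (f q) \<in> fst c' \<and>
       snd (induced_chart X c') (f q) = kscale a (snd (induced_chart X c) q)"
proof -
  obtain c c' where c: "c \<in> charts_at X (fst m)" and c': "c' \<in> charts X"
    and h: "\<forall>q\<in>W. fst q \<in> fst c \<longrightarrow> f q \<in> W' \<and> fst (f q) \<in> fst c' \<and>
       snd (induced_chart X c') (f q) = kscale a (snd (induced_chart X c) q)"
    using assms(1)[unfolded fibre_scaling_def, rule_format, OF assms(2)] by (elim bexE)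
  have "f m \<in> W'" "fst (f m) \<in> fst c'" using h assms(2) charts_atD(2)[OF c] by auto
  then show ?thesis using that[OF c c'] c' h by (simp add: charts_at_def)
qed

lemma fibre_scaling_cong:
  assumes "fibre_scaling X W W' f a" "\<And>m. m \<in> W \<Longrightarrow> g m = f m"
  shows "fibre_scaling X W W' g a"
  using assms(1) unfolding fibre_scaling_def by (simp add: assms(2) cong: ball_cong)

lemma holomorphic_map_fibre_scaling:
  assumes P: "bundle_part X W" and P': "bundle_part X W'" and f: "fibre_scaling X W W' f a"
  shows "holomorphic_map (KW X W) (KW X W') f"
proof (rule holomorphic_mapI[OF bundle_partD(3)[OF P] bundle_partD(3)[OF P']])
  fix m assume "m \<in> points (KW X W)"
  then have m: "m \<in> W" unfolding bundle_partD(4)[OF P] .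
  obtain c c' where c: "c \<in> charts_at X (fst m)" and c': "c' \<in> charts_at X (fst (f m))" and fm: "f m \<in> W'"
    and h: "\<And>q. q \<in> W \<Longrightarrow> fst q \<in> fst c \<Longrightarrow> f q \<in> W' \<and> fst (f q) \<in> fst c' \<and>
       snd (induced_chart X c') (f q) = kscale a (snd (induced_chart X c) q)"
    by (rule fibre_scalingE[OF f m]) blast
  note p = part_chart_at(1)[OF P m c] and p' = part_chart_at(1)[OF P' fm c']
  have "holo_map_on (snd (part_chart X W c) ` fst (part_chart X W c))
      ((\<lambda>q. snd (part_chart X W' c') (f q)) \<circ> chart_inv (part_chart X W c))"
    by (rule holo_map_on_rep[OF charts_atD(1)[OF p] holo_map_on_kscale])
       (simp add: snd_part_chart' fst_part_chart[OF P] h)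
  moreover have "(\<lambda>q. snd (part_chart X W' c') (f q)) \<circ> chart_inv (part_chart X W c)
      = snd (part_chart X W' c') \<circ> f \<circ> chart_inv (part_chart X W c)" by (simp add: comp_def)
  moreover have "f ` fst (part_chart X W c) \<subseteq> fst (part_chart X W' c')"
    using h by (auto simp: fst_part_chart[OF P] fst_part_chart[OF P'])
  ultimately show "\<exists>b\<in>charts_at (KW X W) m. \<exists>d\<in>charts (KW X W'). f ` fst b \<subseteq> fst d \<and>
      holo_map_on (snd b ` fst b) (snd d \<circ> f \<circ> chart_inv b)"
    using p charts_atD(3)[OF p'] by (intro bexI[of _ "part_chart X W c"] bexI[of _ "part_chart X W' c'"]) auto
qed

lemma differential_fibre_scaling:
  assumes P: "bundle_part X W" and P': "bundle_part X W'" and f: "fibre_scaling X W W' f a"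
    and m: "m \<in> W" and c: "c \<in> charts_at X (fst m)" and c': "c' \<in> charts_at X (fst (f m))" and fm: "f m \<in> W'"
    and h: "\<And>q. q \<in> W \<Longrightarrow> fst q \<in> fst c \<Longrightarrow> f q \<in> W' \<and> fst (f q) \<in> fst c' \<and>
       snd (induced_chart X c') (f q) = kscale a (snd (induced_chart X c) q)"
    and v: "v \<in> tangent_space (KW X W) m"
  shows "differential (KW X W) (KW X W') f m v (part_chart X W' c') = kscale a (v (part_chart X W c))"
proof (rule differential_local_rep[OF bundle_partD(3)[OF P] bundle_partD(3)[OF P']
      holomorphic_map_fibre_scaling[OF P P' f] v part_chart_at(1)[OF P m c] part_chart_at(1)[OF P' fm c']])
  show "openin (mtop (KW X W)) W"
    using openin_topspace[of "mtop (KW X W)"] unfolding bundle_partD(4)[OF P] .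
  show "m \<in> W" by (rule m)
  show "snd (part_chart X W' c') (f q) = kscale a (snd (part_chart X W c) q)"
    if "q \<in> W" "q \<in> fst (part_chart X W c)" for q
    using that h[of q] by (simp add: snd_part_chart' fst_part_chart[OF P])
qed (rule has_derivative_kscale)

text \<open>
  The differential multiplies the \<open>z\<close>-components by \<open>a\<close>, that is, one row
  of the determinant.
\<close>

lemma pullback_vol:
  assumes P: "bundle_part X W" and P': "bundle_part X W'" and f: "fibre_scaling X W W' f a"
  shows "pullback (KW X W) (KW X W') f (vol X W') = scale_form a (vol X W)"
proof (intro ext)
  fix m v
  show "pullback (KW X W) (KW X W') f (vol X W') m v = scale_form a (vol X W) m v"
  proof (cases "m \<in> W \<and> (\<forall>k. v k \<in> tangent_space (KW X W) m)")
    case True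
    then have m: "m \<in> W" and v: "\<And>k. v k \<in> tangent_space (KW X W) m" by auto
    obtain c c' where c: "c \<in> charts_at X (fst m)" and c': "c' \<in> charts_at X (fst (f m))" and fm: "f m \<in> W'"
      and h: "\<And>q. q \<in> W \<Longrightarrow> fst q \<in> fst c \<Longrightarrow> f q \<in> W' \<and> fst (f q) \<in> fst c' \<and>
         snd (induced_chart X c') (f q) = kscale a (snd (induced_chart X c) q)"
      by (rule fibre_scalingE[OF f m]) blast
    let ?D = "differential (KW X W) (KW X W') f m"
    have "?D (v k) \<in> tangent_space (KW X W') (f m)" for k
      by (rule differential_tangent[OF bundle_partD(3)[OF P] bundle_partD(3)[OF P']
            holomorphic_map_fibre_scaling[OF P P' f] v]) (simp only: bundle_partD(4)[OF P] m)
    then have t: "\<forall>k. ?D (v k) \<in> tangent_space (KW X W') (f m)" ..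
    have dv: "?D (v k) (part_chart X W' c') = kscale a (v k (part_chart X W c))" for k
      by (rule differential_fibre_scaling[OF P P' f m c c' fm h v])
    have "pullback (KW X W) (KW X W') f (vol X W') m v = vol X W' (f m) (\<lambda>k. ?D (v k))"
      unfolding pullback_def bundle_partD(4)[OF P] using True by simp
    also have "\<dots> = det (\<chi> k l. kscale a (v l (part_chart X W c)) $ k)"
      unfolding vol_eq[OF P' fm c' t] dv ..
    also have "\<dots> = a * vol X W m v"
      unfolding det_kscale vol_eq[OF P m c conjunct2[OF True]] ..
    finally show ?thesis by (simp add: scale_form_def)
  next
    case False
    have "pullback (KW X W) (KW X W') f (vol X W') m v = 0"
      unfolding pullback_def bundle_partD(4)[OF P] by (rule if_not_P[OF False])
    then show ?thesis using vol_0[OF False] by (simp add: scale_form_def)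
  qed
qed

section \<open>The vector field of the scaling action and the interior product\<close>

text \<open>
  Multiplication in the fibres, not restricted to a part of the bundle; the action of
  \<open>h\<close> is multiplication by \<open>h\<^sup>-\<^sup>1\<close>.
\<close>

definition fibre_mult :: "complex \<Rightarrow> ('a, 'd) kpoint \<Rightarrow> ('a, 'd) kpoint" where
  "fibre_mult h m = (fst m, \<lambda>v. snd m v * h)"

definition scale_invariant :: "('a, 'd) kpoint set \<Rightarrow> bool" where
  "scale_invariant W \<longleftrightarrow> (\<forall>m\<in>W. \<forall>h. h \<noteq> 0 \<longrightarrow> fibre_mult h m \<in> W)"

lemma fibre_mult_simps [simp]:
  "fst (fibre_mult h m) = fst m" "fibre_mult 1 m = m" "fibre_mult h (fibre_mult k m) = fibre_mult (k * h) m"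
  "fibre_coord X c (fibre_mult h m) = fibre_coord X c m * h"
  by (simp_all add: fibre_mult_def fibre_coord_def mult.assoc)

lemma scaling_action_eq:
  assumes "bundle_part X W"
  shows "scaling_action (KW X W) h = (\<lambda>m\<in>W. fibre_mult (inverse h) m)"
  unfolding scaling_action_def bundle_partD(4)[OF assms] fibre_mult_def ..

text \<open>In coordinates the orbit is \<open>t \<mapsto> (z exp (- t \<xi>), w)\<close>.\<close>

lemma generated_field:
  assumes P: "bundle_part X W" and inv: "scale_invariant W" and m: "m \<in> W" and c: "c \<in> charts_at X (fst m)"
  defines "\<rho> \<equiv> scaling_action (KW X W)"
  shows "generated_field (KW X W) \<rho> \<xi> m \<in> tangent_space (KW X W) m"
    and "generated_field (KW X W) \<rho> \<xi> m (part_chart X W c) = kjoin (- \<xi> * fibre_coord X c m) 0"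
proof -
  define \<gamma> where "\<gamma> t = \<rho> (exp (of_real t * \<xi>)) m" for t
  have \<gamma>: "\<gamma> t = fibre_mult (exp (of_real t * (- \<xi>))) m" for t
    using m by (simp add: \<gamma>_def \<rho>_def scaling_action_eq[OF P] exp_minus)
  have 0: "\<gamma> 0 = m" by (simp add: \<gamma>)
  have p: "part_chart X W c \<in> charts_at (KW X W) (\<gamma> 0)" unfolding 0 by (rule part_chart_at(1)[OF P m c])
  have in_W: "\<gamma> t \<in> W" for t using inv m unfolding scale_invariant_def \<gamma> by simp
  have d: "((\<lambda>t. snd (part_chart X W c) (\<gamma> t)) has_vector_derivative kjoin (- \<xi> * fibre_coord X c m) 0) (at 0)"
  proof -
    let ?z = "fibre_coord X c m"
    have rep: "snd (part_chart X W c) (\<gamma> t) = kjoin (?z * exp (of_real t * (- \<xi>))) (snd c (fst m))" for t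
      by (simp add: snd_part_chart \<gamma>)
    have "((\<lambda>t. ?z * exp (t * (- \<xi>))) has_field_derivative ?z * (- \<xi>)) (at (of_real 0))"
      by (auto intro!: derivative_eq_intros)
    from has_vector_derivative_real_field[OF this]
    have 1: "((\<lambda>t. ?z * exp (of_real t * (- \<xi>))) has_vector_derivative ?z * (- \<xi>)) (at 0)" .
    show ?thesis unfolding rep has_vector_derivative_def has_derivative_vec_iff
    proof
      fix k show "((\<lambda>t. kjoin (?z * exp (of_real t * (- \<xi>))) (snd c (fst m)) $ k) has_derivative
          (\<lambda>t. (t *\<^sub>R kjoin (- \<xi> * ?z) 0) $ k)) (at 0)"
      proof (cases k)
        case None
        then show ?thesis using 1 by (simp add: has_vector_derivative_def mult.commute)
      qed simp
    qed
  qed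
  have ev: "eventually (\<lambda>t. \<gamma> t \<in> fst (part_chart X W c)) (at 0)"
    using in_W charts_atD(2)[OF c] by (simp add: fst_part_chart[OF P] \<gamma>)
  have "generated_field (KW X W) \<rho> \<xi> m = velocity (KW X W) \<gamma>"
    unfolding generated_field_def \<gamma>_def ..
  then show "generated_field (KW X W) \<rho> \<xi> m \<in> tangent_space (KW X W) m"
    and "generated_field (KW X W) \<rho> \<xi> m (part_chart X W c) = kjoin (- \<xi> * fibre_coord X c m) 0"
    using velocity_component[OF bundle_partD(3)[OF P] p ev d] unfolding 0 by simp_all
qed

text \<open>
  The form \<open>\<iota>\<^bsub>x\<^sub>0\<^esub> vol\<close>, which turns out to be \<open>z
  dw\<^sub>1 \<and> \<dots> \<and> dw\<^sub>d\<close>.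
\<close>

definition horizontal_form ::
  "('a, 'd::finite) cmanifold \<Rightarrow> ('a, 'd) kpoint set \<Rightarrow> ('a, 'd) kpoint \<Rightarrow> (('a, 'd) kpoint, 'd option, 'd) mform" where
  "horizontal_form X W = interior_mult (KW X W) (x0 (KW X W)) (vol X W)"

text \<open>
  The column of the determinant that belongs to \<open>x\<^sub>0\<close> is \<open>(z, 0)\<close>,
  so the determinant is \<open>z\<close> times that of the \<open>w\<close>-components.
\<close>

lemma horizontal_form_eq:
  assumes P: "bundle_part X W" and inv: "scale_invariant W" and m: "m \<in> W" and c: "c \<in> charts_at X (fst m)"
    and v: "\<forall>k. v k \<in> tangent_space (KW X W) m"
  shows "horizontal_form X W m v = fibre_coord X c m * det (\<chi> k l. v l (part_chart X W c) $ Some k)"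
proof -
  have x: "x0 (KW X W) m \<in> tangent_space (KW X W) m"
    "x0 (KW X W) m (part_chart X W c) = kjoin (fibre_coord X c m) 0"
    using generated_field[OF P inv m c, of "-1"] unfolding x0_def by simp_all
  define A where "A = (\<chi> k l. case_option (x0 (KW X W) m) v l (part_chart X W c) $ k)"
  have "\<forall>k. case_option (x0 (KW X W) m) v k \<in> tangent_space (KW X W) m"
    using x(1) v by (simp split: option.split)
  from vol_eq[OF P m c this] have "horizontal_form X W m v = det A"
    unfolding horizontal_form_def interior_mult_def bundle_partD(4)[OF P] A_def using m v by simp
  also have "\<dots> = A $ None $ None * det (\<chi> i j. A $ Some i $ Some j)"
    by (rule det_option_block) (simp add: A_def x(2))
  finally show ?thesis by (simp add: A_def x(2))
qed

lemma horizontal_form_0: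
  "bundle_part X W \<Longrightarrow> \<not> (m \<in> W \<and> (\<forall>k. v k \<in> tangent_space (KW X W) m)) \<Longrightarrow> horizontal_form X W m v = 0"
  unfolding horizontal_form_def interior_mult_def by (simp only: bundle_partD(4) if_False)

lemma holomorphic_form_horizontal:
  fixes X :: "('a, 'd::finite) cmanifold"
  assumes P: "bundle_part X W" and inv: "scale_invariant W"
  shows "holomorphic_form (KW X W) (horizontal_form X W)"
proof (rule holomorphic_formI[OF bundle_partD(3)[OF P], where I = Some])
  fix m and v :: "'d \<Rightarrow> (('a, 'd) kpoint, 'd option) tvec"
  assume "\<not> (m \<in> points (KW X W) \<and> (\<forall>k. v k \<in> tangent_space (KW X W) m))"
  then show "horizontal_form X W m v = 0" unfolding bundle_partD(4)[OF P] by (rule horizontal_form_0[OF P])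
next
  fix m assume "m \<in> points (KW X W)"
  then have m: "m \<in> W" unfolding bundle_partD(4)[OF P] .
  obtain c where c: "c \<in> charts_at X (fst m)" by (rule bundle_part_chart_obtain[OF P m])
  have "horizontal_form X W q v = snd (part_chart X W c) q $ None * det (\<chi> k l. v l (part_chart X W c) $ Some k)"
    if "q \<in> fst (part_chart X W c)" "\<forall>k. v k \<in> tangent_space (KW X W) q" for q v
  proof -
    have q: "q \<in> W" "c \<in> charts_at X (fst q)" using part_chart_memberD[OF P charts_atD(3)[OF c] that(1)] by auto
    show ?thesis unfolding snd_part_chart kjoin_simps by (rule horizontal_form_eq[OF P inv q that(2)])
  qed
  then show "\<exists>b\<in>charts_at (KW X W) m. \<exists>F. holo_fun_on (snd b ` fst b) F \<and>
      (\<forall>q\<in>fst b. \<forall>v. (\<forall>k. v k \<in> tangent_space (KW X W) q) \<longrightarrow>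
        horizontal_form X W q v = F (snd b q) * det (\<chi> k l. v l b $ Some k))"
    by (intro bexI[OF _ part_chart_at(1)[OF P m c]] exI[of _ "\<lambda>u. u $ None"]) (simp add: holo_fun_on_nth)
qed

text \<open>
  The generated fields are vertical: their \<open>w\<close>-components vanish, which gives a zero
  column.
\<close>

lemma Cstar_horizontal_horizontal_form:
  fixes X :: "('a, 'd::finite) cmanifold"
  assumes P: "bundle_part X W" and inv: "scale_invariant W"
  shows "Cstar_horizontal (KW X W) (scaling_action (KW X W)) (horizontal_form X W)"
  unfolding Cstar_horizontal_def bundle_partD(4)[OF P]
proof (intro allI ballI impI)
  fix \<xi> m and v :: "'d \<Rightarrow> (('a, 'd) kpoint, 'd option) tvec" and k
  assume m: "m \<in> W" and v: "\<forall>l. v l \<in> tangent_space (KW X W) m"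
  obtain c where c: "c \<in> charts_at X (fst m)" by (rule bundle_part_chart_obtain[OF P m])
  let ?g = "generated_field (KW X W) (scaling_action (KW X W)) \<xi> m"
  note g = generated_field[OF P inv m c, of \<xi>]
  have t: "\<forall>l. (v(k := ?g)) l \<in> tangent_space (KW X W) m" using g(1) v by simp
  have "det (\<chi> i l. (v(k := ?g)) l (part_chart X W c) $ Some i) = 0"
    by (rule det_zero_column[of k]) (simp add: column_def vec_eq_iff g(2))
  then show "horizontal_form X W m (v(k := ?g)) = 0"
    unfolding horizontal_form_eq[OF P inv m c t] by simp
qed

text \<open>
  The differential leaves the \<open>w\<close>-components unchanged; here the factor
  \<open>a\<close> comes from the coefficient \<open>z\<close>.
\<close>

lemma pullback_horizontal_form:
  assumes P: "bundle_part X W" and P': "bundle_part X W'" and inv: "scale_invariant W" "scale_invariant W'"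
    and f: "fibre_scaling X W W' f a"
  shows "pullback (KW X W) (KW X W') f (horizontal_form X W') = scale_form a (horizontal_form X W)"
proof (intro ext)
  fix m v
  show "pullback (KW X W) (KW X W') f (horizontal_form X W') m v = scale_form a (horizontal_form X W) m v"
  proof (cases "m \<in> W \<and> (\<forall>k. v k \<in> tangent_space (KW X W) m)")
    case True
    then have m: "m \<in> W" and v: "\<And>k. v k \<in> tangent_space (KW X W) m" by auto
    obtain c c' where c: "c \<in> charts_at X (fst m)" and c': "c' \<in> charts_at X (fst (f m))" and fm: "f m \<in> W'"
      and h: "\<And>q. q \<in> W \<Longrightarrow> fst q \<in> fst c \<Longrightarrow> f q \<in> W' \<and> fst (f q) \<in> fst c' \<and>
         snd (induced_chart X c') (f q) = kscale a (snd (induced_chart X c) q)"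
      by (rule fibre_scalingE[OF f m]) blast
    let ?D = "differential (KW X W) (KW X W') f m"
    have "?D (v k) \<in> tangent_space (KW X W') (f m)" for k
      by (rule differential_tangent[OF bundle_partD(3)[OF P] bundle_partD(3)[OF P']
            holomorphic_map_fibre_scaling[OF P P' f] v]) (simp only: bundle_partD(4)[OF P] m)
    then have t: "\<forall>k. ?D (v k) \<in> tangent_space (KW X W') (f m)" ..
    have dv: "?D (v k) (part_chart X W' c') = kscale a (v k (part_chart X W c))" for k
      by (rule differential_fibre_scaling[OF P P' f m c c' fm h v])
    have z: "fibre_coord X c' (f m) = a * fibre_coord X c m"
      using h[OF m charts_atD(2)[OF c]] unfolding snd_induced_chart kscale_kjoin kjoin_eq_iff by blast
    have "pullback (KW X W) (KW X W') f (horizontal_form X W') m v = horizontal_form X W' (f m) (\<lambda>k. ?D (v k))"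
      unfolding pullback_def bundle_partD(4)[OF P] using True by simp
    also have "\<dots> = fibre_coord X c' (f m) * det (\<chi> k l. kscale a (v l (part_chart X W c)) $ Some k)"
      unfolding horizontal_form_eq[OF P' inv(2) fm c' t] dv ..
    also have "\<dots> = a * horizontal_form X W m v"
      unfolding horizontal_form_eq[OF P inv(1) m c conjunct2[OF True]] z by simp
    finally show ?thesis by (simp add: scale_form_def)
  next
    case False
    have "pullback (KW X W) (KW X W') f (horizontal_form X W') m v = 0"
      unfolding pullback_def bundle_partD(4)[OF P] by (rule if_not_P[OF False])
    then show ?thesis using horizontal_form_0[OF P False] by (simp add: scale_form_def)
  qed
qed

lemma fibre_scaling_inclusion:
  assumes P: "bundle_part X W" and P': "bundle_part X W'" and s: "W \<subseteq> W'"
  shows "fibre_scaling X W W' (\<lambda>m. m) 1"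
  unfolding fibre_scaling_def
proof
  fix m assume m: "m \<in> W"
  obtain c where c: "c \<in> charts_at X (fst m)" by (rule bundle_part_chart_obtain[OF P m])
  show "\<exists>c\<in>charts_at X (fst m). \<exists>c'\<in>charts X. \<forall>q\<in>W. fst q \<in> fst c \<longrightarrow> q \<in> W' \<and> fst q \<in> fst c' \<and>
       snd (induced_chart X c') q = kscale 1 (snd (induced_chart X c) q)"
    by (rule bexI[OF _ c], rule bexI[OF _ charts_atD(3)[OF c]]) (use s in \<open>auto simp: kscale_1\<close>)
qed

lemma fibre_scaling_fibre_mult:
  assumes P: "bundle_part X W" and inv: "scale_invariant W" and h: "h \<noteq> 0"
  shows "fibre_scaling X W W (fibre_mult h) h"
  unfolding fibre_scaling_def
proof
  fix m assume m: "m \<in> W"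
  obtain c where c: "c \<in> charts_at X (fst m)" by (rule bundle_part_chart_obtain[OF P m])
  show "\<exists>c\<in>charts_at X (fst m). \<exists>c'\<in>charts X. \<forall>q\<in>W. fst q \<in> fst c \<longrightarrow> fibre_mult h q \<in> W \<and>
       fst (fibre_mult h q) \<in> fst c' \<and> snd (induced_chart X c') (fibre_mult h q) = kscale h (snd (induced_chart X c) q)"
    by (rule bexI[OF _ c], rule bexI[OF _ charts_atD(3)[OF c]])
       (use inv h in \<open>auto simp: scale_invariant_def snd_induced_chart kscale_kjoin mult.commute\<close>)
qed

lemma scaling_action_Bij:
  assumes P: "bundle_part X W" and inv: "scale_invariant W" and h: "h \<noteq> 0"
  shows "scaling_action (KW X W) h \<in> Bij W"
    and "m \<in> W \<Longrightarrow> inv_into W (scaling_action (KW X W) h) m = fibre_mult h m"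
proof -
  have cl: "fibre_mult k q \<in> W" if "q \<in> W" "k \<noteq> 0" for q k
    using inv that unfolding scale_invariant_def by blast
  have "bij_betw (scaling_action (KW X W) h) W W"
    by (rule bij_betw_byWitness[of _ "fibre_mult h"])
       (use h cl in \<open>auto simp: scaling_action_eq[OF P]\<close>)
  then show B: "scaling_action (KW X W) h \<in> Bij W"
    by (simp add: Bij_def scaling_action_eq[OF P])
  assume m: "m \<in> W"
  have "scaling_action (KW X W) h (fibre_mult h m) = m"
    using h cl[OF m h] by (simp add: scaling_action_eq[OF P])
  moreover have "inj_on (scaling_action (KW X W) h) W" using B unfolding Bij_def bij_betw_def by blast
  ultimately show "inv_into W (scaling_action (KW X W) h) m = fibre_mult h m"
    using inv_into_f_f[OF _ cl[OF m h]] by metis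
qed

text \<open>
  \<open>\<Gamma>\<^sub>h\<close> is the pullback by the inverse of the action of \<open>h\<close>,
  which is multiplication by \<open>h\<close> in the fibres.
\<close>

lemma Gam_scaling_vol:
  assumes P: "bundle_part X W" and inv: "scale_invariant W" and h: "h \<noteq> 0"
  shows "Gam (KW X W) (scaling_action (KW X W)) h (vol X W) = scale_form h (vol X W)"
  unfolding Gam_def bundle_partD(4)[OF P]
  by (rule pullback_vol[OF P P fibre_scaling_cong[OF fibre_scaling_fibre_mult[OF P inv h]]])
     (rule scaling_action_Bij(2)[OF P inv h])

lemma group_action_scaling:
  assumes P: "bundle_part X W" and inv: "scale_invariant W"
  shows "group_action Cstar W (scaling_action (KW X W))"
proof (rule group_action.intro, rule group_hom.intro[OF group_Cstar group_BijGroup], rule group_hom_axioms.intro, rule homI)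
  fix h assume "h \<in> carrier Cstar"
  then show "scaling_action (KW X W) h \<in> carrier (BijGroup W)"
    using scaling_action_Bij(1)[OF P inv] by (simp add: BijGroup_def)
next
  fix h k assume hk: "h \<in> carrier Cstar" "k \<in> carrier Cstar"
  then have B: "scaling_action (KW X W) h \<in> Bij W" "scaling_action (KW X W) k \<in> Bij W"
    using scaling_action_Bij(1)[OF P inv] by auto
  have cl: "fibre_mult (inverse k) q \<in> W" if "q \<in> W" for q
    using inv that hk unfolding scale_invariant_def by simp
  show "scaling_action (KW X W) (h \<otimes>\<^bsub>Cstar\<^esub> k)
      = scaling_action (KW X W) h \<otimes>\<^bsub>BijGroup W\<^esub> scaling_action (KW X W) k"
    using B cl by (auto simp: BijGroup_def compose_def scaling_action_eq[OF P] fun_eq_iff mult.commute)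
qed

section \<open>The automorphism group\<close>

lemma biholomorphic_compose:
  assumes X: "holo_atlas X" and g: "biholomorphic X X g" and h: "biholomorphic X X h"
  shows "biholomorphic X X (compose (points X) g h)"
proof -
  let ?P = "points X"
  have bg: "bij_betw g ?P ?P" and bh: "bij_betw h ?P ?P" and hg: "holomorphic_map X X g" and hh: "holomorphic_map X X h"
    and ig: "holomorphic_map X X (inv_into ?P g)" and ih: "holomorphic_map X X (inv_into ?P h)"
    using g h unfolding biholomorphic_def by auto
  have b: "bij_betw (compose ?P g h) ?P ?P"
    by (rule bij_betw_compose[OF bh bg])
  have "holomorphic_map X X (compose ?P g h)"
    by (rule holomorphic_map_cong[OF holomorphic_map_compose[OF X X X hh hg]]) (simp add: compose_def)
  moreover have "holomorphic_map X X (inv_into ?P (compose ?P g h))"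
  proof (rule holomorphic_map_cong[OF holomorphic_map_compose[OF X X X ig ih]])
    fix p assume p: "p \<in> ?P"
    let ?q = "inv_into ?P h (inv_into ?P g p)"
    have gp: "inv_into ?P g p \<in> ?P" by (rule holomorphic_map_funcset[OF ig p])
    have q: "?q \<in> ?P" by (rule holomorphic_map_funcset[OF ih gp])
    have "compose ?P g h ?q = p"
      using q bij_betw_inv_into_right[OF bh gp] bij_betw_inv_into_right[OF bg p] by (simp add: compose_def)
    then show "(inv_into ?P h \<circ> inv_into ?P g) p = inv_into ?P (compose ?P g h) p"
      using bij_betw_inv_into_left[OF b q] by simp
  qed
  ultimately show ?thesis using b unfolding biholomorphic_def by blast
qed

lemma biholomorphic_inverse:
  assumes g: "biholomorphic X X g"
  shows "biholomorphic X X (restrict (inv_into (points X) g) (points X))"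
proof -
  let ?P = "points X" and ?i = "restrict (inv_into (points X) g) (points X)"
  have bg: "bij_betw g ?P ?P" and hg: "holomorphic_map X X g" and ig: "holomorphic_map X X (inv_into ?P g)"
    using g unfolding biholomorphic_def by auto
  have b: "bij_betw ?i ?P ?P" using bij_betw_inv_into[OF bg] by (simp cong: bij_betw_cong)
  have "holomorphic_map X X ?i" by (rule holomorphic_map_cong[OF ig]) simp
  moreover have "holomorphic_map X X (inv_into ?P ?i)"
  proof (rule holomorphic_map_cong[OF hg])
    fix p assume p: "p \<in> ?P"
    have gp: "g p \<in> ?P" by (rule holomorphic_map_funcset[OF hg p])
    then have "?i (g p) = p" using bij_betw_inv_into_left[OF bg p] by simp
    then show "g p = inv_into ?P ?i p" using bij_betw_inv_into_left[OF b gp] by simp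
  qed
  ultimately show ?thesis using b unfolding biholomorphic_def by blast
qed

lemma biholomorphic_id:
  assumes X: "holo_atlas X"
  shows "biholomorphic X X (\<lambda>p\<in>points X. p)"
proof -
  let ?P = "points X" and ?i = "\<lambda>p\<in>points X. p"
  have b: "bij_betw ?i ?P ?P" by (auto simp: bij_betw_def inj_on_def)
  have "holomorphic_map X X ?i" by (rule holomorphic_map_cong[OF holomorphic_map_id[OF X]]) simp
  moreover have "holomorphic_map X X (inv_into ?P ?i)"
  proof (rule holomorphic_map_cong[OF holomorphic_map_id[OF X]])
    fix p assume p: "p \<in> ?P"
    then show "p = inv_into ?P ?i p" using bij_betw_inv_into_left[OF b p] by simp
  qed
  ultimately show ?thesis using b unfolding biholomorphic_def by blast
qed

lemma subgroup_Aut: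
  assumes X: "holo_atlas X"
  shows "subgroup {f \<in> Bij (points X). biholomorphic X X f} (BijGroup (points X))"
proof (rule subgroup.intro)
  show "{f \<in> Bij (points X). biholomorphic X X f} \<subseteq> carrier (BijGroup (points X))"
    by (auto simp: BijGroup_def)
  show "\<one>\<^bsub>BijGroup (points X)\<^esub> \<in> {f \<in> Bij (points X). biholomorphic X X f}"
    using id_Bij[of "points X"] biholomorphic_id[OF X] by (simp add: BijGroup_def)
next
  fix f g assume "f \<in> {f \<in> Bij (points X). biholomorphic X X f}" "g \<in> {f \<in> Bij (points X). biholomorphic X X f}"
  then show "f \<otimes>\<^bsub>BijGroup (points X)\<^esub> g \<in> {f \<in> Bij (points X). biholomorphic X X f}"
    using compose_Bij[of f "points X" g] biholomorphic_compose[OF X, of f g] by (simp add: BijGroup_def)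
next
  fix f assume "f \<in> {f \<in> Bij (points X). biholomorphic X X f}"
  then show "inv\<^bsub>BijGroup (points X)\<^esub> f \<in> {f \<in> Bij (points X). biholomorphic X X f}"
    using restrict_inv_into_Bij[of f "points X"] biholomorphic_inverse[of X f] by (simp add: inv_BijGroup)
qed

lemma carrier_Aut: "carrier (Aut X) = {f \<in> Bij (points X). biholomorphic X X f}"
  by (simp add: Aut_def)

lemma mult_Aut: "f \<in> carrier (Aut X) \<Longrightarrow> g \<in> carrier (Aut X) \<Longrightarrow> f \<otimes>\<^bsub>Aut X\<^esub> g = compose (points X) f g"
  by (simp add: Aut_def BijGroup_def)

lemma group_Aut: "holo_atlas X \<Longrightarrow> group (Aut X)"
  unfolding Aut_def by (rule subgroup.subgroup_is_group[OF subgroup_Aut group_BijGroup])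

lemma AutD:
  assumes "g \<in> carrier (Aut X)"
  shows "bij_betw g (points X) (points X)" "holomorphic_map X X g" "holomorphic_map X X (inv_into (points X) g)"
    "g \<in> Bij (points X)" "biholomorphic X X g"
  using assms unfolding carrier_Aut biholomorphic_def by auto

lemma inverse_Aut:
  assumes g: "g \<in> carrier (Aut X)"
  shows "restrict (inv_into (points X) g) (points X) \<in> carrier (Aut X)"
  using restrict_inv_into_Bij[OF AutD(4)[OF g]] biholomorphic_inverse[OF AutD(5)[OF g]]
  unfolding carrier_Aut by blast

lemma group_action_Aut:
  assumes X: "holo_atlas X"
  shows "group_action (Aut X) (points X) (\<lambda>g. g)"
proof (rule group_action.intro, rule group_hom.intro[OF group_Aut[OF X] group_BijGroup], rule group_hom_axioms.intro, rule homI)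
  fix g assume "g \<in> carrier (Aut X)"
  then show "g \<in> carrier (BijGroup (points X))" by (simp add: carrier_Aut BijGroup_def)
qed (simp add: Aut_def)

section \<open>The lift of automorphisms to the canonical bundle\<close>

definition transport_chart :: "('a, 'd::finite) cmanifold \<Rightarrow> ('a \<Rightarrow> 'a) \<Rightarrow> ('a, 'd) chart \<Rightarrow> ('a, 'd) chart" where
  "transport_chart X g c = (g ` fst c, snd c \<circ> inv_into (points X) g)"

text \<open>
  The chart \<open>c'\<close> is \<open>c\<close> transported by \<open>g\<close>.
  Only the values on the domain count, so that transport by \<open>g\<close> after \<open>h\<close>
  and transport by their composition yield related charts although the maps may differ off the
  domains.
\<close>

definition charts_related :: "('a, 'd::finite) cmanifold \<Rightarrow> ('a \<Rightarrow> 'a) \<Rightarrow> ('a, 'd) chart \<Rightarrow> ('a, 'd) chart \<Rightarrow> bool" where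
  "charts_related X g c c' \<longleftrightarrow> c \<in> charts X \<and> c' \<in> charts X \<and> fst c' = g ` fst c \<and>
     (\<forall>q\<in>fst c. snd c' (g q) = snd c q)"

text \<open>
  Since \<open>g\<close> and its inverse are holomorphic, \<open>w \<circ> g\<^sup>-\<^sup>1\<close>
  is again a chart of the maximal atlas.
\<close>

lemma transport_chart_related:
  assumes X: "holo_atlas X" and g: "g \<in> carrier (Aut X)" and c: "c \<in> charts X"
  shows "charts_related X g c (transport_chart X g c)"
proof -
  let ?g' = "inv_into (points X) g" and ?c' = "transport_chart X g c"
  note G = AutD[OF g] and t = chartsD[OF c]
  have cP: "fst c \<subseteq> points X" by (rule charts_subset_points[OF c])
  have gg: "?g' (g q) = q" if "q \<in> fst c" for q
    using bij_betw_inv_into_left[OF G(1)] that cP by blast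
  have mem: "p \<in> g ` V \<longleftrightarrow> p \<in> points X \<and> ?g' p \<in> V" if "V \<subseteq> points X" for V p
  proof
    assume "p \<in> g ` V"
    then obtain q where q: "q \<in> V" "p = g q" by blast
    then show "p \<in> points X \<and> ?g' p \<in> V"
      using that bij_betw_inv_into_left[OF G(1)] bij_betwE[OF G(1)] by auto
  next
    assume p: "p \<in> points X \<and> ?g' p \<in> V"
    then have "p = g (?g' p)" using bij_betw_inv_into_right[OF G(1)] by simp
    then show "p \<in> g ` V" using p by blast
  qed
  have img: "openin (mtop X) (g ` V)" if "openin (mtop X) V" for V
  proof -
    have "g ` V = {p \<in> points X. ?g' p \<in> V}" using mem[OF openin_subset[OF that]] by blast
    then show ?thesis
      using continuous_map_open_vimage[OF holomorphic_map_continuous[OF G(3)] that] by simp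
  qed
  have s: "snd ?c' (g q) = snd c q" if "q \<in> fst c" for q
    by (simp add: transport_chart_def gg[OF that])
  have f: "fst ?c' = g ` fst c" by (simp add: transport_chart_def)
  have T: "topological_chart (mtop X) ?c'"
    unfolding topological_chart_iff f
  proof (intro conjI allI impI)
    show "openin (mtop X) (g ` fst c)" by (rule img[OF topological_chartD(1)[OF t]])
    show "inj_on (snd ?c') (g ` fst c)"
      using topological_chartD(2)[OF t] by (auto simp: inj_on_def s)
    show "open (snd ?c' ` (V \<inter> g ` fst c))" if V: "openin (mtop X) V" for V
    proof -
      have "snd ?c' ` (V \<inter> g ` fst c) = snd c ` ({q \<in> points X. g q \<in> V} \<inter> fst c)"
      proof (intro equalityI subsetI)
        fix u assume "u \<in> snd ?c' ` (V \<inter> g ` fst c)"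
        then obtain q where q: "q \<in> fst c" "g q \<in> V" "u = snd ?c' (g q)" by blast
        then show "u \<in> snd c ` ({q \<in> points X. g q \<in> V} \<inter> fst c)" using cP s[OF q(1)] by auto
      next
        fix u assume "u \<in> snd c ` ({q \<in> points X. g q \<in> V} \<inter> fst c)"
        then obtain q where q: "q \<in> fst c" "g q \<in> V" "u = snd c q" by blast
        then show "u \<in> snd ?c' ` (V \<inter> g ` fst c)" using s[OF q(1)] by (intro image_eqI[of _ _ "g q"]) auto
      qed
      then show ?thesis
        using topological_chartD(4)[OF t continuous_map_open_vimage[OF holomorphic_map_continuous[OF G(2)] V]] by simp
    qed
    show "openin (mtop X) {p \<in> g ` fst c. snd ?c' p \<in> W}" if W: "open W" for W
    proof -
      have "{p \<in> g ` fst c. snd ?c' p \<in> W} = g ` {q \<in> fst c. snd c q \<in> W}" using s by auto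
      then show ?thesis using img[OF topological_chartD(5)[OF t W]] by simp
    qed
  qed
  have "?c' \<in> charts X"
  proof (rule chartsI[OF X T])
    fix p assume "p \<in> fst ?c'"
    then obtain q where q: "q \<in> fst c" "p = g q" unfolding f by blast
    have pP: "p \<in> points X" using q cP bij_betwE[OF G(1)] by blast
    obtain b where b: "b \<in> charts_at X p" by (rule atlas_chart_at[OF X pP])
    have gp: "?g' p = q" using gg[OF q(1)] q(2) by simp
    have cq: "c \<in> charts_at X q" using c q(1) by (simp add: charts_at_def)
    have "cdiff_at (snd c \<circ> ?g' \<circ> chart_inv b) (snd b p)"
      by (rule holomorphic_mapD[OF G(3) b]) (simp add: gp cq)
    then have 1: "cdiff_at (transition b ?c') (snd b p)"
      by (simp add: transition_def transport_chart_def)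
    have "cdiff_at (snd b \<circ> g \<circ> chart_inv c) (snd c q)"
      by (rule holomorphic_mapD[OF G(2) cq]) (use b q in simp)
    moreover have "\<forall>u\<in>snd c ` fst c. transition ?c' b u = (snd b \<circ> g \<circ> chart_inv c) u"
    proof
      fix u assume "u \<in> snd c ` fst c"
      then obtain r where r: "r \<in> fst c" "u = snd c r" by blast
      have "chart_inv ?c' u = g r"
        using chart_inv_left[OF T, of "g r"] r s[OF r(1)] by (simp add: f)
      then show "transition ?c' b u = (snd b \<circ> g \<circ> chart_inv c) u"
        using chart_inv_left[OF t r(1)] r(2) by (simp add: transition_def)
    qed
    ultimately have "cdiff_at (transition ?c' b) (snd c q)"
      using cdiff_at_cong(1)[OF topological_chartD(3)[OF t] imageI[OF q(1)]] by blast
    then have "cdiff_at (transition ?c' b) (snd ?c' p)" using s[OF q(1)] q(2) by simp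
    then show "\<exists>b\<in>charts_at X p. cdiff_at (transition b ?c') (snd b p) \<and> cdiff_at (transition ?c' b) (snd ?c' p)"
      using 1 b by blast
  qed
  then show ?thesis unfolding charts_related_def using c s f by blast
qed

definition lift_point :: "('a, 'd::finite) cmanifold \<Rightarrow> ('a \<Rightarrow> 'a) \<Rightarrow> ('a, 'd) kpoint \<Rightarrow> ('a, 'd) kpoint" where
  "lift_point X g m = (g (fst m), \<lambda>v. if \<forall>i. v i \<in> tangent_space X (g (fst m))
     then snd m (\<lambda>i. differential X X (inv_into (points X) g) (g (fst m)) (v i)) else 0)"

lemma lift_action_eq: "lift_action X M g = (\<lambda>m\<in>points M. lift_point X g m)"
  by (simp add: lift_action_def lift_point_def)

text \<open>
  In the transported chart the differential of \<open>g\<^sup>-\<^sup>1\<close> preserves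
  components, so the lift preserves induced coordinates.
\<close>

lemma lift_point_eq:
  assumes X: "holo_atlas X" and g: "g \<in> carrier (Aut X)" and r: "charts_related X g c c'"
    and m: "m \<in> KX_points X" and mc: "fst m \<in> fst c"
  shows "lift_point X g m = kpoint_of X c' (snd (induced_chart X c) m)"
proof -
  let ?p = "fst m" and ?g' = "inv_into (points X) g"
  note G = AutD[OF g]
  have c: "c \<in> charts X" and c': "c' \<in> charts X" and f: "fst c' = g ` fst c"
    and s: "\<And>q. q \<in> fst c \<Longrightarrow> snd c' (g q) = snd c q" using r unfolding charts_related_def by auto
  have cp: "c \<in> charts_at X ?p" using c mc by (simp add: charts_at_def)
  have cp': "c' \<in> charts_at X (g ?p)" using c' mc by (simp add: charts_at_def f)
  have i: "chart_inv c' (snd c ?p) = g ?p"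
    using chart_inv_left[OF charts_atD(1,2)[OF cp']] s[OF mc] by simp
  have gg: "?g' (g q) = q" if "q \<in> fst c" for q
    using bij_betw_inv_into_left[OF G(1)] that charts_subset_points[OF c] by blast
  have "snd m (\<lambda>i. differential X X ?g' (g ?p) (v i)) = fibre_coord X c m * det (\<chi> k l. v l c' $ k)"
    if v: "\<forall>i. v i \<in> tangent_space X (g ?p)" for v
  proof -
    let ?w = "\<lambda>l. differential X X ?g' (g ?p) (v l)"
    have "?w l \<in> tangent_space X (?g' (g ?p))" for l
      by (rule differential_tangent[OF X X G(3) v[rule_format] charts_atD(4)[OF cp']])
    then have w: "\<forall>l. ?w l \<in> tangent_space X ?p" unfolding gg[OF mc] ..
    have "?w l c = v l c'" for l
    proof (rule differential_local_rep[OF X X G(3) v[rule_format] cp', where V = "fst c'" and g = "\<lambda>u. u" and D = "\<lambda>u. u"])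
      show "c \<in> charts_at X (?g' (g ?p))" unfolding gg[OF mc] by (rule cp)
      show "openin (mtop X) (fst c')" by (rule topological_chartD(1)[OF chartsD[OF c']])
      show "g ?p \<in> fst c'" by (rule charts_atD(2)[OF cp'])
      show "snd c (?g' q) = snd c' q" if "q \<in> fst c'" for q
        using that gg s unfolding f by auto
    qed simp
    then show ?thesis
      unfolding top_form_eq_det[OF X KX_pointsD(2)[OF m] cp w] by (simp add: fibre_coord_def mult.commute)
  qed
  then show ?thesis
    unfolding lift_point_def kpoint_of_def form_of_def snd_induced_chart kjoin_simps i by (auto simp: fun_eq_iff)
qed

lemma lift_point_induced:
  assumes X: "holo_atlas X" and g: "g \<in> carrier (Aut X)" and r: "charts_related X g c c'"
    and m: "m \<in> KX_points X" and mc: "fst m \<in> fst c"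
  shows "lift_point X g m \<in> KX_points X" "fst (lift_point X g m) \<in> fst c'"
    "snd (induced_chart X c') (lift_point X g m) = snd (induced_chart X c) m"
proof -
  have c': "c' \<in> charts X" and f: "fst c' = g ` fst c" and s: "snd c' (g (fst m)) = snd c (fst m)"
    using r mc unfolding charts_related_def by auto
  have k: "kbase (snd (induced_chart X c) m) \<in> snd c' ` fst c'"
    using mc s by (auto simp: snd_induced_chart f image_iff intro!: bexI[of _ "fst m"])
  show "lift_point X g m \<in> KX_points X" "fst (lift_point X g m) \<in> fst c'"
    "snd (induced_chart X c') (lift_point X g m) = snd (induced_chart X c) m"
    using kpoint_of[OF X c' k] unfolding lift_point_eq[OF assms] by (auto simp: fst_induced_chart)
qed

lemma KX_point_chart:
  assumes X: "holo_atlas X" and m: "m \<in> KX_points X"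
  obtains c where "c \<in> charts X" "fst m \<in> fst c"
  using atlas_chart_at[OF X KX_pointsD(1)[OF m]] charts_atD(2,3) by metis

text \<open>Both sides have the same coordinates in the chart transported twice.\<close>

lemma lift_point_compose:
  assumes X: "holo_atlas X" and g: "g \<in> carrier (Aut X)" and h: "h \<in> carrier (Aut X)" and m: "m \<in> KX_points X"
  shows "lift_point X (compose (points X) g h) m = lift_point X g (lift_point X h m)"
proof -
  obtain c where c: "c \<in> charts X" "fst m \<in> fst c" by (rule KX_point_chart[OF X m])
  let ?c1 = "transport_chart X h c"
  let ?c2 = "transport_chart X g ?c1"
  have r1: "charts_related X h c ?c1" by (rule transport_chart_related[OF X h c(1)])
  then have c1: "?c1 \<in> charts X" unfolding charts_related_def by blast
  have r2: "charts_related X g ?c1 ?c2" by (rule transport_chart_related[OF X g c1])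
  have gh: "compose (points X) g h \<in> carrier (Aut X)"
    using group.is_monoid[OF group_Aut[OF X]] monoid.m_closed g h mult_Aut[OF g h] by metis
  have "compose (points X) g h q = g (h q)" if "q \<in> fst c" for q
    using that charts_subset_points[OF c(1)] by (auto simp: compose_def)
  then have r: "charts_related X (compose (points X) g h) c ?c2"
    using r1 r2 unfolding charts_related_def by (auto simp: image_iff)
  note L = lift_point_induced[OF X h r1 m c(2)]
  show ?thesis
    unfolding lift_point_eq[OF X gh r m c(2)] lift_point_eq[OF X g r2 L(1,2)] L(3) ..
qed

lemma lift_point_id:
  assumes X: "holo_atlas X" and m: "m \<in> KX_points X"
  shows "lift_point X (\<lambda>p\<in>points X. p) m = m"
proof -
  obtain c where c: "c \<in> charts X" "fst m \<in> fst c" by (rule KX_point_chart[OF X m])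
  have i: "(\<lambda>p\<in>points X. p) \<in> carrier (Aut X)"
    using id_Bij[of "points X"] biholomorphic_id[OF X] unfolding carrier_Aut by blast
  have "(\<lambda>p\<in>points X. p) q = q" if "q \<in> fst c" for q
    using that charts_subset_points[OF c(1)] by auto
  then have r: "charts_related X (\<lambda>p\<in>points X. p) c c"
    using c(1) unfolding charts_related_def by (auto simp: image_iff)
  have "m \<in> fst (induced_chart X c)" using m c(2) by (simp add: fst_induced_chart)
  then show ?thesis unfolding lift_point_eq[OF X i r m c(2)] by (rule kpoint_of_left[OF X c(1)])
qed

text \<open>
  For a part with this property the lifts of \<open>g\<close> and of
  \<open>g\<^sup>-\<^sup>1\<close> restrict to mutually inverse maps.
\<close>

definition lift_invariant :: "('a, 'd::finite) cmanifold \<Rightarrow> ('a, 'd) kpoint set \<Rightarrow> bool" where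
  "lift_invariant X W \<longleftrightarrow> (\<forall>g\<in>carrier (Aut X). \<forall>m\<in>W. lift_point X g m \<in> W)"

lemma fibre_scaling_lift:
  assumes P: "bundle_part X W" and inv: "lift_invariant X W" and g: "g \<in> carrier (Aut X)"
  shows "fibre_scaling X W W (lift_point X g) 1"
  unfolding fibre_scaling_def
proof
  fix m assume m: "m \<in> W"
  note X = bundle_partD(1)[OF P]
  obtain c where c: "c \<in> charts_at X (fst m)" by (rule bundle_part_chart_obtain[OF P m])
  have r: "charts_related X g c (transport_chart X g c)" by (rule transport_chart_related[OF X g charts_atD(3)[OF c]])
  show "\<exists>c\<in>charts_at X (fst m). \<exists>c'\<in>charts X. \<forall>q\<in>W. fst q \<in> fst c \<longrightarrow> lift_point X g q \<in> W \<and>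
       fst (lift_point X g q) \<in> fst c' \<and> snd (induced_chart X c') (lift_point X g q) = kscale 1 (snd (induced_chart X c) q)"
  proof (rule bexI[OF _ c], rule bexI[of _ "transport_chart X g c"], intro ballI impI conjI)
    fix q assume q: "q \<in> W" "fst q \<in> fst c"
    show "lift_point X g q \<in> W" using inv g q(1) unfolding lift_invariant_def by blast
    have qK: "q \<in> KX_points X" using q bundle_partD(5)[OF P] by blast
    show "fst (lift_point X g q) \<in> fst (transport_chart X g c)"
      "snd (induced_chart X (transport_chart X g c)) (lift_point X g q) = kscale 1 (snd (induced_chart X c) q)"
      using lift_point_induced(2,3)[OF X g r qK q(2)] by (simp_all add: kscale_1)
  qed (use r in \<open>simp add: charts_related_def\<close>)
qed

lemma lift_action_KW:
  "bundle_part X W \<Longrightarrow> lift_action X (KW X W) g = (\<lambda>m\<in>W. lift_point X g m)"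
  by (simp only: lift_action_eq bundle_partD(4))

lemma lift_action_Bij:
  assumes P: "bundle_part X W" and inv: "lift_invariant X W" and g: "g \<in> carrier (Aut X)"
  defines "g' \<equiv> restrict (inv_into (points X) g) (points X)"
  shows "lift_action X (KW X W) g \<in> Bij W"
    and "m \<in> W \<Longrightarrow> inv_into W (lift_action X (KW X W) g) m = lift_point X g' m"
proof -
  note X = bundle_partD(1)[OF P]
  have g': "g' \<in> carrier (Aut X)" unfolding g'_def by (rule inverse_Aut[OF g])
  have cl: "lift_point X g q \<in> W" "lift_point X g' q \<in> W" "q \<in> KX_points X" if "q \<in> W" for q
    using inv that g g' bundle_partD(5)[OF P] unfolding lift_invariant_def by auto
  have c1: "compose (points X) g' g = (\<lambda>p\<in>points X. p)"
    unfolding g'_def by (rule Bij_compose_restrict_eq[OF AutD(4)[OF g]])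
  have c2: "compose (points X) g g' = (\<lambda>p\<in>points X. p)"
    using bij_betw_inv_into_right[OF AutD(1)[OF g]] by (auto simp: g'_def compose_def fun_eq_iff)
  have l1: "lift_point X g' (lift_point X g q) = q" if "q \<in> W" for q
    using lift_point_compose[OF X g' g cl(3)[OF that]] lift_point_id[OF X cl(3)[OF that]] unfolding c1 by simp
  have l2: "lift_point X g (lift_point X g' q) = q" if "q \<in> W" for q
    using lift_point_compose[OF X g g' cl(3)[OF that]] lift_point_id[OF X cl(3)[OF that]] unfolding c2 by simp
  have b: "bij_betw (lift_action X (KW X W) g) W W"
    by (rule bij_betw_byWitness[of _ "lift_point X g'"])
       (use cl l1 l2 in \<open>auto simp: lift_action_KW[OF P]\<close>)
  then show "lift_action X (KW X W) g \<in> Bij W"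
    by (simp add: Bij_def lift_action_KW[OF P])
  assume m: "m \<in> W"
  have "lift_action X (KW X W) g (lift_point X g' m) = m"
    using cl(2)[OF m] l2[OF m] by (simp add: lift_action_KW[OF P])
  then show "inv_into W (lift_action X (KW X W) g) m = lift_point X g' m"
    using bij_betw_inv_into_left[OF b cl(2)[OF m]] by simp
qed

lemma fibre_scaling_lift_inverse:
  assumes P: "bundle_part X W" and inv: "lift_invariant X W" and g: "g \<in> carrier (Aut X)"
  shows "fibre_scaling X W W (inv_into W (lift_action X (KW X W) g)) 1"
  by (rule fibre_scaling_cong[OF fibre_scaling_lift[OF P inv inverse_Aut[OF g]]]) (rule lift_action_Bij(2)[OF P inv g])

lemma scale_form_1: "scale_form 1 \<omega> = \<omega>"
  by (simp add: scale_form_def)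

lemma Gam_lift_vol:
  assumes P: "bundle_part X W" and inv: "lift_invariant X W" and g: "g \<in> carrier (Aut X)"
  shows "Gam (KW X W) (lift_action X (KW X W)) g (vol X W) = vol X W"
  unfolding Gam_def bundle_partD(4)[OF P] pullback_vol[OF P P fibre_scaling_lift_inverse[OF P inv g]]
  by (rule scale_form_1)

lemma Gam_lift_horizontal_form:
  assumes P: "bundle_part X W" and inv: "lift_invariant X W" "scale_invariant W" and g: "g \<in> carrier (Aut X)"
  shows "Gam (KW X W) (lift_action X (KW X W)) g (horizontal_form X W) = horizontal_form X W"
  unfolding Gam_def bundle_partD(4)[OF P]
    pullback_horizontal_form[OF P P inv(2) inv(2) fibre_scaling_lift_inverse[OF P inv(1) g]]
  by (rule scale_form_1)

lemma biholomorphic_lift: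
  assumes P: "bundle_part X W" and inv: "lift_invariant X W" and g: "g \<in> carrier (Aut X)"
  shows "biholomorphic (KW X W) (KW X W) (lift_action X (KW X W) g)"
  unfolding biholomorphic_def bundle_partD(4)[OF P]
proof (intro conjI)
  show "bij_betw (lift_action X (KW X W) g) W W"
    using lift_action_Bij(1)[OF P inv g] unfolding Bij_def by blast
  show "holomorphic_map (KW X W) (KW X W) (lift_action X (KW X W) g)"
    by (rule holomorphic_map_fibre_scaling[OF P P fibre_scaling_cong[OF fibre_scaling_lift[OF P inv g]]])
       (simp add: lift_action_KW[OF P])
  show "holomorphic_map (KW X W) (KW X W) (inv_into W (lift_action X (KW X W) g))"
    by (rule holomorphic_map_fibre_scaling[OF P P fibre_scaling_lift_inverse[OF P inv g]])
qed

lemma group_action_lift: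
  assumes P: "bundle_part X W" and inv: "lift_invariant X W"
  shows "group_action (Aut X) W (lift_action X (KW X W))"
proof (rule group_action.intro, rule group_hom.intro[OF group_Aut[OF bundle_partD(1)[OF P]] group_BijGroup],
    rule group_hom_axioms.intro, rule homI)
  fix g assume "g \<in> carrier (Aut X)"
  then show "lift_action X (KW X W) g \<in> carrier (BijGroup W)"
    using lift_action_Bij(1)[OF P inv] by (simp add: BijGroup_def)
next
  fix g h assume g: "g \<in> carrier (Aut X)" and h: "h \<in> carrier (Aut X)"
  have cl: "lift_point X h q \<in> W" "q \<in> KX_points X" if "q \<in> W" for q
    using inv that h bundle_partD(5)[OF P] unfolding lift_invariant_def by auto
  have "lift_action X (KW X W) (g \<otimes>\<^bsub>Aut X\<^esub> h) = compose W (lift_action X (KW X W) g) (lift_action X (KW X W) h)"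
    using cl lift_point_compose[OF bundle_partD(1)[OF P] g h]
    by (auto simp: mult_Aut[OF g h] lift_action_KW[OF P] compose_def fun_eq_iff)
  then show "lift_action X (KW X W) (g \<otimes>\<^bsub>Aut X\<^esub> h)
      = lift_action X (KW X W) g \<otimes>\<^bsub>BijGroup W\<^esub> lift_action X (KW X W) h"
    using lift_action_Bij(1)[OF P inv g] lift_action_Bij(1)[OF P inv h] by (simp add: BijGroup_def)
qed

section \<open>The complement of the zero section\<close>

definition nonzero_part :: "('a, 'd::finite) cmanifold \<Rightarrow> ('a, 'd) kpoint set" where
  "nonzero_part X = {m \<in> KX_points X. snd m \<noteq> (\<lambda>v. 0)}"

lemma KX_times_eq: "KX_times X = KW X (nonzero_part X)"
  by (simp add: KX_times_def nonzero_part_def)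

lemma zero_form_iff:
  assumes X: "holo_atlas X" and m: "m \<in> KX_points X" and c: "c \<in> charts_at X (fst m)"
  shows "snd m = (\<lambda>v. 0) \<longleftrightarrow> fibre_coord X c m = 0"
proof
  assume "snd m = (\<lambda>v. 0)"
  then show "fibre_coord X c m = 0" by (simp add: fibre_coord_def)
next
  assume "fibre_coord X c m = 0"
  then have "form_of X c (fst m) (fibre_coord X c m) = (\<lambda>v. 0)" by (simp add: form_of_def fun_eq_iff)
  then show "snd m = (\<lambda>v. 0)"
    using form_of_eq[OF X KX_pointsD(2)[OF m] c] by (simp add: fibre_coord_def)
qed

lemma nonzero_part_iff:
  assumes X: "holo_atlas X" and m: "m \<in> KX_points X" and c: "c \<in> charts X" "fst m \<in> fst c"
  shows "m \<in> nonzero_part X \<longleftrightarrow> fibre_coord X c m \<noteq> 0"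
  using zero_form_iff[OF X m, of c] c m by (simp add: nonzero_part_def charts_at_def)

text \<open>
  In an induced chart the complement of the zero section is given by \<open>z \<noteq> 0\<close>.
\<close>

lemma bundle_part_nonzero:
  assumes X: "holo_atlas X"
  shows "bundle_part X (nonzero_part X)"
  unfolding bundle_part_def openin_KX[OF X]
proof (intro conjI X ballI)
  show "nonzero_part X \<subseteq> KX_points X" by (auto simp: nonzero_part_def)
  fix c assume c: "c \<in> charts X"
  let ?b = "induced_chart X c"
  have o: "open {u :: complex ^ 'b option. u $ None \<noteq> 0}"
  proof -
    have "open ((\<lambda>u :: complex ^ 'b option. u $ None) -` (- {0}))"
      by (intro open_vimage continuous_intros)
    then show ?thesis by (simp add: vimage_def)
  qed
  have nz: "m \<in> nonzero_part X \<longleftrightarrow> snd ?b m $ None \<noteq> 0" if "m \<in> fst ?b" for m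
    using nonzero_part_iff[OF X _ c, of m] that by (simp add: fst_induced_chart snd_induced_chart)
  have "snd ?b ` (nonzero_part X \<inter> fst ?b) = {u. u $ None \<noteq> 0} \<inter> snd ?b ` fst ?b"
    using nz by auto
  then show "open (snd ?b ` (nonzero_part X \<inter> fst ?b))"
    using open_Int[OF o topological_chartD(3)[OF topological_chart_induced[OF X c]]] by simp
qed

lemma fibre_mult_KX_points:
  assumes X: "holo_atlas X" and m: "m \<in> KX_points X"
  shows "fibre_mult h m \<in> KX_points X"
proof -
  obtain c where c: "c \<in> charts_at X (fst m)" by (rule atlas_chart_at[OF X KX_pointsD(1)[OF m]])
  have "(\<lambda>v. form_of X c (fst m) (fibre_coord X c m) v * h) = form_of X c (fst m) (fibre_coord X c m * h)"
    by (simp add: form_of_def fun_eq_iff)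
  then have "(\<lambda>v. snd m v * h) = form_of X c (fst m) (fibre_coord X c m * h)"
    unfolding fibre_coord_def form_of_eq[OF X KX_pointsD(2)[OF m] c, symmetric] .
  then show ?thesis
    using form_of_alternating[OF X c] KX_pointsD(1)[OF m] by (simp add: fibre_mult_def KX_points_def)
qed

lemma scale_invariant_KX: "holo_atlas X \<Longrightarrow> scale_invariant (KX_points X)"
  unfolding scale_invariant_def using fibre_mult_KX_points by blast

lemma scale_invariant_nonzero:
  assumes X: "holo_atlas X"
  shows "scale_invariant (nonzero_part X)"
  unfolding scale_invariant_def
proof (intro ballI allI impI)
  fix m and h :: complex assume m: "m \<in> nonzero_part X" and h: "h \<noteq> 0"
  then have mK: "m \<in> KX_points X" by (simp add: nonzero_part_def)
  obtain c where c: "c \<in> charts X" "fst m \<in> fst c" by (rule KX_point_chart[OF X mK])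
  show "fibre_mult h m \<in> nonzero_part X"
    using m h nonzero_part_iff[OF X mK c] nonzero_part_iff[OF X fibre_mult_KX_points[OF X mK, of h] c(1)] c(2) by simp
qed

lemma lift_invariant_KX:
  assumes X: "holo_atlas X"
  shows "lift_invariant X (KX_points X)"
  unfolding lift_invariant_def
proof (intro ballI)
  fix g m assume g: "g \<in> carrier (Aut X)" and m: "m \<in> KX_points X"
  obtain c where c: "c \<in> charts X" "fst m \<in> fst c" by (rule KX_point_chart[OF X m])
  show "lift_point X g m \<in> KX_points X"
    by (rule lift_point_induced(1)[OF X g transport_chart_related[OF X g c(1)] m c(2)])
qed

lemma lift_invariant_nonzero:
  assumes X: "holo_atlas X"
  shows "lift_invariant X (nonzero_part X)"
  unfolding lift_invariant_def
proof (intro ballI)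
  fix g m assume g: "g \<in> carrier (Aut X)" and m: "m \<in> nonzero_part X"
  then have mK: "m \<in> KX_points X" by (simp add: nonzero_part_def)
  obtain c where c: "c \<in> charts X" "fst m \<in> fst c" by (rule KX_point_chart[OF X mK])
  let ?c' = "transport_chart X g c"
  have r: "charts_related X g c ?c'" by (rule transport_chart_related[OF X g c(1)])
  note L = lift_point_induced[OF X g r mK c(2)]
  have "fibre_coord X ?c' (lift_point X g m) = fibre_coord X c m"
    using L(3) unfolding snd_induced_chart kjoin_eq_iff by blast
  moreover have "?c' \<in> charts X" using r unfolding charts_related_def by blast
  ultimately show "lift_point X g m \<in> nonzero_part X"
    using nonzero_part_iff[OF X mK c] nonzero_part_iff[OF X L(1) _ L(2)] m by simp
qed

lemma lift_fibre_mult_commute: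
  assumes X: "holo_atlas X" and g: "g \<in> carrier (Aut X)" and m: "m \<in> KX_points X"
  shows "lift_point X g (fibre_mult h m) = fibre_mult h (lift_point X g m)"
  by (auto simp: lift_point_def fibre_mult_def)

section \<open>Local triviality\<close>

lemma holomorphic_map_fst_KW:
  assumes P: "bundle_part X W"
  shows "holomorphic_map (KW X W) X fst"
proof -
  note X = bundle_partD(1)[OF P] and K = bundle_part_KX[OF bundle_partD(1)[OF P]]
  have "holomorphic_map (KW X W) (KX X) (\<lambda>m. m)"
    using holomorphic_map_fibre_scaling[OF P K fibre_scaling_inclusion[OF P K bundle_partD(5)[OF P]]]
    unfolding KW_KX[OF X] .
  from holomorphic_map_compose[OF bundle_partD(3)[OF P] holo_atlas_KX[OF X] X this holomorphic_map_fst_KX[OF X]]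
  show ?thesis by (simp add: comp_def)
qed

text \<open>
  Both \<open>m \<mapsto> (\<pi> m, z m)\<close> and its inverse are, in the induced chart and the
  product chart, mere renamings of coordinates.  The chart is taken from the given atlas because
  only such charts enter the atlas of the product.
\<close>

lemma local_trivialisation:
  fixes X :: "('a, 'd::finite) cmanifold"
  assumes X: "holo_atlas X" and c: "c \<in> atlas X"
  defines "V \<equiv> {m \<in> nonzero_part X. fst m \<in> fst c}"
  shows "biholomorphic (open_submanifold (KX_times X) V)
    (prod_manifold (open_submanifold X (fst c)) Cstar_manifold) (\<lambda>m. (fst m, fibre_coord X c m))"
proof -
  let ?S = "open_submanifold (KX_times X) V" and ?W = "nonzero_part X"
  let ?N = "prod_manifold (open_submanifold X (fst c)) Cstar_manifold"
  let ?\<Phi> = "\<lambda>m. (fst m, fibre_coord X c m)"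
  let ?\<Psi> = "\<lambda>(p, z). kpoint_of X c (kjoin z (snd c p))"
  let ?b = "part_chart X ?W c" and ?d = "prod_chart c Cchart"
  note P = bundle_part_nonzero[OF X]
  note D = bundle_partD[OF P]
  have cX: "c \<in> charts X" using c atlas_subset_charts[OF X] by blast
  note tc = chartsD[OF cX]
  have U: "openin (mtop X) (fst c)" by (rule topological_chartD(1)[OF tc])
  have V: "openin (mtop (KX_times X)) V"
    using continuous_map_open_vimage[OF holomorphic_map_continuous[OF holomorphic_map_fst_KW[OF P]] U]
    unfolding KX_times_eq D(4) V_def .
  have aT: "holo_atlas (KX_times X)" unfolding KX_times_eq by (rule D(3))
  have S: "holo_atlas ?S" by (rule holo_atlas_open_submanifold[OF aT V])
  have pS: "points ?S = V" by (rule points_open_submanifold[OF V])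
  have N: "holo_atlas ?N"
    by (rule holo_atlas_prod_manifold[OF holo_atlas_open_submanifold[OF X U] holo_atlas_Cstar])
  have pN: "points ?N = fst c \<times> (UNIV - {0})"
    using points_open_submanifold[OF U] by simp
  have fb: "fst ?b = V" unfolding V_def by (rule fst_part_chart[OF P])
  have bV: "?b \<in> charts_at ?S m" if "m \<in> V" for m
  proof -
    have "m \<in> ?W" "c \<in> charts_at X (fst m)" using that cX by (auto simp: V_def charts_at_def)
    then have "?b \<in> charts_at (KX_times X) m" unfolding KX_times_eq by (rule part_chart_at(1)[OF P])
    then show ?thesis unfolding charts_at_open_submanifold[OF aT V] by (simp add: fb)
  qed
  have tb: "topological_chart (mtop ?S) ?b" if "m \<in> V" for m using charts_atD(1)[OF bV[OF that]] .
  have ca: "c \<in> atlas (open_submanifold X (fst c))"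
    using c unfolding atlas_open_submanifold by (intro image_eqI[of _ _ c]) auto
  have da: "?d \<in> atlas ?N" using ca unfolding atlas_prod_manifold Cstar_manifold_simps by blast
  have dc: "?d \<in> charts ?N" using da atlas_subset_charts[OF N] by blast
  have fd: "fst ?d = fst c \<times> (UNIV - {0})" by simp
  have nz: "fibre_coord X c m \<noteq> 0" "m \<in> KX_points X" "fst m \<in> fst c" if "m \<in> V" for m
  proof -
    show K: "m \<in> KX_points X" and F: "fst m \<in> fst c" using that by (auto simp: V_def nonzero_part_def)
    show "fibre_coord X c m \<noteq> 0" using nonzero_part_iff[OF X K cX F] that by (simp add: V_def)
  qed
  have \<Phi>V: "?\<Phi> m \<in> fst ?d" if "m \<in> V" for m using nz[OF that] by simp
  have \<Psi>: "?\<Psi> y \<in> V" "snd (induced_chart X c) (?\<Psi> y) = kjoin (snd y) (snd c (fst y))" if "y \<in> fst ?d" for y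
  proof -
    have k: "kbase (kjoin (snd y) (snd c (fst y))) \<in> snd c ` fst c" using that by auto
    note K = kpoint_of[OF X cX k]
    show s: "snd (induced_chart X c) (?\<Psi> y) = kjoin (snd y) (snd c (fst y))"
      using K(2) by (simp add: case_prod_beta)
    have m: "?\<Psi> y \<in> KX_points X" "fst (?\<Psi> y) \<in> fst c"
      using K(1) by (auto simp: fst_induced_chart case_prod_beta)
    have "fibre_coord X c (?\<Psi> y) = snd y" using s unfolding snd_induced_chart kjoin_eq_iff by blast
    then have "?\<Psi> y \<in> ?W" using nonzero_part_iff[OF X m(1) cX m(2)] that by auto
    then show "?\<Psi> y \<in> V" using m(2) unfolding V_def by blast
  qed
  have \<Psi>\<Phi>: "?\<Psi> (?\<Phi> m) = m" if "m \<in> V" for m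
  proof -
    have "m \<in> fst (induced_chart X c)" using nz[OF that] by (simp add: fst_induced_chart)
    from kpoint_of_left[OF X cX this] show ?thesis by (simp add: snd_induced_chart)
  qed
  have \<Phi>\<Psi>: "?\<Phi> (?\<Psi> y) = y" if "y \<in> fst ?d" for y
  proof -
    have "fibre_coord X c (?\<Psi> y) = snd y" "snd c (fst (?\<Psi> y)) = snd c (fst y)"
      using \<Psi>(2)[OF that] unfolding snd_induced_chart kjoin_eq_iff by auto
    moreover have "fst (?\<Psi> y) = fst y"
      using inj_onD[OF topological_chartD(2)[OF tc] calculation(2)] \<Psi>(1)[OF that] nz(3) that by auto
    ultimately show ?thesis by (simp add: prod_eq_iff)
  qed
  have bij: "bij_betw ?\<Phi> V (fst ?d)"
    by (rule bij_betw_byWitness[of _ ?\<Psi>]) (use \<Psi>\<Phi> \<Phi>\<Psi> \<Phi>V \<Psi>(1) in blast)+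
  have hol\<Phi>: "holomorphic_map ?S ?N ?\<Phi>"
  proof (rule holomorphic_mapI[OF S N])
    fix m assume "m \<in> points ?S"
    then have m: "m \<in> V" unfolding pS .
    have "holo_map_on (snd ?b ` fst ?b) (\<lambda>u. vjoin (kbase u) (\<chi> i. u $ None) :: complex ^ ('d + 1))"
      unfolding holo_map_on_iff
      by (intro ballI cdiff_at_vjoin cdiff_at_kbase) (simp add: cdiff_at_componentwise holo_fun_on_nth)
    from holo_map_on_rep[OF tb[OF m] this, of "\<lambda>m. snd ?d (?\<Phi> m)"]
    have "holo_map_on (snd ?b ` fst ?b) ((\<lambda>m. snd ?d (?\<Phi> m)) \<circ> chart_inv ?b)"
      by (simp add: snd_part_chart Cchart_def)
    moreover have "(\<lambda>m. snd ?d (?\<Phi> m)) \<circ> chart_inv ?b = snd ?d \<circ> ?\<Phi> \<circ> chart_inv ?b" by (simp add: comp_def)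
    ultimately show "\<exists>b\<in>charts_at ?S m. \<exists>d\<in>charts ?N. ?\<Phi> ` fst b \<subseteq> fst d \<and>
        holo_map_on (snd b ` fst b) (snd d \<circ> ?\<Phi> \<circ> chart_inv b)"
      using bV[OF m] dc \<Phi>V by (intro bexI[of _ ?b] bexI[of _ ?d]) (auto simp: fb)
  qed
  have hol\<Psi>: "holomorphic_map ?N ?S ?\<Psi>"
  proof (rule holomorphic_mapI[OF N S])
    fix y assume "y \<in> points ?N"
    then have y: "y \<in> fst ?d" unfolding pN fd .
    have yd: "?d \<in> charts_at ?N y" using dc y by (simp add: charts_at_def)
    have "holo_map_on (snd ?d ` fst ?d) (\<lambda>u :: complex ^ ('d + 1). kjoin (u $ Inr 1) (vleft u))"
      unfolding holo_map_on_iff cdiff_at_componentwise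
    proof (intro ballI allI)
      fix u :: "complex ^ ('d + 1)" and k :: "'d option"
      show "holo_fun_on {u} (\<lambda>u :: complex ^ ('d + 1). kjoin (u $ Inr 1) (vleft u) $ k)"
        by (cases k) (simp_all add: holo_fun_on_nth)
    qed
    moreover have "snd ?b (?\<Psi> q) = kjoin (snd ?d q $ Inr 1) (vleft (snd ?d q))" if "q \<in> fst ?d" for q
      using \<Psi>(2)[OF that] by (simp add: snd_part_chart' case_prod_beta prod_chart_def)
    ultimately have "holo_map_on (snd ?d ` fst ?d) ((\<lambda>q. snd ?b (?\<Psi> q)) \<circ> chart_inv ?d)"
      by (rule holo_map_on_rep[OF charts_atD(1)[OF yd]])
    moreover have "(\<lambda>q. snd ?b (?\<Psi> q)) \<circ> chart_inv ?d = snd ?b \<circ> ?\<Psi> \<circ> chart_inv ?d" by (simp add: comp_def)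
    moreover have "?\<Psi> ` fst ?d \<subseteq> fst ?b" using \<Psi>(1) unfolding fb by blast
    ultimately show "\<exists>b\<in>charts_at ?N y. \<exists>d\<in>charts ?S. ?\<Psi> ` fst b \<subseteq> fst d \<and>
        holo_map_on (snd b ` fst b) (snd d \<circ> ?\<Psi> \<circ> chart_inv b)"
      using yd charts_atD(3)[OF bV[OF \<Psi>(1)[OF y]]] by (intro bexI[of _ ?d] bexI[of _ ?b]) simp_all
  qed
  have "holomorphic_map ?N ?S (inv_into (points ?S) ?\<Phi>)"
  proof (rule holomorphic_map_cong[OF hol\<Psi>])
    fix y assume "y \<in> points ?N"
    then have y: "y \<in> fst ?d" unfolding pN fd .
    show "?\<Psi> y = inv_into (points ?S) ?\<Phi> y"
      using bij_betw_inv_into_left[OF bij \<Psi>(1)[OF y]] unfolding \<Phi>\<Psi>[OF y] pS by simp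
  qed
  then show ?thesis using bij hol\<Phi> unfolding biholomorphic_def pS pN fd by blast
qed

lemma principal_bundle_KX_times:
  assumes X: "complex_manifold X" and cpt: "compact_space (mtop X)"
  shows "principal_bundle Cstar Cstar_manifold (scaling_action (KX_times X)) (KX_times X) X fst"
proof -
  have aX: "holo_atlas X" using X unfolding complex_manifold_iff by blast
  note P = bundle_part_nonzero[OF aX] and I = scale_invariant_nonzero[OF aX]
  note D = bundle_partD[OF P]
  have pT: "points (KX_times X) = nonzero_part X" unfolding KX_times_eq by (rule D(4))
  have \<rho>: "scaling_action (KX_times X) h m = fibre_mult (inverse h) m" if "m \<in> nonzero_part X" for h m
    using that by (simp add: KX_times_eq scaling_action_eq[OF P])
  show ?thesis unfolding principal_bundle_def pT
  proof (intro conjI ballI complex_lie_group_Cstar X)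
    show "complex_manifold (KX_times X)"
      unfolding KX_times_eq by (rule complex_manifold_open_submanifold[OF complex_manifold_KX[OF X cpt] D(2)])
    show "holomorphic_map (KX_times X) X fst" unfolding KX_times_eq by (rule holomorphic_map_fst_KW[OF P])
    show "group_action Cstar (nonzero_part X) (scaling_action (KX_times X))"
      unfolding KX_times_eq by (rule group_action_scaling[OF P I])
    show "fst (scaling_action (KX_times X) h m) = fst m" if "m \<in> nonzero_part X" for h m
      by (simp add: \<rho>[OF that])
    fix x assume x: "x \<in> points X"
    obtain c where c: "c \<in> atlas X" "c \<in> charts_at X x" by (rule atlas_chart_at[OF aX x])
    let ?\<Phi> = "\<lambda>m. (fst m, fibre_coord X c m)"
    show "\<exists>U \<Phi>. openin (mtop X) U \<and> x \<in> U \<and>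
        biholomorphic (open_submanifold (KX_times X) {m \<in> nonzero_part X. fst m \<in> U})
          (prod_manifold (open_submanifold X U) Cstar_manifold) \<Phi> \<and>
        (\<forall>m\<in>nonzero_part X. fst m \<in> U \<longrightarrow> fst (\<Phi> m) = fst m) \<and>
        (\<forall>h\<in>carrier Cstar. \<forall>m\<in>nonzero_part X. fst m \<in> U \<longrightarrow>
           \<Phi> (scaling_action (KX_times X) h m) = (fst m, snd (\<Phi> m) \<otimes>\<^bsub>Cstar\<^esub> inv\<^bsub>Cstar\<^esub> h))"
    proof (rule exI[of _ "fst c"], rule exI[of _ ?\<Phi>], intro conjI ballI impI)
      show "openin (mtop X) (fst c)" by (rule topological_chartD(1)[OF charts_atD(1)[OF c(2)]])
      show "x \<in> fst c" by (rule charts_atD(2)[OF c(2)])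
      show "biholomorphic (open_submanifold (KX_times X) {m \<in> nonzero_part X. fst m \<in> fst c})
          (prod_manifold (open_submanifold X (fst c)) Cstar_manifold) ?\<Phi>"
        by (rule local_trivialisation[OF aX c(1)])
      show "?\<Phi> (scaling_action (KX_times X) h m) = (fst m, snd (?\<Phi> m) \<otimes>\<^bsub>Cstar\<^esub> inv\<^bsub>Cstar\<^esub> h)"
        if "h \<in> carrier Cstar" "m \<in> nonzero_part X" for h m
        by (simp add: \<rho>[OF that(2)] inv_Cstar[OF that(1)])
    qed simp
  qed
qed

lemma equivariant_CY_structure_KX_times:
  assumes X: "complex_manifold X" and cpt: "compact_space (mtop X)"
  shows "equivariant_CY_structure (Aut X) (lift_action X (KX_times X)) (\<lambda>g. g)
     Cstar Cstar_manifold (scaling_action (KX_times X)) (KX_times X) X fst (vol X (nonzero_part X)) (\<lambda>h. h)"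
proof -
  have aX: "holo_atlas X" using X unfolding complex_manifold_iff by blast
  note P = bundle_part_nonzero[OF aX] and I = scale_invariant_nonzero[OF aX] and L = lift_invariant_nonzero[OF aX]
  note D = bundle_partD[OF P]
  have cl: "fibre_mult (inverse h) m \<in> nonzero_part X" if "h \<noteq> 0" "m \<in> nonzero_part X" for h m
    using I that unfolding scale_invariant_def by simp
  have ll: "lift_point X g m \<in> nonzero_part X" if "g \<in> carrier (Aut X)" "m \<in> nonzero_part X" for g m
    using L that unfolding lift_invariant_def by blast
  have "equivariant_principal_bundle (Aut X) (lift_action X (KX_times X)) (\<lambda>g. g)
     Cstar Cstar_manifold (scaling_action (KX_times X)) (KX_times X) X fst"
    unfolding equivariant_principal_bundle_def
  proof (intro conjI ballI principal_bundle_KX_times[OF X cpt] group_action_Aut[OF aX])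
    show "group_action (Aut X) (points (KX_times X)) (lift_action X (KX_times X))"
      unfolding KX_times_eq D(4) by (rule group_action_lift[OF P L])
    fix g assume g: "g \<in> carrier (Aut X)"
    show "biholomorphic (KX_times X) (KX_times X) (lift_action X (KX_times X) g)"
      unfolding KX_times_eq by (rule biholomorphic_lift[OF P L g])
    show "biholomorphic X X g" by (rule AutD(5)[OF g])
    fix m assume "m \<in> points (KX_times X)"
    then have m: "m \<in> nonzero_part X" unfolding KX_times_eq D(4) .
    then have mK: "m \<in> KX_points X" using D(5) by blast
    show "fst (lift_action X (KX_times X) g m) = g (fst m)"
      using m by (simp add: KX_times_eq lift_action_KW[OF P] lift_point_def)
    fix h assume "h \<in> carrier Cstar"
    then have h: "h \<noteq> 0" by simp
    show "lift_action X (KX_times X) g (scaling_action (KX_times X) h m)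
        = scaling_action (KX_times X) h (lift_action X (KX_times X) g m)"
      using m cl[OF h m] ll[OF g m] lift_fibre_mult_commute[OF aX g mK]
      by (simp add: KX_times_eq lift_action_KW[OF P] scaling_action_eq[OF P])
  qed
  moreover have "holomorphic_form (KX_times X) (vol X (nonzero_part X))"
    unfolding KX_times_eq by (rule holomorphic_form_vol[OF P])
  moreover have "nowhere_vanishing (KX_times X) (vol X (nonzero_part X))"
    unfolding KX_times_eq by (rule nowhere_vanishing_vol[OF P])
  moreover have "\<forall>g\<in>carrier (Aut X). Gam (KX_times X) (lift_action X (KX_times X)) g (vol X (nonzero_part X))
      = vol X (nonzero_part X)"
    unfolding KX_times_eq using Gam_lift_vol[OF P L] by blast
  moreover have "(\<lambda>h. h) \<in> hom Cstar Cstar" by (simp add: hom_def)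
  moreover have "\<forall>h\<in>carrier Cstar. Gam (KX_times X) (scaling_action (KX_times X)) h (vol X (nonzero_part X))
      = scale_form h (vol X (nonzero_part X))"
    unfolding KX_times_eq using Gam_scaling_vol[OF P I] by simp
  ultimately show ?thesis
    unfolding equivariant_CY_structure_def using holomorphic_map_id[OF holo_atlas_Cstar] by blast
qed

text \<open>
  The inclusion of the complement of the zero section is the identity in induced charts.
\<close>

lemma restrict_to_nonzero_part:
  assumes X: "holo_atlas X"
  shows "restrict_to_KX_times X (vol X (KX_points X)) = vol X (nonzero_part X)"
    and "restrict_to_KX_times X (horizontal_form X (KX_points X)) = horizontal_form X (nonzero_part X)"
proof -
  note P = bundle_part_nonzero[OF X] and K = bundle_part_KX[OF X]
  have f: "fibre_scaling X (nonzero_part X) (KX_points X) (\<lambda>m. m) 1"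
    by (rule fibre_scaling_inclusion[OF P K bundle_partD(5)[OF P]])
  show "restrict_to_KX_times X (vol X (KX_points X)) = vol X (nonzero_part X)"
    using pullback_vol[OF P K f] unfolding restrict_to_KX_times_def KX_times_eq KW_KX[OF X] scale_form_1 .
  show "restrict_to_KX_times X (horizontal_form X (KX_points X)) = horizontal_form X (nonzero_part X)"
    using pullback_horizontal_form[OF P K scale_invariant_nonzero[OF X] scale_invariant_KX[OF X] f]
    unfolding restrict_to_KX_times_def KX_times_eq KW_KX[OF X] scale_form_1 .
qed

theorem theorem6p3:
  fixes X :: "('a, 'd::finite) cmanifold"
  assumes "complex_manifold X" and "compact_space (mtop X)"
  shows
    "(\<forall>g\<in>carrier (Aut X).
        Gam (KX X) (lift_action X (KX X)) g (canonical_form X) = canonical_form X) \<and>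
     ((\<forall>h\<in>carrier Cstar.
         Gam (KX X) (scaling_action (KX X)) h (canonical_form X) = scale_form h (canonical_form X)) \<and>
      equivariant_CY_structure
        (Aut X) (lift_action X (KX_times X)) (\<lambda>g. g)
        Cstar Cstar_manifold (scaling_action (KX_times X))
        (KX_times X) X fst
        (restrict_to_KX_times X (canonical_form X)) (\<lambda>h. h)) \<and>
     (let \<theta> = interior_mult (KX_times X) (x0 (KX_times X)) (restrict_to_KX_times X (canonical_form X))
      in \<theta> = restrict_to_KX_times X (interior_mult (KX X) (x0 (KX X)) (canonical_form X)) \<and>
         holomorphic_form (KX_times X) \<theta> \<and>
         (\<forall>g\<in>carrier (Aut X). Gam (KX_times X) (lift_action X (KX_times X)) g \<theta> = \<theta>) \<and>
         Cstar_horizontal (KX_times X) (scaling_action (KX_times X)) \<theta>) \<and>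
     (\<forall>c\<in>charts X. \<forall>m\<in>fst (induced_chart X c).
        interior_mult (KX X) (x0 (KX X)) (canonical_form X) m =
        (\<lambda>v. fibre_coord X c m * wedge_coords (KX X) (induced_chart X c) Some m v))"
proof -
  have X: "holo_atlas X" using assms(1) unfolding complex_manifold_iff by blast
  let ?K = "KX_points X" and ?W = "nonzero_part X"
  note K = bundle_part_KX[OF X] and P = bundle_part_nonzero[OF X]
  note IK = scale_invariant_KX[OF X] and I = scale_invariant_nonzero[OF X]
  note LK = lift_invariant_KX[OF X] and L = lift_invariant_nonzero[OF X]
  have hK: "interior_mult (KX X) (x0 (KX X)) (vol X ?K) = horizontal_form X ?K"
    unfolding horizontal_form_def KW_KX[OF X] ..
  have hW: "interior_mult (KX_times X) (x0 (KX_times X)) (vol X ?W) = horizontal_form X ?W"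
    unfolding horizontal_form_def KX_times_eq ..
  have 1: "\<forall>g\<in>carrier (Aut X). Gam (KX X) (lift_action X (KX X)) g (vol X ?K) = vol X ?K"
    using Gam_lift_vol[OF K LK] unfolding KW_KX[OF X] by blast
  have 2: "\<forall>h\<in>carrier Cstar. Gam (KX X) (scaling_action (KX X)) h (vol X ?K) = scale_form h (vol X ?K)"
    using Gam_scaling_vol[OF K IK] unfolding KW_KX[OF X] by simp
  have 3: "\<forall>g\<in>carrier (Aut X). Gam (KX_times X) (lift_action X (KX_times X)) g (horizontal_form X ?W) = horizontal_form X ?W"
    unfolding KX_times_eq using Gam_lift_horizontal_form[OF P L I] by blast
  have 4: "holomorphic_form (KX_times X) (horizontal_form X ?W)"
    unfolding KX_times_eq by (rule holomorphic_form_horizontal[OF P I])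
  have 5: "Cstar_horizontal (KX_times X) (scaling_action (KX_times X)) (horizontal_form X ?W)"
    unfolding KX_times_eq by (rule Cstar_horizontal_horizontal_form[OF P I])
  have 6: "horizontal_form X ?K m = (\<lambda>v. fibre_coord X c m * wedge_coords (KX X) (induced_chart X c) Some m v)"
    if c: "c \<in> charts X" and m: "m \<in> fst (induced_chart X c)" for c m
  proof
    fix v
    have mK: "m \<in> ?K" and cm: "c \<in> charts_at X (fst m)"
      using c m by (auto simp: fst_induced_chart charts_at_def)
    show "horizontal_form X ?K m v = fibre_coord X c m * wedge_coords (KX X) (induced_chart X c) Some m v"
    proof (cases "\<forall>k. v k \<in> tangent_space (KX X) m")
      case True
      then show ?thesis
        using horizontal_form_eq[OF K IK mK cm, of v] m
        unfolding KW_KX[OF X] part_chart_KX wedge_coords_def by simp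
    next
      case False
      have "wedge_coords (KX X) (induced_chart X c) Some m v = 0"
        unfolding wedge_coords_def by (rule if_not_P) (use False in blast)
      moreover have "horizontal_form X ?K m v = 0"
        by (rule horizontal_form_0[OF K]) (use False in \<open>simp only: KW_KX[OF X] simp_thms\<close>)
      ultimately show ?thesis by simp
    qed
  qed
  show ?thesis
    unfolding canonical_form_eq_vol[OF X] restrict_to_nonzero_part[OF X] hK hW Let_def
    using 1 2 equivariant_CY_structure_KX_times[OF assms] 3 4 5 6 by blast
qed

end
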